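(* Let $p:\mathbb{C}\to\mathbb{R}_+$ be a $\mathcal{C}^1$ function, let $S((z,t),(w,s))$ ($z,w\in\mathbb{C}$, $s,t\in\mathbb{R}$) be the Szegő kernel of $H^2(\partial\Omega_p)$ and, for $\tau>0$, let $K_\tau(z,w)$ be the Bergman kernel of $H_\tau$ (all defined in the context). Then $$S((z,t),(w,s))=\int_0^{\infty}K_{\tau}(z,w)\,e^{-\tau (p(z)+p(w))}\,e^{-i\tau (s-t)}\, d\tau .$$
   Context: $\Omega_p=\{(z_1,z_2)\in\mathbb{C}^2:\ \Im z_2>p(z_1)\}$. The boundary $\partial\Omega_p$ is identified with $\mathbb{C}\times\mathbb{R}$ via $(z,t)\mapsto(z,t+ip(z))$, and $d\lambda$ denotes Lebesgue measure on $\mathbb{C}$. $H^2(\partial\Omega_p)$ is the space of all functions $f\in L^2(\partial\Omega_p)=L^2(d\lambda(z)\,dt)$ which are holomorphic in $\Omega_p$ and satisfy $\sup_{y>0}\int_{\mathbb{C}}\int_{\mathbb{R}}|f(z,t+ip(z)+iy)|^2\,d\lambda(z)\,dt<\infty$. The Szegő kernel $S((z,t),(w,s))$ is the integral kernel of the orthogonal projection (Szegő projection) of $L^2(d\lambda\,dt)$ onto $H^2(\partial\Omega_p)$. For $\tau>0$, $H_\tau$ is the space of all entire functions $f$ on $\mathbb{C}$ with $\int_{\mathbb{C}}|f(z)|^2e^{-2\tau p(z)}\,d\lambda(z)<\infty$, and $K_\tau(z,w)$ is its Bergman (reproducing) kernel. The weight function $p$ is supposed to have a reasonable growth behavior so that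 the corresponding spaces of entire functions are nontrivial (for example, $p(z)$ a polynomial in $\Re z$ and $\Im z$).
   Formalization: With Lebesgue measures dλ, dt and dτ the right-hand side needs a factor 1/(2π), which is added; the identity is proved for the kernels as distributions, and almost everywhere on open sets where the τ-integral is locally absolutely integrable. *)

theory Defs
  imports "HOL-Complex_Analysis.Complex_Analysis"
begin

definition C1_function :: "(complex \<Rightarrow> real) \<Rightarrow> bool" where
  "C1_function p \<longleftrightarrow>
     (\<exists>p' :: complex \<Rightarrow> complex \<Rightarrow>\<^sub>L real.
        (\<forall>z. (p has_derivative blinfun_apply (p' z)) (at z)) \<and> continuous_on UNIV p')"

definition Omega :: "(complex \<Rightarrow> real) \<Rightarrow> (complex \<times> complex) set" where
  "Omega p = {(z1, z2). Im z2 > p z1}"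

definition holomorphic2_on :: "(complex \<times> complex \<Rightarrow> complex) \<Rightarrow> (complex \<times> complex) set \<Rightarrow> bool" where
  "holomorphic2_on F D \<longleftrightarrow>
     (\<forall>x\<in>D. \<exists>a b. (F has_derivative (\<lambda>(u, v). a * u + b * v)) (at x within D))"


text \<open>The boundary of \<open>Omega p\<close> is identified with \<open>complex \<times> real\<close>, with Lebesgue measure.\<close>

definition L2 :: "(complex \<times> real \<Rightarrow> complex) set" where
  "L2 = {f \<in> borel_measurable lborel. integrable lborel (\<lambda>x. (cmod (f x))\<^sup>2)}"

definition L2_inner :: "(complex \<times> real \<Rightarrow> complex) \<Rightarrow> (complex \<times> real \<Rightarrow> complex) \<Rightarrow> complex" where
  "L2_inner f g = (LINT x|lborel. f x * cnj (g x))"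

definition lift :: "(complex \<Rightarrow> real) \<Rightarrow> real \<Rightarrow> complex \<times> real \<Rightarrow> complex \<times> complex" where
  "lift p y = (\<lambda>(z, t). (z, complex_of_real t + \<i> * complex_of_real (p z) + \<i> * complex_of_real y))"

text \<open>A function on the boundary belongs to the Hardy space if it is the boundary value
  (limit in \<open>L2\<close> of the vertical translates) of a holomorphic function on \<open>Omega p\<close>
  with uniformly bounded \<open>L2\<close> norms.\<close>

definition H2 :: "(complex \<Rightarrow> real) \<Rightarrow> (complex \<times> real \<Rightarrow> complex) set" where
  "H2 p = {f \<in> L2. \<exists>F. holomorphic2_on F (Omega p) \<and>
       (SUP y\<in>{0<..}. \<integral>\<^sup>+ x. ennreal ((cmod (F (lift p y x)))\<^sup>2) \<partial>lborel) < \<infinity> \<and>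
       ((\<lambda>y. \<integral>\<^sup>+ x. ennreal ((cmod (F (lift p y x) - f x))\<^sup>2) \<partial>lborel) \<longlongrightarrow> 0) (at_right 0)}"

text \<open>Orthogonal projection of \<open>L2\<close> onto \<open>H2 p\<close>; its values are determined up to null sets.\<close>

definition szego_projection ::
    "(complex \<Rightarrow> real) \<Rightarrow> (complex \<times> real \<Rightarrow> complex) \<Rightarrow> complex \<times> real \<Rightarrow> complex" where
  "szego_projection p f =
     (SOME g. g \<in> H2 p \<and> (\<forall>h\<in>H2 p. L2_inner (\<lambda>x. f x - g x) h = 0))"

definition weighted_entire :: "(complex \<Rightarrow> real) \<Rightarrow> real \<Rightarrow> (complex \<Rightarrow> complex) set" where
  "weighted_entire p \<tau> = {f. f holomorphic_on UNIV \<and>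
     integrable lborel (\<lambda>z. (cmod (f z))\<^sup>2 * exp (- 2 * \<tau> * p z))}"

definition bergman_kernel :: "(complex \<Rightarrow> real) \<Rightarrow> real \<Rightarrow> complex \<Rightarrow> complex \<Rightarrow> complex" where
  "bergman_kernel p \<tau> z w =
     (THE k. k \<in> weighted_entire p \<tau> \<and>
        (\<forall>f\<in>weighted_entire p \<tau>.
           f w = (LINT v|lborel. f v * cnj (k v) * complex_of_real (exp (- 2 * \<tau> * p v))))) z"


definition supp :: "('a::topological_space \<Rightarrow> complex) \<Rightarrow> 'a set" where
  "supp f = closure {x. f x \<noteq> 0}"

definition test_function :: "(complex \<times> real \<Rightarrow> complex) \<Rightarrow> bool" where
  "test_function f \<longleftrightarrow> continuous_on UNIV f \<and> compact (supp f)"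

text \<open>The Szego projection is in general a singular integral operator, so the integral kernel
  of an operator \<open>T\<close> on \<open>L2\<close> is understood weakly: the first point \<open>x\<close> is
  the argument of \<open>T f\<close>, the second point \<open>y\<close> the variable integrated against
  \<open>f\<close>, and \<open>T f\<close> is tested against \<open>g\<close>.\<close>

definition tested :: "((complex \<times> real) \<times> (complex \<times> real) \<Rightarrow> complex) \<Rightarrow>
    (complex \<times> real \<Rightarrow> complex) \<Rightarrow> (complex \<times> real \<Rightarrow> complex) \<Rightarrow>
    (complex \<times> real) \<times> (complex \<times> real) \<Rightarrow> complex" where
  "tested k f g = (\<lambda>(x, y). k (x, y) * f y * cnj (g x))"

text \<open>A locally integrable function \<open>S\<close> on the open set \<open>U\<close> is the integral kernel
  of \<open>T\<close> there.\<close>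

definition integral_kernel_on ::
    "((complex \<times> real) \<times> (complex \<times> real)) set \<Rightarrow>
     ((complex \<times> real \<Rightarrow> complex) \<Rightarrow> complex \<times> real \<Rightarrow> complex) \<Rightarrow>
     ((complex \<times> real) \<times> (complex \<times> real) \<Rightarrow> complex) \<Rightarrow> bool" where
  "integral_kernel_on U T S \<longleftrightarrow>
     (\<forall>C. compact C \<and> C \<subseteq> U \<longrightarrow> set_integrable lborel C S) \<and>
     (\<forall>f g. test_function f \<and> test_function g \<and> supp g \<times> supp f \<subseteq> U \<longrightarrow>
        L2_inner (T f) g = (LINT q|lborel. tested S f g q))"

text \<open>The (distributional) kernel of \<open>T\<close> is \<open>c\<close> times the integral of the
  functions \<open>k \<tau>\<close> over \<open>\<tau> > 0\<close>, convergent in the sense of distributions.\<close>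

definition integral_kernel_is_integral ::
    "((complex \<times> real \<Rightarrow> complex) \<Rightarrow> complex \<times> real \<Rightarrow> complex) \<Rightarrow> complex \<Rightarrow>
     (real \<Rightarrow> (complex \<times> real) \<times> (complex \<times> real) \<Rightarrow> complex) \<Rightarrow> bool" where
  "integral_kernel_is_integral T c k \<longleftrightarrow>
     (\<forall>f g. test_function f \<and> test_function g \<longrightarrow>
        (\<forall>\<tau>>0. integrable lborel (tested (k \<tau>) f g)) \<and>
        set_integrable lborel {0<..} (\<lambda>\<tau>. LINT q|lborel. tested (k \<tau>) f g q) \<and>
        L2_inner (T f) g = c * (LBINT \<tau>:{0<..}. LINT q|lborel. tested (k \<tau>) f g q))"

text \<open>Kernels are taken with respect to unnormalised Lebesgue measure on both \<open>complex \<times> real\<close>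
  and the \<open>\<tau>\<close>-axis, so Fourier inversion in the real variable puts a factor
  \<open>1 / (2 * pi)\<close> in front of the integral of this function over \<open>\<tau> > 0\<close>.\<close>

definition szego_integrand ::
    "(complex \<Rightarrow> real) \<Rightarrow> real \<Rightarrow> (complex \<times> real) \<times> (complex \<times> real) \<Rightarrow> complex" where
  "szego_integrand p \<tau> = (\<lambda>((z, t), (w, s)).
     bergman_kernel p \<tau> z w * complex_of_real (exp (- \<tau> * (p z + p w)))
       * exp (- \<i> * complex_of_real (\<tau> * (s - t))))"

end

theory Submission
  imports Defs "HOL-Probability.Probability"
begin

text \<open>For a test function \<open>f\<close>, let \<open>f\<^sub>\<tau>\<close> be its Fourier transform in the real variable and \<open>u\<^sub>\<tau>\<close> the
  Bergman projection of \<open>exp (\<tau> p) f\<^sub>\<tau>\<close> to the space of entire functions with weight \<open>exp (- 2 \<tau> p)\<close>. The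
  function \<open>1 / (2 \<pi>) \<integral> u\<^sub>\<tau>(z) exp (\<i> \<tau> \<zeta>) d\<tau>\<close> over \<open>\<tau> > 0\<close> is holomorphic on the domain, because the kernel is
  locally at most \<open>C exp (\<tau> (p z + p w + 2 \<delta>))\<close> for every \<open>\<delta> > 0\<close>, and by Bessel's inequality its vertical
  translates converge in \<open>L2\<close> to some \<open>g\<close> in the Hardy space.

  That \<open>f - g\<close> is orthogonal to a Hardy function with extension \<open>H\<close> needs to be checked only for
  \<open>H(z, \<zeta> + \<i> y) (1 - \<i> \<epsilon> \<zeta>)\<^sup>-\<^sup>2\<close>, where \<open>p \<ge> 0\<close> keeps the denominator away from zero. These functions are
  integrable on every horizontal line, so their Fourier transforms are given pointwise: they vanish
  for \<open>\<tau> < 0\<close>, decay exponentially for \<open>\<tau> > 0\<close> and are \<open>exp (- \<tau> (p + y))\<close> times entire functions in \<open>z\<close>, to which the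
  reproducing property of \<open>u\<^sub>\<tau>\<close> applies. Hence \<open>g\<close> is the Szego projection of \<open>f\<close>.\<close>

section \<open>Integration preliminaries\<close>

text \<open>The obstacle on the Fourier side is that only absolutely convergent transforms are
  available pointwise. Plancherel's theorem is therefore replaced by two facts: the norm inequality
  with constant 2 \<pi> for an integrable function, and the multiplication formula, which gives
  exact pairings once one factor is damped. Damping by exp (- \<tau> y) serves for the projected
  function. The inverse square serves for Hardy functions, since a bounded function times a single
  inverse factor need not be integrable on a line. A second obstacle is that the Bergman kernel is
  defined separately for each \<tau> by a definite description, so measurability in \<tau> has to be
  earned; it comes from monotonicity. A third is that nothing forces the \<tau>-integral of the
  kernels to converge: for p(z) = |z|^2 it diverges on the diagonal. The formula is thus an identity
  of pairings first, and an identity of functions on open sets where Fubini applies. Weighted spaces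
  reduced to 0 are allowed; for such \<tau> the kernel and u vanish.\<close>

lemma Cauchy_Schwarz_integral:
  fixes f g :: "'a \<Rightarrow> complex"
  assumes f: "f \<in> borel_measurable M" "integrable M (\<lambda>x. (cmod (f x))\<^sup>2)"
    and g: "g \<in> borel_measurable M" "integrable M (\<lambda>x. (cmod (g x))\<^sup>2)"
  shows "integrable M (\<lambda>x. f x * g x)"
    and "(cmod (LINT x|M. f x * g x))\<^sup>2 \<le> (LINT x|M. (cmod (f x))\<^sup>2) * (LINT x|M. (cmod (g x))\<^sup>2)"
proof -
  note [measurable] = f(1) g(1)
  have le: "a * b \<le> a\<^sup>2 + b\<^sup>2" if "a \<ge> 0" "b \<ge> 0" for a b :: real
    using sum_squares_bound[of a b] mult_nonneg_nonneg[OF that] by linarith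
  show int: "integrable M (\<lambda>x. f x * g x)"
    by (rule Bochner_Integration.integrable_bound[OF Bochner_Integration.integrable_add[OF f(2) g(2)]])
       (auto simp: norm_mult le)
  have int': "integrable M (\<lambda>x. cmod (f x) * cmod (g x))"
    using integrable_norm[OF int] by (simp add: norm_mult)
  have "ennreal ((cmod (LINT x|M. f x * g x))\<^sup>2) \<le> ennreal ((LINT x|M. cmod (f x) * cmod (g x))\<^sup>2)"
    using integral_norm_bound[of M "\<lambda>x. f x * g x"] by (intro ennreal_leI power_mono) (auto simp: norm_mult)
  also have "\<dots> = (\<integral>\<^sup>+x. ennreal (cmod (f x)) * ennreal (cmod (g x)) \<partial>M)\<^sup>2"
    using nn_integral_eq_integral[OF int'] by (simp add: ennreal_mult ennreal_power)
  also have "\<dots> \<le> (\<integral>\<^sup>+x. ennreal (cmod (f x)) ^ 2 \<partial>M) * (\<integral>\<^sup>+x. ennreal (cmod (g x)) ^ 2 \<partial>M)"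
    by (rule Cauchy_Schwarz_nn_integral) auto
  also have "\<dots> = ennreal ((LINT x|M. (cmod (f x))\<^sup>2) * (LINT x|M. (cmod (g x))\<^sup>2))"
    using nn_integral_eq_integral[OF f(2)] nn_integral_eq_integral[OF g(2)]
    by (simp add: ennreal_mult ennreal_power)
  finally show "(cmod (LINT x|M. f x * g x))\<^sup>2 \<le> (LINT x|M. (cmod (f x))\<^sup>2) * (LINT x|M. (cmod (g x))\<^sup>2)"
    by (simp add: ennreal_le_iff)
qed

text \<open>The second variable is replaced by the first point of a dense sequence within 1 / (n +
  1) of it. This selection has countably many values, so each approximation is measurable, and
  continuity passes to the limit. It serves the Bergman kernel, whose dependence on the frequency is
  known only to be measurable.\<close>

lemma measurable_Caratheodory:
  fixes f :: "'a \<times> 'b::{metric_space, second_countable_topology} \<Rightarrow> 'c::metric_space"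
  assumes m: "\<And>y. (\<lambda>x. f (x, y)) \<in> borel_measurable M"
    and c: "\<And>x. x \<in> space M \<Longrightarrow> continuous_on UNIV (\<lambda>y. f (x, y))"
  shows "f \<in> borel_measurable (M \<Otimes>\<^sub>M borel)"
proof -
  obtain D :: "'b set" where D: "countable D" "\<And>X. open X \<Longrightarrow> X \<noteq> {} \<Longrightarrow> \<exists>d\<in>D. d \<in> X"
    using countable_dense_exists by blast
  have "D \<noteq> {}" using D(2)[of UNIV] by auto
  define d where "d = from_nat_into D"
  have ex: "\<exists>i. dist y (d i) < 1 / real (Suc n)" for n y
  proof -
    obtain a where "a \<in> D" "a \<in> ball y (1 / real (Suc n))"
      using D(2)[of "ball y (1 / real (Suc n))"] by auto
    then show ?thesis using from_nat_into_surj[OF D(1)] unfolding d_def by (metis mem_ball)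
  qed
  define N where "N n y = (LEAST i. dist y (d i) < 1 / real (Suc n))" for n y
  have N: "dist y (d (N n y)) < 1 / real (Suc n)" for n y
    unfolding N_def by (rule LeastI_ex[OF ex])
  have Nm: "(\<lambda>y. N n y) \<in> measurable borel (count_space UNIV)" for n
    unfolding N_def by measurable
  show ?thesis
  proof (rule borel_measurable_LIMSEQ_metric)
    fix n
    have "(\<lambda>p. (\<lambda>i p. f (fst p, d i)) (N n (snd p)) p) \<in> borel_measurable (M \<Otimes>\<^sub>M borel)"
    proof (rule measurable_compose_countable)
      show "(\<lambda>p. f (fst p, d i)) \<in> borel_measurable (M \<Otimes>\<^sub>M borel)" for i
        by (rule measurable_compose[OF measurable_fst m])
      show "(\<lambda>p. N n (snd p)) \<in> measurable (M \<Otimes>\<^sub>M borel) (count_space UNIV)"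
        by (rule measurable_compose[OF measurable_snd Nm])
    qed
    then show "(\<lambda>p. f (fst p, d (N n (snd p)))) \<in> borel_measurable (M \<Otimes>\<^sub>M borel)" by simp
  next
    fix p assume p: "p \<in> space (M \<Otimes>\<^sub>M (borel :: 'b measure))"
    have "(\<lambda>n. d (N n (snd p))) \<longlonglongrightarrow> snd p"
    proof (rule metric_tendsto_imp_tendsto[of "\<lambda>n. 1 / real (Suc n)" 0])
      show "(\<lambda>n. 1 / real (Suc n)) \<longlonglongrightarrow> 0" using LIMSEQ_inverse_real_of_nat by (simp add: inverse_eq_divide)
      show "\<forall>\<^sub>F n in sequentially. dist (d (N n (snd p))) (snd p) \<le> dist (1 / real (Suc n)) 0"
        using N by (auto simp: dist_commute intro!: always_eventually less_imp_le)
    qed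
    moreover have "isCont (\<lambda>y. f (fst p, y)) (snd p)"
      using c[of "fst p"] p by (auto simp: space_pair_measure continuous_on_eq_continuous_at)
    ultimately show "(\<lambda>n. f (fst p, d (N n (snd p)))) \<longlonglongrightarrow> f p"
      using isCont_tendsto_compose by fastforce
  qed
qed

text \<open>The rate 4^-n leaves room for the weight 2^n: the series of 2^n |F (n+1) - F n|^2 has a
  finite integral, so it converges almost everywhere, and it dominates the telescoping series up to
  the summable term 2^-n.\<close>

lemma L2_Cauchy_AE_convergent:
  fixes F :: "nat \<Rightarrow> 'a \<Rightarrow> complex"
  assumes m [measurable]: "\<And>n. F n \<in> borel_measurable M"
    and C: "\<And>n. (\<integral>\<^sup>+x. ennreal ((cmod (F (Suc n) x - F n x))\<^sup>2) \<partial>M) \<le> ennreal ((1/4) ^ n)"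
  obtains g where "g \<in> borel_measurable M" "AE x in M. (\<lambda>n. F n x) \<longlonglongrightarrow> g x"
proof -
  define d where "d n x = F (Suc n) x - F n x" for n x
  have [measurable]: "d n \<in> borel_measurable M" for n unfolding d_def by measurable
  have "(\<integral>\<^sup>+x. (\<Sum>n. ennreal (2 ^ n * (cmod (d n x))\<^sup>2)) \<partial>M) = (\<Sum>n. \<integral>\<^sup>+x. ennreal (2 ^ n * (cmod (d n x))\<^sup>2) \<partial>M)"
    by (rule nn_integral_suminf) measurable
  also have "\<dots> \<le> (\<Sum>n. ennreal ((1/2) ^ n))"
  proof (rule suminf_le)
    fix n
    have "(\<integral>\<^sup>+x. ennreal (2 ^ n * (cmod (d n x))\<^sup>2) \<partial>M) = ennreal (2 ^ n) * (\<integral>\<^sup>+x. ennreal ((cmod (d n x))\<^sup>2) \<partial>M)"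
      by (subst nn_integral_cmult[symmetric]) (auto simp: ennreal_mult)
    also have "\<dots> \<le> ennreal (2 ^ n) * ennreal ((1/4) ^ n)"
      using C[of n] by (intro mult_left_mono) (auto simp: d_def)
    also have "\<dots> = ennreal ((1/2) ^ n)"
      by (simp add: ennreal_mult[symmetric] power_mult_distrib[symmetric])
    finally show "(\<integral>\<^sup>+x. ennreal (2 ^ n * (cmod (d n x))\<^sup>2) \<partial>M) \<le> ennreal ((1/2) ^ n)" .
  qed auto
  also have "\<dots> = ennreal (\<Sum>n. (1/2) ^ n)"
    by (rule suminf_ennreal2) (auto intro: summable_geometric)
  also have "\<dots> < \<infinity>" by simp
  finally have "AE x in M. (\<Sum>n. ennreal (2 ^ n * (cmod (d n x))\<^sup>2)) \<noteq> \<infinity>"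
    by (intro nn_integral_PInf_AE) auto
  then have "AE x in M. (\<lambda>n. F n x) \<longlonglongrightarrow> lim (\<lambda>n. F n x)"
  proof eventually_elim
    case (elim x)
    have s: "summable (\<lambda>n. 2 ^ n * (cmod (d n x))\<^sup>2)"
      by (rule summable_suminf_not_top) (use elim in auto)
    have "summable (\<lambda>n. 2 ^ n * (cmod (d n x))\<^sup>2 + (1/2) ^ n)"
      by (intro summable_add s summable_geometric) auto
    then have "summable (\<lambda>n. cmod (d n x))"
    proof (rule summable_comparison_test'[where N=0])
      fix n
      \<comment> \<open>Completing the square gives 2 |d| \<le> 2^n |d|^2 + 2^-n.\<close>
      have "0 \<le> (2 ^ n * cmod (d n x) - 1)\<^sup>2" by simp
      also have "\<dots> = 2 ^ n * (2 ^ n * (cmod (d n x))\<^sup>2 - 2 * cmod (d n x) + (1/2) ^ n)"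
        by (simp add: power2_eq_square algebra_simps flip: power_mult_distrib)
      finally have "2 ^ n * 0 \<le> 2 ^ n * (2 ^ n * (cmod (d n x))\<^sup>2 - 2 * cmod (d n x) + (1/2) ^ n)"
        by simp
      then have "0 \<le> 2 ^ n * (cmod (d n x))\<^sup>2 - 2 * cmod (d n x) + (1/2) ^ n"
        by (rule mult_left_le_imp_le) simp
      then show "norm (cmod (d n x)) \<le> 2 ^ n * (cmod (d n x))\<^sup>2 + (1/2) ^ n"
        using norm_ge_zero[of "d n x"] unfolding real_norm_def abs_norm_cancel by linarith
    qed
    then have "summable (\<lambda>n. d n x)" by (rule summable_norm_cancel)
    then have "convergent (\<lambda>n. \<Sum>i<n. d i x)" by (simp add: summable_iff_convergent)
    moreover have "(\<Sum>i<n. d i x) = F n x - F 0 x" for n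
      by (induction n) (auto simp: d_def)
    ultimately have "convergent (\<lambda>n. F n x - F 0 x)" by simp
    then have "convergent (\<lambda>n. F n x)"
      by (simp add: convergent_diff_const_right_iff)
    then show ?case by (simp add: convergent_LIMSEQ_iff)
  qed
  moreover have "(\<lambda>x. lim (\<lambda>n. F n x)) \<in> borel_measurable M" by measurable
  ultimately show ?thesis using that by blast
qed

text \<open>A bound on the integrand alone suffices: Cauchy's inequality converts it into a bound
  for the derivative on a smaller ball, the mean value inequality into one for the difference
  quotients, and dominated convergence along sequences does the rest.\<close>

lemma holomorphic_integral_has_field_derivative:
  fixes f :: "complex \<Rightarrow> 'a \<Rightarrow> complex"
  assumes S: "open S"
    and hol: "\<And>x. x \<in> space M \<Longrightarrow> (\<lambda>z. f z x) holomorphic_on S"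
    and meas: "\<And>z. z \<in> S \<Longrightarrow> f z \<in> borel_measurable M"
    and dom: "\<And>z0. z0 \<in> S \<Longrightarrow> \<exists>r>0. \<exists>g. integrable M g \<and> (\<forall>z\<in>ball z0 r \<inter> S. \<forall>x\<in>space M. cmod (f z x) \<le> g x)"
    and z0: "z0 \<in> S"
  shows "((\<lambda>z. LINT x|M. f z x) has_field_derivative (LINT x|M. deriv (\<lambda>z. f z x) z0)) (at z0)"
proof -
  obtain r1 where r1: "r1 > 0" "ball z0 r1 \<subseteq> S" using S z0 by (meson openE)
  obtain r2 g where g: "r2 > 0" "integrable M g" "\<And>z x. z \<in> ball z0 r2 \<inter> S \<Longrightarrow> x \<in> space M \<Longrightarrow> cmod (f z x) \<le> g x"
    using dom[OF z0] by blast
  define r where "r = min r1 r2"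
  have r: "r > 0" "ball z0 r \<subseteq> S" "\<And>z x. z \<in> ball z0 r \<Longrightarrow> x \<in> space M \<Longrightarrow> cmod (f z x) \<le> g x"
    using r1 g by (auto simp: r_def subset_eq)
  have int: "integrable M (f z)" if "z \<in> ball z0 r" for z
    by (rule Bochner_Integration.integrable_bound[OF g(2)])
       (use that r meas in \<open>auto intro!: AE_I2 intro: order_trans[OF _ abs_ge_self]\<close>)
  define B where "B = ball z0 (r/2)"
  have B: "open B" "convex B" "z0 \<in> B" "B \<subseteq> ball z0 r" using r by (auto simp: B_def)
  have der: "cmod (deriv (\<lambda>z. f z x) z) \<le> g x / (r/4)" if "z \<in> B" "x \<in> space M" for z x
  proof -
    \<comment> \<open>Half the radius for z plus a quarter for the Cauchy circle stays inside the
      ball where \<open>g\<close> dominates; the quarter becomes the denominator of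
      \<open>g x / (r/4)\<close>.\<close>
    have sub: "cball z (r/4) \<subseteq> ball z0 r"
    proof
      fix w assume "w \<in> cball z (r/4)"
      then show "w \<in> ball z0 r" using that(1) dist_triangle[of z0 w z] r(1) by (auto simp: B_def)
    qed
    have h: "(\<lambda>z. f z x) holomorphic_on cball z (r/4)"
      using hol[OF that(2)] sub r(2) by (meson holomorphic_on_subset order_trans)
    have "cmod ((deriv ^^ 1) (\<lambda>z. f z x) z) \<le> fact 1 * g x / (r/4) ^ 1"
    proof (rule Cauchy_inequality)
      show "(\<lambda>z. f z x) holomorphic_on ball z (r/4)" using h holomorphic_on_subset ball_subset_cball by blast
      show "continuous_on (cball z (r/4)) (\<lambda>z. f z x)" using h by (rule holomorphic_on_imp_continuous_on)
      show "cmod (f w x) \<le> g x" if "cmod (z - w) = r/4" for w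
        using that sub \<open>x \<in> space M\<close> by (intro r(3)) (auto simp: dist_norm subset_eq)
    qed (use r in auto)
    then show ?thesis by simp
  qed
  have lip: "cmod ((f z x - f z0 x) / (z - z0)) \<le> g x / (r/4)" if "z \<in> B" "z \<noteq> z0" "x \<in> space M" for z x
  proof -
    have "cmod (f z x - f z0 x) \<le> g x / (r/4) * cmod (z - z0)"
    proof (rule field_differentiable_bound[OF B(2)])
      fix w assume "w \<in> B"
      then show "((\<lambda>z. f z x) has_field_derivative deriv (\<lambda>z. f z x) w) (at w within B)"
        using hol[OF that(3)] S B r(2) by (meson has_field_derivative_at_within holomorphic_derivI subsetD)
    qed (use that der B in auto)
    then show ?thesis using that(2) by (simp add: norm_divide divide_le_eq)
  qed
  have "((\<lambda>z. ((LINT x|M. f z x) - (LINT x|M. f z0 x)) / (z - z0)) \<longlongrightarrow> (LINT x|M. deriv (\<lambda>z. f z x) z0)) (at z0 within B)"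
    unfolding tendsto_at_iff_sequentially
  proof (intro allI impI)
    fix X :: "nat \<Rightarrow> complex" assume X: "\<forall>i. X i \<in> B - {z0}" "X \<longlonglongrightarrow> z0"
    have lim: "(\<lambda>i. LINT x|M. (f (X i) x - f z0 x) / (X i - z0)) \<longlonglongrightarrow> (LINT x|M. deriv (\<lambda>z. f z x) z0)"
    proof (rule integral_dominated_convergence[where w="\<lambda>x. g x / (r/4)"])
      have dm: "(\<lambda>x. (f (X i) x - f z0 x) / (X i - z0)) \<in> borel_measurable M" for i
        using meas[of "X i"] meas[of z0] X(1) B r(2) z0 by (intro borel_measurable_divide borel_measurable_diff borel_measurable_const) blast+
      then show "(\<lambda>x. (f (X i) x - f z0 x) / (X i - z0)) \<in> borel_measurable M" for i .
      have pt: "(\<lambda>i. (f (X i) x - f z0 x) / (X i - z0)) \<longlonglongrightarrow> deriv (\<lambda>z. f z x) z0" if "x \<in> space M" for x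
      proof -
        have "((\<lambda>z. f z x) has_field_derivative deriv (\<lambda>z. f z x) z0) (at z0)"
          using hol[OF that] S z0 by (rule holomorphic_derivI)
        then have "((\<lambda>z. (f z x - f z0 x) / (z - z0)) \<longlongrightarrow> deriv (\<lambda>z. f z x) z0) (at z0 within UNIV)"
          by (simp add: has_field_derivative_iff)
        then show ?thesis using X unfolding tendsto_at_iff_sequentially comp_def by blast
      qed
      then show "AE x in M. (\<lambda>i. (f (X i) x - f z0 x) / (X i - z0)) \<longlonglongrightarrow> deriv (\<lambda>z. f z x) z0" by auto
      \<comment> \<open>The derivative is measurable as a pointwise limit of difference quotients
        along \<open>X\<close>.\<close>
      show "(\<lambda>x. deriv (\<lambda>z. f z x) z0) \<in> borel_measurable M"
        using dm pt by (rule borel_measurable_LIMSEQ_metric)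
      show "integrable M (\<lambda>x. g x / (r/4))" using g(2) by simp
      show "AE x in M. cmod ((f (X i) x - f z0 x) / (X i - z0)) \<le> g x / (r/4)" for i
        using lip X(1) by auto
    qed
    have "(LINT x|M. (f (X i) x - f z0 x) / (X i - z0)) = ((LINT x|M. f (X i) x) - (LINT x|M. f z0 x)) / (X i - z0)" for i
      using X(1) B int[of "X i"] int[of z0] by (subst integral_divide_zero) (auto simp: Bochner_Integration.integral_diff subset_eq)
    with lim show "((\<lambda>z. ((LINT x|M. f z x) - (LINT x|M. f z0 x)) / (z - z0)) \<circ> X) \<longlonglongrightarrow> (LINT x|M. deriv (\<lambda>z. f z x) z0)"
      unfolding comp_def by (simp only:)
  qed
  then show ?thesis
    by (simp add: has_field_derivative_iff at_within_open[OF B(3,1)])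
qed

lemma holomorphic_on_integral:
  fixes f :: "complex \<Rightarrow> 'a \<Rightarrow> complex"
  assumes "open S"
    and "\<And>x. x \<in> space M \<Longrightarrow> (\<lambda>z. f z x) holomorphic_on S"
    and "\<And>z. z \<in> S \<Longrightarrow> f z \<in> borel_measurable M"
    and "\<And>z0. z0 \<in> S \<Longrightarrow> \<exists>r>0. \<exists>g. integrable M g \<and> (\<forall>z\<in>ball z0 r \<inter> S. \<forall>x\<in>space M. cmod (f z x) \<le> g x)"
  shows "(\<lambda>z. LINT x|M. f z x) holomorphic_on S"
  using holomorphic_integral_has_field_derivative[OF assms] assms(1)
  by (auto simp: holomorphic_on_open)

section \<open>The Fourier transform on the line\<close>

lemma integrable_exp_square:
  assumes "e > 0"
  shows "integrable lborel (\<lambda>t::real. exp (- (e * t)\<^sup>2 / 2))"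
    and "exp (- (e * t)\<^sup>2 / 2) = sqrt (2 * pi) / e * normal_density 0 (1 / e) t"
proof -
  show *: "exp (- (e * t)\<^sup>2 / 2) = sqrt (2 * pi) / e * normal_density 0 (1 / e) t" for t
    using assms by (simp add: normal_density_def real_sqrt_mult real_sqrt_divide power_mult_distrib power_divide field_simps)
  show "integrable lborel (\<lambda>t::real. exp (- (e * t)\<^sup>2 / 2))"
    unfolding * by (intro integrable_mult_right) (use assms in auto)
qed

text \<open>The integral is the characteristic function of the standard normal law after the
  substitution t = u / e. The result is 2 \<pi> times a probability density, hence an approximate
  identity as e tends to 0.\<close>

lemma fourier_gaussian:
  assumes e: "e > 0"
  shows "(LINT t|lborel. complex_of_real (exp (- (e * t)\<^sup>2 / 2)) * cis (t * x)) = complex_of_real (2 * pi * normal_density 0 e x)"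
proof -
  have 1: "(LINT t|lborel. complex_of_real (std_normal_density t) * cis (s * t)) = complex_of_real (exp (- s\<^sup>2 / 2))" for s
  proof -
    have "char std_normal_distribution s = complex_of_real (exp (- s\<^sup>2 / 2))"
      by (simp add: char_std_normal_distribution)
    then show ?thesis
      by (simp add: char_def integral_density scaleR_conv_of_real cis_conv_exp)
  qed
  have "(LINT t|lborel. complex_of_real (exp (- (e * t)\<^sup>2 / 2)) * cis (t * x))
     = complex_of_real (1 / e) * (LINT u|lborel. complex_of_real (exp (- (e * (0 + 1 / e * u))\<^sup>2 / 2)) * cis ((0 + 1 / e * u) * x))"
    using e by (subst lborel_integral_real_affine[where t=0 and c="1/e"]) (auto simp: scaleR_conv_of_real)
  also have "(\<lambda>u. complex_of_real (exp (- (e * (0 + 1 / e * u))\<^sup>2 / 2)) * cis ((0 + 1 / e * u) * x))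
      = (\<lambda>u. complex_of_real (sqrt (2 * pi)) * (complex_of_real (std_normal_density u) * cis (x / e * u)))"
    using e by (auto simp: std_normal_density_def fun_eq_iff mult.commute)
  also have "complex_of_real (1 / e) * (LINT u|lborel. complex_of_real (sqrt (2 * pi)) * (complex_of_real (std_normal_density u) * cis (x / e * u)))
      = complex_of_real (1 / e) * (complex_of_real (sqrt (2 * pi)) * complex_of_real (exp (- (x/e)\<^sup>2 / 2)))"
    by (simp only: 1 integral_mult_right_zero)
  also have "\<dots> = complex_of_real (1 / e * sqrt (2 * pi) * exp (- (x/e)\<^sup>2 / 2))" by simp
  also have "1 / e * sqrt (2 * pi) * exp (- (x/e)\<^sup>2 / 2) = 2 * pi * normal_density 0 e x"
  proof -
    have "2 * pi = sqrt (2 * pi) * sqrt (2 * pi)" by simp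
    moreover have "sqrt (2 * pi * e\<^sup>2) = sqrt (2 * pi) * e" using e by (simp add: real_sqrt_mult)
    ultimately show ?thesis using e
      unfolding normal_density_def by (simp add: power_divide real_sqrt_mult)
  qed
  finally show ?thesis .
qed

text \<open>Unnormalised transform: the 2 \<pi> of inversion and of the norm inequality, and finally
  the factor 1 / (2 \<pi>) in the kernel formula, all stem from this choice.\<close>

definition fourier :: "(real \<Rightarrow> complex) \<Rightarrow> real \<Rightarrow> complex" where
  "fourier \<phi> t = (LINT s|lborel. \<phi> s * cis (- (t * s)))"

lemma measurable_cis [measurable]: "cis \<in> borel_measurable borel"
  by (intro borel_measurable_continuous_onI continuous_intros)

lemma measurable_cnj [measurable]: "cnj \<in> borel_measurable borel"
  by (intro borel_measurable_continuous_onI continuous_intros)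

lemma integrable_mult_cis:
  fixes \<phi> :: "real \<Rightarrow> complex"
  assumes "integrable lborel \<phi>"
  shows "integrable lborel (\<lambda>s::real. \<phi> s * cis (c * s))"
proof -
  have [measurable]: "\<phi> \<in> borel_measurable borel" using assms by simp
  show ?thesis
    by (rule Bochner_Integration.integrable_bound[OF assms]) (auto simp: norm_mult)
qed

lemma fourier_norm_le: "cmod (fourier \<phi> t) \<le> (LINT s|lborel. cmod (\<phi> s))"
  unfolding fourier_def by (rule order_trans[OF integral_norm_bound]) (simp add: norm_mult)

lemma measurable_fourier [measurable]:
  assumes "\<phi> \<in> borel_measurable borel"
  shows "fourier \<phi> \<in> borel_measurable borel"
proof -
  note [measurable] = assms
  show ?thesis unfolding fourier_def[abs_def] by measurable
qed

text \<open>Fubini for \<psi>(t) \<phi>(s) exp (- i t s), which is absolutely integrable. Every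
  exact pairing on the Fourier side below comes from this symmetry, with one factor presented as the
  transform of an integrable function.\<close>

lemma fourier_multiplication:
  fixes \<phi> \<psi> :: "real \<Rightarrow> complex"
  assumes "integrable lborel \<phi>" "integrable lborel \<psi>"
  shows "(LINT t|lborel. \<psi> t * fourier \<phi> t) = (LINT s|lborel. \<phi> s * fourier \<psi> s)"
proof -
  have [measurable]: "\<phi> \<in> borel_measurable borel" "\<psi> \<in> borel_measurable borel" using assms by auto
  have int: "integrable (lborel \<Otimes>\<^sub>M lborel) (\<lambda>(t, s). \<psi> t * (\<phi> s * cis (- (t * s))))"
  proof (rule lborel_pair.Fubini_integrable)
    show "integrable lborel (\<lambda>x. LINT y|lborel. cmod (case (x, y) of (t, s) \<Rightarrow> \<psi> t * (\<phi> s * cis (- (t * s)))))"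
      using assms by (simp add: norm_mult)
    show "AE x in lborel. integrable lborel (\<lambda>y. case (x, y) of (t, s) \<Rightarrow> \<psi> t * (\<phi> s * cis (- (t * s))))"
      using integrable_mult_cis[OF assms(1), of "- x" for x] by auto
  qed measurable
  have "(LINT t|lborel. \<psi> t * fourier \<phi> t) = (LINT t|lborel. LINT s|lborel. \<psi> t * (\<phi> s * cis (- (t * s))))"
    by (simp add: fourier_def)
  also have "\<dots> = (LINT s|lborel. LINT t|lborel. \<psi> t * (\<phi> s * cis (- (t * s))))"
    using lborel_pair.Fubini_integral[OF int] by simp
  also have "\<dots> = (LINT s|lborel. \<phi> s * fourier \<psi> s)"
    unfolding fourier_def by (simp add: mult.left_commute mult.commute flip: integral_mult_right_zero)
  finally show ?thesis .
qed

lemma fourier_mult_cis: "fourier (\<lambda>t. \<phi> t * cis (t * a)) s = fourier \<phi> (s - a)"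
  unfolding fourier_def by (intro Bochner_Integration.integral_cong) (auto simp: algebra_simps cis_mult)

lemma fourier_gaussian':
  assumes "e > 0"
  shows "fourier (\<lambda>t. complex_of_real (exp (- (e * t)\<^sup>2 / 2))) x = complex_of_real (2 * pi * normal_density 0 e x)"
  using fourier_gaussian[OF assms, of "- x"] by (simp add: fourier_def normal_density_def mult.commute)

text \<open>Gaussian summation: with the weight \<open>W n\<close> the multiplication formula turns
  the left side into 2 \<pi> times the Gaussian mean of \<phi> around x at scale \<open>e n\<close>.
  Integrability of the transform controls one limit, boundedness and continuity of \<phi> the
  other.\<close>

lemma fourier_inversion:
  fixes \<phi> :: "real \<Rightarrow> complex"
  assumes cont: "continuous_on UNIV \<phi>" and bd: "\<And>s. cmod (\<phi> s) \<le> B"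
    and int: "integrable lborel \<phi>" and fint: "integrable lborel (fourier \<phi>)"
  shows "(LINT t|lborel. fourier \<phi> t * cis (t * x)) = 2 * pi * \<phi> x"
proof -
  have [measurable]: "\<phi> \<in> borel_measurable borel" using int by simp
  define e where "e n = 1 / real (Suc n)" for n
  have e: "e n > 0" for n by (simp add: e_def)
  have elim: "e \<longlonglongrightarrow> 0" unfolding e_def using LIMSEQ_inverse_real_of_nat by (simp add: inverse_eq_divide)
  define W where "W n t = complex_of_real (exp (- (e n * t)\<^sup>2 / 2))" for n t
  have Wint: "integrable lborel (W n)" for n
    unfolding W_def using integrable_exp_square(1)[OF e[of n]] by simp
  have [measurable]: "W n \<in> borel_measurable borel" for n using Wint[of n] by simp
  have key: "(LINT t|lborel. W n t * cis (t * x) * fourier \<phi> t) = 2 * pi * (LINT u|lborel. complex_of_real (std_normal_density u) * \<phi> (x + e n * u))" for n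
  proof -
    have "(LINT t|lborel. W n t * cis (t * x) * fourier \<phi> t) = (LINT s|lborel. \<phi> s * fourier (\<lambda>t. W n t * cis (t * x)) s)"
      using fourier_multiplication[OF int, of "\<lambda>t. W n t * cis (t * x)"] integrable_mult_cis[OF Wint[of n], of x]
      by (simp add: mult.commute)
    also have "\<dots> = (LINT s|lborel. \<phi> s * complex_of_real (2 * pi * normal_density 0 (e n) (s - x)))"
      unfolding fourier_mult_cis W_def by (simp only: fourier_gaussian'[OF e])
    \<comment> \<open>Substituting s = x + e n u freezes the Gaussian and moves the dependence on n
      into the argument of \<phi>.\<close>
    also have "\<dots> = e n * (LINT u|lborel. \<phi> (x + e n * u) * complex_of_real (2 * pi * normal_density 0 (e n) (x + e n * u - x)))"
      using e[of n] by (subst lborel_integral_real_affine[where t=x and c="e n"]) (auto simp: scaleR_conv_of_real)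
    also have "\<dots> = (LINT u|lborel. 2 * pi * (complex_of_real (std_normal_density u) * \<phi> (x + e n * u)))"
      using e[of n]
      by (subst integral_mult_right_zero[symmetric], intro Bochner_Integration.integral_cong)
         (auto simp: normal_density_def real_sqrt_mult power_mult_distrib)
    finally show ?thesis by simp
  qed
  have "(\<lambda>n. LINT t|lborel. W n t * cis (t * x) * fourier \<phi> t) \<longlonglongrightarrow> (LINT t|lborel. fourier \<phi> t * cis (t * x))"
  proof (rule integral_dominated_convergence[where w="\<lambda>t. cmod (fourier \<phi> t)"])
    show "AE t in lborel. (\<lambda>n. W n t * cis (t * x) * fourier \<phi> t) \<longlonglongrightarrow> fourier \<phi> t * cis (t * x)"
    proof (rule AE_I2)
      fix t
      have "(\<lambda>n. W n t * cis (t * x) * fourier \<phi> t) \<longlonglongrightarrow> complex_of_real (exp (- (0 * t)\<^sup>2 / 2)) * cis (t * x) * fourier \<phi> t"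
        unfolding W_def by (intro tendsto_intros elim) simp
      then show "(\<lambda>n. W n t * cis (t * x) * fourier \<phi> t) \<longlonglongrightarrow> fourier \<phi> t * cis (t * x)" by (simp add: mult.commute)
    qed
    show "AE t in lborel. norm (W n t * cis (t * x) * fourier \<phi> t) \<le> cmod (fourier \<phi> t)" for n
      by (auto simp: W_def norm_mult intro!: AE_I2 mult_left_le_one_le)
  qed (use fint in auto)
  moreover have "(\<lambda>n. LINT u|lborel. complex_of_real (std_normal_density u) * \<phi> (x + e n * u)) \<longlonglongrightarrow> (LINT u|lborel. complex_of_real (std_normal_density u) * \<phi> x)"
  proof (rule integral_dominated_convergence[where w="\<lambda>u. std_normal_density u * B"])
    show "AE u in lborel. (\<lambda>n. complex_of_real (std_normal_density u) * \<phi> (x + e n * u)) \<longlonglongrightarrow> complex_of_real (std_normal_density u) * \<phi> x"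
    proof (rule AE_I2)
      fix u
      have "(\<lambda>n. x + e n * u) \<longlonglongrightarrow> x + 0 * u" by (intro tendsto_intros elim)
      then have "(\<lambda>n. \<phi> (x + e n * u)) \<longlonglongrightarrow> \<phi> x"
        using cont continuous_on_tendsto_compose[OF cont, of "\<lambda>n. x + e n * u" x] by simp
      then show "(\<lambda>n. complex_of_real (std_normal_density u) * \<phi> (x + e n * u)) \<longlonglongrightarrow> complex_of_real (std_normal_density u) * \<phi> x"
        by (intro tendsto_intros)
    qed
    show "AE u in lborel. norm (complex_of_real (std_normal_density u) * \<phi> (x + e n * u)) \<le> std_normal_density u * B" for n
      by (auto simp: norm_mult bd intro!: AE_I2 mult_left_mono)
  qed (use integrable_normal_density[of 0 1] in \<open>auto\<close>)
  moreover have "(LINT u|lborel. complex_of_real (std_normal_density u) * \<phi> x) = \<phi> x"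
    by simp
  ultimately show ?thesis
    unfolding key using LIMSEQ_unique[OF _ tendsto_mult_left[of _ _ _ "2 * complex_of_real pi"]] by auto
qed

text \<open>The right side may be infinite, as \<phi> is merely integrable. The Gaussian weight
  makes the left side finite, and the multiplication formula rewrites it as 2 \<pi> times a double
  integral of \<phi>(s) times the conjugate of \<phi>(s') against \<open>N n (s - s')\<close>. That
  kernel has mass 1 in each variable, so |a b| \<le> a^2/2 + b^2/2 bounds the double integral;
  Fatou's lemma removes the weight.\<close>

lemma nn_integral_fourier_le:
  fixes \<phi> :: "real \<Rightarrow> complex"
  assumes int: "integrable lborel \<phi>"
  shows "(\<integral>\<^sup>+t. ennreal ((cmod (fourier \<phi> t))\<^sup>2) \<partial>lborel) \<le> ennreal (2 * pi) * (\<integral>\<^sup>+s. ennreal ((cmod (\<phi> s))\<^sup>2) \<partial>lborel)"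
proof -
  have [measurable]: "\<phi> \<in> borel_measurable borel" using int by simp
  define e where "e n = 1 / real (Suc n)" for n
  have e: "e n > 0" for n by (simp add: e_def)
  have elim: "e \<longlonglongrightarrow> 0" unfolding e_def using LIMSEQ_inverse_real_of_nat by (simp add: inverse_eq_divide)
  define W where "W n t = exp (- (e n * t)\<^sup>2 / 2)" for n :: nat and t :: real
  have Wint: "integrable lborel (W n)" for n
    unfolding W_def using integrable_exp_square(1)[OF e[of n]] by simp
  have [measurable]: "W n \<in> borel_measurable borel" for n using Wint[of n] by simp
  define N where "N n = normal_density 0 (e n)" for n
  have [measurable]: "N n \<in> borel_measurable borel" for n unfolding N_def by simp
  have Nnn: "0 \<le> N n s" for n s by (simp add: N_def)
  have Nsub: "(\<integral>\<^sup>+s'. ennreal (N n (s - s')) \<partial>lborel) = 1" for n s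
  proof -
    have "(\<integral>\<^sup>+s'. ennreal (N n (s - s')) \<partial>lborel) = (\<integral>\<^sup>+s'. ennreal (N n s') \<partial>lborel)"
      using nn_integral_real_affine[of "\<lambda>s'. ennreal (N n s')" "-1" s] by simp
    also have "\<dots> = 1"
      unfolding N_def using e[of n] by (subst nn_integral_eq_integral) auto
    finally show ?thesis .
  qed
  have Nsub': "(\<integral>\<^sup>+s. ennreal (N n (s - s')) \<partial>lborel) = 1" for n s'
    using Nsub[of n s'] by (simp add: N_def normal_density_def power2_commute)
  have bound: "(\<integral>\<^sup>+t. ennreal (W n t * (cmod (fourier \<phi> t))\<^sup>2) \<partial>lborel) \<le> ennreal (2 * pi) * (\<integral>\<^sup>+s. ennreal ((cmod (\<phi> s))\<^sup>2) \<partial>lborel)" for n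
  proof -
    \<comment> \<open>Chosen so that \<psi> times the transform of \<phi> is the weighted squared
      modulus of that transform.\<close>
    define \<psi> where "\<psi> t = complex_of_real (W n t) * cnj (fourier \<phi> t)" for t
    have \<psi>int: "integrable lborel \<psi>"
    proof (rule Bochner_Integration.integrable_bound)
      show "integrable lborel (\<lambda>t. W n t * (LINT s|lborel. cmod (\<phi> s)))" using Wint[of n] by simp
      show "\<psi> \<in> borel_measurable lborel" unfolding \<psi>_def by measurable
      show "AE t in lborel. norm (\<psi> t) \<le> norm (W n t * (LINT s|lborel. cmod (\<phi> s)))"
        by (auto simp: \<psi>_def norm_mult W_def intro!: AE_I2 mult_left_mono order_trans[OF fourier_norm_le])
    qed
    have f\<psi>: "fourier \<psi> s = 2 * pi * (LINT s'|lborel. cnj (\<phi> s') * complex_of_real (N n (s - s')))" for s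
    proof -
      have ci: "integrable lborel (\<lambda>s. cnj (\<phi> (- s)))"
        using lborel_integrable_real_affine[of "\<lambda>s. cnj (\<phi> s)" "-1" 0] int by simp
      have "cnj (fourier \<phi> t) = fourier (\<lambda>s. cnj (\<phi> (- s))) t" for t
      proof -
        have "cnj (fourier \<phi> t) = (LINT s|lborel. cnj (\<phi> s) * cis (t * s))"
          unfolding fourier_def by (subst Bochner_Integration.integral_cnj[symmetric]) (simp add: cis_cnj)
        also have "\<dots> = fourier (\<lambda>s. cnj (\<phi> (- s))) t"
          unfolding fourier_def by (subst lborel_integral_real_affine[where t=0 and c="-1"]) auto
        finally show ?thesis .
      qed
      then have "fourier \<psi> s = (LINT t|lborel. (complex_of_real (W n t) * cis (t * (- s))) * fourier (\<lambda>s. cnj (\<phi> (- s))) t)"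
        unfolding fourier_def[of \<psi>] \<psi>_def by (intro Bochner_Integration.integral_cong) (auto simp: mult_ac)
      also have "\<dots> = (LINT u|lborel. cnj (\<phi> (- u)) * fourier (\<lambda>t. complex_of_real (W n t) * cis (t * (- s))) u)"
        using fourier_multiplication[OF ci, of "\<lambda>t. complex_of_real (W n t) * cis (t * (- s))"]
          integrable_mult_cis[of "\<lambda>t. complex_of_real (W n t)" "- s"] Wint[of n]
        by (simp add: mult.commute)
      also have "\<dots> = (LINT u|lborel. cnj (\<phi> (- u)) * complex_of_real (2 * pi * N n (u + s)))"
        unfolding fourier_mult_cis W_def N_def by (simp only: fourier_gaussian'[OF e]) simp
      also have "\<dots> = (LINT u|lborel. cnj (\<phi> u) * complex_of_real (2 * pi * N n (- u + s)))"
        by (subst lborel_integral_real_affine[where t=0 and c="-1"]) auto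
      also have "\<dots> = (LINT u|lborel. 2 * pi * (cnj (\<phi> u) * complex_of_real (N n (s - u))))"
        by (intro Bochner_Integration.integral_cong) auto
      finally show ?thesis by simp
    qed
    have "(\<integral>\<^sup>+t. ennreal (W n t * (cmod (fourier \<phi> t))\<^sup>2) \<partial>lborel) = ennreal (cmod (LINT t|lborel. \<psi> t * fourier \<phi> t))"
    proof -
      have eq: "\<psi> t * fourier \<phi> t = complex_of_real (W n t * (cmod (fourier \<phi> t))\<^sup>2)" for t
        unfolding \<psi>_def of_real_mult complex_norm_square by (simp add: mult_ac)
      have i: "integrable lborel (\<lambda>t. W n t * (cmod (fourier \<phi> t))\<^sup>2)"
      proof (rule Bochner_Integration.integrable_bound)
        show "integrable lborel (\<lambda>t. W n t * (LINT s|lborel. cmod (\<phi> s))\<^sup>2)" using Wint[of n] by simp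
        show "AE t in lborel. norm (W n t * (cmod (fourier \<phi> t))\<^sup>2) \<le> norm (W n t * (LINT s|lborel. cmod (\<phi> s))\<^sup>2)"
          by (auto simp: norm_mult W_def abs_mult intro!: AE_I2 mult_left_mono power_mono order_trans[OF fourier_norm_le])
      qed measurable
      have "0 \<le> (LINT t|lborel. W n t * (cmod (fourier \<phi> t))\<^sup>2)"
        by (rule Bochner_Integration.integral_nonneg) (simp add: W_def)
      then show ?thesis
        unfolding eq integral_complex_of_real using i
        by (subst nn_integral_eq_integral) (auto simp: W_def)
    qed
    also have "(LINT t|lborel. \<psi> t * fourier \<phi> t) = (LINT s|lborel. \<phi> s * fourier \<psi> s)"
      by (rule fourier_multiplication[OF int \<psi>int])
    also have "ennreal (cmod \<dots>) \<le> (\<integral>\<^sup>+s. ennreal (cmod (\<phi> s * fourier \<psi> s)) \<partial>lborel)"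
      by (rule integral_norm_bound_ennreal) (rule Bochner_Integration.integrable_bound[OF integrable_mult_right[OF integrable_norm[OF int], of "LINT s|lborel. cmod (\<psi> s)"]],
          use \<psi>int in \<open>auto simp: norm_mult mult.commute intro!: AE_I2 mult_mono order_trans[OF fourier_norm_le]\<close>)
    also have "\<dots> \<le> (\<integral>\<^sup>+s. (\<integral>\<^sup>+s'. ennreal (2 * pi) * ennreal (((cmod (\<phi> s))\<^sup>2 / 2 + (cmod (\<phi> s'))\<^sup>2 / 2) * N n (s - s')) \<partial>lborel) \<partial>lborel)"
    proof (rule nn_integral_mono)
      fix s
      have "ennreal (cmod (\<phi> s * fourier \<psi> s)) = ennreal (2 * pi * cmod (\<phi> s)) * ennreal (cmod (LINT s'|lborel. cnj (\<phi> s') * complex_of_real (N n (s - s'))))"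
        by (simp add: f\<psi> norm_mult ennreal_mult[symmetric] mult_ac)
      also have "\<dots> \<le> ennreal (2 * pi * cmod (\<phi> s)) * (\<integral>\<^sup>+s'. ennreal (cmod (\<phi> s') * N n (s - s')) \<partial>lborel)"
      proof (rule mult_left_mono)
        show "ennreal (cmod (LINT s'|lborel. cnj (\<phi> s') * complex_of_real (N n (s - s')))) \<le> (\<integral>\<^sup>+s'. ennreal (cmod (\<phi> s') * N n (s - s')) \<partial>lborel)"
        proof (cases "integrable lborel (\<lambda>s'. cnj (\<phi> s') * complex_of_real (N n (s - s')))")
          case True
          from integral_norm_bound_ennreal[OF this] show ?thesis by (simp add: norm_mult Nnn)
        qed (simp add: not_integrable_integral_eq)
      qed simp
      also have "\<dots> = (\<integral>\<^sup>+s'. ennreal (2 * pi * cmod (\<phi> s) * (cmod (\<phi> s') * N n (s - s'))) \<partial>lborel)"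
        by (subst nn_integral_cmult[symmetric]) (auto simp: ennreal_mult Nnn)
      also have "\<dots> \<le> (\<integral>\<^sup>+s'. ennreal (2 * pi) * ennreal (((cmod (\<phi> s))\<^sup>2 / 2 + (cmod (\<phi> s'))\<^sup>2 / 2) * N n (s - s')) \<partial>lborel)"
      proof (rule nn_integral_mono)
        fix s'
        have "cmod (\<phi> s) * cmod (\<phi> s') \<le> (cmod (\<phi> s))\<^sup>2 / 2 + (cmod (\<phi> s'))\<^sup>2 / 2"
          using sum_squares_bound[of "cmod (\<phi> s)" "cmod (\<phi> s')"] by (simp add: field_simps)
        then have "2 * pi * ((cmod (\<phi> s) * cmod (\<phi> s')) * N n (s - s')) \<le> 2 * pi * (((cmod (\<phi> s))\<^sup>2 / 2 + (cmod (\<phi> s'))\<^sup>2 / 2) * N n (s - s'))"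
          by (intro mult_left_mono mult_right_mono Nnn) auto
        then show "ennreal (2 * pi * cmod (\<phi> s) * (cmod (\<phi> s') * N n (s - s'))) \<le> ennreal (2 * pi) * ennreal (((cmod (\<phi> s))\<^sup>2 / 2 + (cmod (\<phi> s'))\<^sup>2 / 2) * N n (s - s'))"
          by (subst ennreal_mult[symmetric]) (auto simp: mult_ac Nnn intro!: ennreal_leI)
      qed
      finally show "ennreal (cmod (\<phi> s * fourier \<psi> s)) \<le> \<dots>" .
    qed
    also have "\<dots> = ennreal (2 * pi) * (\<integral>\<^sup>+s. (\<integral>\<^sup>+s'. ennreal ((cmod (\<phi> s))\<^sup>2 / 2) * ennreal (N n (s - s')) + ennreal ((cmod (\<phi> s'))\<^sup>2 / 2) * ennreal (N n (s - s')) \<partial>lborel) \<partial>lborel)"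
      by (subst nn_integral_cmult[symmetric], measurable, intro nn_integral_cong, subst nn_integral_cmult[symmetric], measurable)
         (auto intro!: nn_integral_cong simp: ennreal_mult[symmetric] ennreal_plus[symmetric] Nnn distrib_right simp del: ennreal_plus)
    also have "(\<integral>\<^sup>+s. (\<integral>\<^sup>+s'. ennreal ((cmod (\<phi> s))\<^sup>2 / 2) * ennreal (N n (s - s')) + ennreal ((cmod (\<phi> s'))\<^sup>2 / 2) * ennreal (N n (s - s')) \<partial>lborel) \<partial>lborel)
       = (\<integral>\<^sup>+s. (\<integral>\<^sup>+s'. ennreal ((cmod (\<phi> s))\<^sup>2 / 2) * ennreal (N n (s - s')) \<partial>lborel) \<partial>lborel)
       + (\<integral>\<^sup>+s. (\<integral>\<^sup>+s'. ennreal ((cmod (\<phi> s'))\<^sup>2 / 2) * ennreal (N n (s - s')) \<partial>lborel) \<partial>lborel)"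
      by (subst nn_integral_add[symmetric], measurable, intro nn_integral_cong, rule nn_integral_add) measurable
    also have "(\<integral>\<^sup>+s. (\<integral>\<^sup>+s'. ennreal ((cmod (\<phi> s'))\<^sup>2 / 2) * ennreal (N n (s - s')) \<partial>lborel) \<partial>lborel)
        = (\<integral>\<^sup>+s'. (\<integral>\<^sup>+s. ennreal ((cmod (\<phi> s'))\<^sup>2 / 2) * ennreal (N n (s - s')) \<partial>lborel) \<partial>lborel)"
      by (rule lborel_pair.Fubini') measurable
    also have "(\<integral>\<^sup>+s. (\<integral>\<^sup>+s'. ennreal ((cmod (\<phi> s))\<^sup>2 / 2) * ennreal (N n (s - s')) \<partial>lborel) \<partial>lborel) = (\<integral>\<^sup>+s. ennreal ((cmod (\<phi> s))\<^sup>2 / 2) \<partial>lborel)"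
      by (intro nn_integral_cong) (simp add: nn_integral_cmult Nsub)
    also have "(\<integral>\<^sup>+s'. (\<integral>\<^sup>+s. ennreal ((cmod (\<phi> s'))\<^sup>2 / 2) * ennreal (N n (s - s')) \<partial>lborel) \<partial>lborel) = (\<integral>\<^sup>+s. ennreal ((cmod (\<phi> s))\<^sup>2 / 2) \<partial>lborel)"
      by (intro nn_integral_cong) (simp add: nn_integral_cmult Nsub')
    also have "(\<integral>\<^sup>+s. ennreal ((cmod (\<phi> s))\<^sup>2 / 2) \<partial>lborel) + (\<integral>\<^sup>+s. ennreal ((cmod (\<phi> s))\<^sup>2 / 2) \<partial>lborel) = (\<integral>\<^sup>+s. ennreal ((cmod (\<phi> s))\<^sup>2) \<partial>lborel)"
      by (subst nn_integral_add[symmetric]) (auto simp flip: ennreal_plus)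
    finally show ?thesis .
  qed
  have "(\<integral>\<^sup>+t. ennreal ((cmod (fourier \<phi> t))\<^sup>2) \<partial>lborel) = (\<integral>\<^sup>+t. liminf (\<lambda>n. ennreal (W n t * (cmod (fourier \<phi> t))\<^sup>2)) \<partial>lborel)"
  proof (intro nn_integral_cong)
    fix t
    have "(\<lambda>n. W n t * (cmod (fourier \<phi> t))\<^sup>2) \<longlonglongrightarrow> exp (- (0 * t)\<^sup>2 / 2) * (cmod (fourier \<phi> t))\<^sup>2"
      unfolding W_def by (intro tendsto_intros elim) simp
    then have "(\<lambda>n. ennreal (W n t * (cmod (fourier \<phi> t))\<^sup>2)) \<longlonglongrightarrow> ennreal ((cmod (fourier \<phi> t))\<^sup>2)"
      by (intro tendsto_ennrealI) simp
    then show "ennreal ((cmod (fourier \<phi> t))\<^sup>2) = liminf (\<lambda>n. ennreal (W n t * (cmod (fourier \<phi> t))\<^sup>2))"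
      by (rule lim_imp_Liminf[symmetric, rotated]) simp
  qed
  also have "\<dots> \<le> liminf (\<lambda>n. \<integral>\<^sup>+t. ennreal (W n t * (cmod (fourier \<phi> t))\<^sup>2) \<partial>lborel)"
    by (rule nn_integral_liminf) measurable
  also have "\<dots> \<le> ennreal (2 * pi) * (\<integral>\<^sup>+s. ennreal ((cmod (\<phi> s))\<^sup>2) \<partial>lborel)"
    by (rule order_trans[OF Liminf_mono Liminf_const[THEN eq_refl]]) (auto simp: bound intro: always_eventually)
  finally show ?thesis .
qed

section \<open>Local bounds for holomorphic functions by area means\<close>

lemma measurable_Complex [measurable]:
  "(\<lambda>p. Complex (fst p) (snd p)) \<in> borel_measurable (borel \<Otimes>\<^sub>M borel)"
  unfolding complex_eq borel_prod
  by (intro borel_measurable_continuous_onI continuous_intros)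

lemma lborel_complex_eq: "(lborel :: complex measure) = distr (lborel \<Otimes>\<^sub>M lborel) borel (\<lambda>p. Complex (fst p) (snd p))"
proof (rule lborel_eqI)
  fix l u :: complex
  assume le: "\<And>b. b \<in> Basis \<Longrightarrow> l \<bullet> b \<le> u \<bullet> b"
  have le': "Re l \<le> Re u" "Im l \<le> Im u"
    using le[of 1] le[of \<i>] by (auto simp: Basis_complex_def)
  have m: "(\<lambda>p. Complex (fst p) (snd p)) \<in> measurable (lborel \<Otimes>\<^sub>M lborel) borel"
    using measurable_Complex by simp
  have "emeasure (distr (lborel \<Otimes>\<^sub>M lborel) borel (\<lambda>p. Complex (fst p) (snd p))) (box l u)
     = emeasure (lborel \<Otimes>\<^sub>M lborel) ({Re l<..<Re u} \<times> {Im l<..<Im u})"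
    by (subst emeasure_distr[OF m])
       (auto simp: in_box_complex_iff space_pair_measure intro!: arg_cong[where f="emeasure _"])
  also have "\<dots> = ennreal (Re u - Re l) * ennreal (Im u - Im l)"
    using le' by (simp add: lborel.emeasure_pair_measure_Times)
  also have "\<dots> = (\<Prod>b\<in>Basis. (u - l) \<bullet> b)"
    using le' by (simp add: Basis_complex_def prod.insert ennreal_mult)
  finally show "emeasure (distr (lborel \<Otimes>\<^sub>M lborel) borel (\<lambda>p. Complex (fst p) (snd p))) (box l u) = (\<Prod>b\<in>Basis. (u - l) \<bullet> b)" .
qed simp

lemma nn_integral_complex:
  assumes "f \<in> borel_measurable borel"
  shows "(\<integral>\<^sup>+z. f z \<partial>lborel) = (\<integral>\<^sup>+x. \<integral>\<^sup>+y. f (Complex x y) \<partial>lborel \<partial>lborel)"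
proof -
  note [measurable] = assms
  have m: "(\<lambda>p. Complex (fst p) (snd p)) \<in> measurable (lborel \<Otimes>\<^sub>M lborel) borel"
    using measurable_Complex by simp
  show ?thesis
    apply (subst lborel_complex_eq)
    apply (subst nn_integral_distr[OF m])
     apply simp
    apply (subst lborel.nn_integral_fst[symmetric])
     apply (simp_all add: m measurable_compose[OF m assms])
    done
qed

text \<open>On a segment of length 2 s at distance at least s from z, the quotient of length and
  distance is at most 2, so the Cauchy kernel leaves no trace beyond this constant.\<close>

lemma norm_linepath_Cauchy_integral_le:
  fixes h :: "complex \<Rightarrow> complex"
  assumes h: "continuous_on (closed_segment a b) h" and s: "s > 0"
    and far: "\<And>w. w \<in> closed_segment a b \<Longrightarrow> s \<le> cmod (w - z)" and ab: "cmod (b - a) = 2 * s"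
    and I: "((\<lambda>w. h w / (w - z)) has_contour_integral I) (linepath a b)"
  shows "ennreal (cmod I) \<le> 2 * (\<integral>\<^sup>+x. ennreal (cmod (h (linepath a b x))) * indicator {0..1} x \<partial>lborel)"
proof -
  have seg: "linepath a b x \<in> closed_segment a b" if "x \<in> {0..1}" for x
    using that by (auto simp: linepath_in_path)
  have cl: "continuous_on {0..1} (\<lambda>x. cmod (h (linepath a b x)))"
    by (intro continuous_on_norm continuous_on_compose2[OF h] continuous_on_linepath) (use seg in auto)
  then have J: "((\<lambda>x. cmod (h (linepath a b x))) has_integral (integral {0..1} (\<lambda>x. cmod (h (linepath a b x))))) {0..1}"
    by (intro integrable_integral integrable_continuous_real)
  have I': "((\<lambda>x. h (linepath a b x) / (linepath a b x - z) * (b - a)) has_integral I) {0..1}"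
    using I by (simp add: has_contour_integral_linepath)
  have "cmod I \<le> integral {0..1} (\<lambda>x. 2 * cmod (h (linepath a b x)))"
    unfolding integral_unique[OF I', symmetric]
  proof (rule Henstock_Kurzweil_Integration.integral_norm_bound_integral)
    show "(\<lambda>x. h (linepath a b x) / (linepath a b x - z) * (b - a)) integrable_on {0..1}"
      using I' by blast
    show "(\<lambda>x. 2 * cmod (h (linepath a b x))) integrable_on {0..1}"
      by (intro integrable_continuous_real continuous_intros cl)
    fix x :: real assume "x \<in> {0..1}"
    then have "s \<le> cmod (linepath a b x - z)" using far seg by blast
    then have "cmod (h (linepath a b x)) * (2 * s) / cmod (linepath a b x - z) \<le> cmod (h (linepath a b x)) * (2 * s) / s"
      using s by (intro divide_left_mono) (auto intro!: mult_pos_pos)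
    then show "cmod (h (linepath a b x) / (linepath a b x - z) * (b - a)) \<le> 2 * cmod (h (linepath a b x))"
      using s by (simp add: norm_mult norm_divide ab mult.commute)
  qed
  then have "ennreal (cmod I) \<le> ennreal (2 * integral {0..1} (\<lambda>x. cmod (h (linepath a b x))))"
    by (intro ennreal_leI) simp
  also have "\<dots> = 2 * ennreal (integral {0..1} (\<lambda>x. cmod (h (linepath a b x))))"
    using J by (subst ennreal_mult) (auto intro!: integral_nonneg)
  also have "ennreal (integral {0..1} (\<lambda>x. cmod (h (linepath a b x)))) = (\<integral>\<^sup>+x. ennreal (cmod (h (linepath a b x))) * indicator {0..1} x \<partial>lborel)"
    using nn_integral_has_integral_lebesgue'[OF _ J] by simp
  finally show ?thesis .
qed

text \<open>Cauchy's formula on the boundary of the square of half side s, averaged over r/2 \<le> s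
  < r. Squares instead of circles keep everything in Cartesian coordinates, so the average of a side
  over s is an area integral by Tonelli. Four sides, the factor 2 / (2 \<pi> r) and the length r/2
  of the interval combine to 8 / (\<pi> r^2).\<close>

lemma norm_le_square_mean_0:
  fixes h :: "complex \<Rightarrow> complex"
  assumes r: "r > 0" and h: "h holomorphic_on cbox (- Complex r r) (Complex r r)"
  shows "ennreal (cmod (h 0)) \<le> ennreal (8 / (pi * r\<^sup>2)) * (\<integral>\<^sup>+v. ennreal (cmod (h v)) * indicator (cbox (- Complex r r) (Complex r r)) v \<partial>lborel)"
proof -
  define Q where "Q = cbox (- Complex r r) (Complex r r)"
  define q where "q v = ennreal (cmod (h v)) * indicator Q v" for v
  have Q: "v \<in> Q \<longleftrightarrow> \<bar>Re v\<bar> \<le> r \<and> \<bar>Im v\<bar> \<le> r" for v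
    by (auto simp: Q_def in_cbox_complex_iff)
  have hc: "continuous_on Q h" using h unfolding Q_def by (rule holomorphic_on_imp_continuous_on)
  have [measurable]: "q \<in> borel_measurable borel"
  proof -
    have "(\<lambda>v. indicator Q v *\<^sub>R cmod (h v)) \<in> borel_measurable borel"
      by (intro borel_measurable_continuous_on_indicator continuous_intros hc) (simp add: Q_def)
    then have "(\<lambda>v. ennreal (indicator Q v *\<^sub>R cmod (h v))) \<in> borel_measurable borel" by measurable
    also have "(\<lambda>v. ennreal (indicator Q v *\<^sub>R cmod (h v))) = q"
      by (auto simp: q_def fun_eq_iff split: split_indicator)
    finally show ?thesis .
  qed
  have qm: "q \<in> borel_measurable borel" by fact
  have mq: "(\<lambda>p. q (Complex (fst p) (snd p))) \<in> borel_measurable (lborel \<Otimes>\<^sub>M lborel)"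
    and mq': "(\<lambda>p. q (Complex (snd p) (fst p))) \<in> borel_measurable (lborel \<Otimes>\<^sub>M lborel)"
    and [measurable]: "(\<lambda>t. q (Complex s t)) \<in> borel_measurable borel" "(\<lambda>s. q (Complex s t)) \<in> borel_measurable borel" for s t
    unfolding complex_eq lborel_prod measurable_lborel2
    by (intro measurable_compose[OF _ qm] borel_measurable_continuous_onI continuous_intros)+
  have m1: "(\<lambda>s. \<integral>\<^sup>+t. q (Complex s t) \<partial>lborel) \<in> borel_measurable borel"
    using lborel.borel_measurable_nn_integral[of "\<lambda>s t. q (Complex s t)" lborel] mq by (simp add: case_prod_beta')
  have m2: "(\<lambda>s. \<integral>\<^sup>+t. q (Complex t s) \<partial>lborel) \<in> borel_measurable borel"
    using lborel.borel_measurable_nn_integral[of "\<lambda>s t. q (Complex t s)" lborel] mq' by (simp add: case_prod_beta')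
  define J where "J = (\<integral>\<^sup>+v. q v \<partial>lborel)"
  have J1: "(\<integral>\<^sup>+s. \<integral>\<^sup>+t. q (Complex s t) \<partial>lborel \<partial>lborel) = J"
    unfolding J_def by (rule nn_integral_complex[OF qm, symmetric])
  have J2: "(\<integral>\<^sup>+s. \<integral>\<^sup>+t. q (Complex t s) \<partial>lborel \<partial>lborel) = J"
    unfolding J1[symmetric] using lborel_pair.Fubini'[of "\<lambda>s t. q (Complex t s)"] mq' by (simp add: case_prod_beta')
  define V where "V s = (\<integral>\<^sup>+t. q (Complex s t) \<partial>lborel)" for s
  define H where "H s = (\<integral>\<^sup>+t. q (Complex t s) \<partial>lborel)" for s
  have [measurable]: "V \<in> borel_measurable borel" "H \<in> borel_measurable borel"
    using m1 m2 by (auto simp: V_def[abs_def] H_def[abs_def])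
  \<comment> \<open>\<open>c\<close> is the signed length of a side; as its modulus is at least r,
    the Jacobian 1 / |c| is at most 1 / r, a bound free of s.\<close>
  have scale: "(\<integral>\<^sup>+x. ennreal (cmod (h (P (c * x + d)))) * indicator {0..1} x \<partial>lborel) \<le> ennreal (1 / r) * (\<integral>\<^sup>+t. q (P t) \<partial>lborel)"
    if c: "\<bar>c\<bar> \<ge> r" and PQ: "\<And>x. x \<in> {0..1} \<Longrightarrow> P (c * x + d) \<in> Q" and P: "(\<lambda>t. q (P t)) \<in> borel_measurable borel"
    for P c d
  proof -
    have "(\<integral>\<^sup>+x. ennreal (cmod (h (P (c * x + d)))) * indicator {0..1} x \<partial>lborel) \<le> (\<integral>\<^sup>+x. q (P (d + c * x)) \<partial>lborel)"
      by (rule nn_integral_mono) (use PQ in \<open>auto simp: q_def add.commute split: split_indicator\<close>)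
    also have "\<dots> = ennreal (1 / \<bar>c\<bar>) * (ennreal \<bar>c\<bar> * (\<integral>\<^sup>+x. q (P (d + c * x)) \<partial>lborel))"
      using c r by (subst mult.assoc[symmetric], subst ennreal_mult[symmetric]) auto
    also have "ennreal \<bar>c\<bar> * (\<integral>\<^sup>+x. q (P (d + c * x)) \<partial>lborel) = (\<integral>\<^sup>+t. q (P t) \<partial>lborel)"
      using nn_integral_real_affine[OF P, of c d] c r by auto
    also have "ennreal (1 / \<bar>c\<bar>) * (\<integral>\<^sup>+t. q (P t) \<partial>lborel) \<le> ennreal (1 / r) * (\<integral>\<^sup>+t. q (P t) \<partial>lborel)"
      using c r by (intro mult_right_mono ennreal_leI divide_left_mono) auto
    finally show ?thesis .
  qed
  have main: "ennreal (pi * r * cmod (h 0)) \<le> H (- s) + V s + H s + V (- s)" if s: "s \<in> {r/2..<r}" for s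
  proof -
    have s0: "s > 0" "s < r" "r \<le> 2 * s" using s r by auto
    define a1 a2 a3 a4 where "a1 = Complex (- s) (- s)" and "a2 = Complex s (- s)" and "a3 = Complex s s" and "a4 = Complex (- s) s"
    have "((\<lambda>w. h w / (w - 0)) has_contour_integral (2 * pi * \<i> * winding_number (rectpath a1 a3) 0 * h 0)) (rectpath a1 a3)"
    proof (rule Cauchy_integral_formula_convex_simple)
      show "convex Q" "h holomorphic_on Q" using h by (auto simp: Q_def)
      show "0 \<in> interior Q" using r by (simp add: Q_def in_box_complex_iff)
      show "path_image (rectpath a1 a3) \<subseteq> Q - {0}"
        using s0 by (auto simp: path_image_rectpath a1_def a3_def Q complex_eq_iff)
    qed auto
    moreover have "winding_number (rectpath a1 a3) 0 = 1"
      using s0 by (intro winding_number_rectpath) (auto simp: in_box_complex_iff a1_def a3_def)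
    ultimately have C: "((\<lambda>w. h w / (w - 0)) has_contour_integral (2 * pi * \<i> * h 0)) (rectpath a1 a3)" by simp
    have rp: "rectpath a1 a3 = linepath a1 a2 +++ linepath a2 a3 +++ linepath a3 a4 +++ linepath a4 a1"
      by (simp add: rectpath_def Let_def a1_def a2_def a3_def a4_def)
    from C have ci: "(\<lambda>w. h w / (w - 0)) contour_integrable_on linepath a1 a2" "(\<lambda>w. h w / (w - 0)) contour_integrable_on linepath a2 a3"
      "(\<lambda>w. h w / (w - 0)) contour_integrable_on linepath a3 a4" "(\<lambda>w. h w / (w - 0)) contour_integrable_on linepath a4 a1"
      unfolding rp by (auto dest!: has_contour_integral_integrable)
    define I where "I a b = contour_integral (linepath a b) (\<lambda>w. h w / (w - 0))" for a b
    have sum: "2 * pi * \<i> * h 0 = I a1 a2 + (I a2 a3 + (I a3 a4 + I a4 a1))"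
      using contour_integral_unique[OF C] ci unfolding rp I_def by (simp add: contour_integrable_joinI)
    have side: "ennreal (cmod (I (P (- e)) (P e))) \<le> 2 * (ennreal (1 / r) * (\<integral>\<^sup>+t. q (P t) \<partial>lborel))"
      if ci: "(\<lambda>w. h w / (w - 0)) contour_integrable_on linepath (P (- e)) (P e)"
        and P: "P = (\<lambda>t. Complex t k) \<or> P = (\<lambda>t. Complex k t)" and k: "\<bar>k\<bar> = s" and e: "\<bar>e\<bar> = s" for P k e
    proof -
      have lp: "linepath (P (- e)) (P e) x = P (2 * e * x + (- e))" for x
        using P by (auto simp: linepath_def complex_eq_iff algebra_simps)
      have PQ: "P (2 * e * x + (- e)) \<in> Q \<and> s \<le> cmod (P (2 * e * x + (- e)) - 0)" if "x \<in> {0..1}" for x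
      proof -
        have "2 * e * x + (- e) = e * (2 * x - 1)" by (simp add: algebra_simps)
        moreover have "\<bar>2 * x - 1\<bar> \<le> 1" using that by auto
        ultimately have "\<bar>2 * e * x + (- e)\<bar> \<le> s" using e s0 mult_left_le[of "\<bar>2 * x - 1\<bar>" s] by (simp add: abs_mult)
        moreover have "\<bar>k\<bar> \<le> cmod (P (2 * e * x + (- e)))"
          using P abs_Re_le_cmod[of "P (2 * e * x + (- e))"] abs_Im_le_cmod[of "P (2 * e * x + (- e))"] by auto
        ultimately show ?thesis using P k s0 by (auto simp: Q)
      qed
      have segs: "closed_segment (P (- e)) (P e) = (\<lambda>x. P (2 * e * x + (- e))) ` {0..1}"
        using lp linepath_image_01[of "P (- e)" "P e"] by auto
      have "ennreal (cmod (I (P (- e)) (P e))) \<le> 2 * (\<integral>\<^sup>+x. ennreal (cmod (h (linepath (P (- e)) (P e) x))) * indicator {0..1} x \<partial>lborel)"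
      proof (rule norm_linepath_Cauchy_integral_le[where s=s and z=0])
        show "continuous_on (closed_segment (P (- e)) (P e)) h"
          using PQ segs by (intro continuous_on_subset[OF hc]) auto
        show "s \<le> cmod (w - 0)" if "w \<in> closed_segment (P (- e)) (P e)" for w
          using that PQ unfolding segs by blast
        show "cmod (P e - P (- e)) = 2 * s" using P e by (auto simp: cmod_def real_sqrt_mult)
        show "((\<lambda>w. h w / (w - 0)) has_contour_integral I (P (- e)) (P e)) (linepath (P (- e)) (P e))"
          unfolding I_def using ci by (rule has_contour_integral_integral)
      qed (use s0 in auto)
      also have "\<dots> \<le> 2 * (ennreal (1 / r) * (\<integral>\<^sup>+t. q (P t) \<partial>lborel))"
        unfolding lp using P e s0 PQ by (intro mult_left_mono scale) auto
      finally show ?thesis .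
    qed
    have S1: "ennreal (cmod (I a1 a2)) \<le> 2 * (ennreal (1 / r) * H (- s))"
      unfolding H_def using side[of "\<lambda>t. Complex t (- s)" s "- s"] ci s0 by (auto simp: a1_def a2_def)
    have S2: "ennreal (cmod (I a2 a3)) \<le> 2 * (ennreal (1 / r) * V s)"
      unfolding V_def using side[of "\<lambda>t. Complex s t" s s] ci s0 by (auto simp: a2_def a3_def)
    have S3: "ennreal (cmod (I a3 a4)) \<le> 2 * (ennreal (1 / r) * H s)"
      unfolding H_def using side[of "\<lambda>t. Complex t s" "- s" s] ci s0 by (auto simp: a3_def a4_def)
    have S4: "ennreal (cmod (I a4 a1)) \<le> 2 * (ennreal (1 / r) * V (- s))"
      unfolding V_def using side[of "\<lambda>t. Complex (- s) t" "- s" "- s"] ci s0 by (auto simp: a4_def a1_def)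
    have "ennreal (2 * pi * cmod (h 0)) = ennreal (cmod (2 * pi * \<i> * h 0))" by (simp add: norm_mult)
    also have "\<dots> \<le> ennreal (cmod (I a1 a2) + (cmod (I a2 a3) + (cmod (I a3 a4) + cmod (I a4 a1))))"
      unfolding sum by (intro ennreal_leI order_trans[OF norm_triangle_ineq] add_left_mono order_refl)
    also have "\<dots> = ennreal (cmod (I a1 a2)) + (ennreal (cmod (I a2 a3)) + (ennreal (cmod (I a3 a4)) + ennreal (cmod (I a4 a1))))"
      by simp
    also have "\<dots> \<le> 2 * (ennreal (1 / r) * H (- s)) + (2 * (ennreal (1 / r) * V s) + (2 * (ennreal (1 / r) * H s) + 2 * (ennreal (1 / r) * V (- s))))"
      by (intro add_mono S1 S2 S3 S4)
    also have "\<dots> = ennreal (2 / r) * (H (- s) + V s + H s + V (- s))"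
    proof -
      have "ennreal (2 / r) = 2 * ennreal (1 / r)" using r by (subst ennreal_numeral[symmetric], subst ennreal_mult[symmetric]) auto
      then show ?thesis by (simp only: distrib_left mult.assoc add.assoc)
    qed
    finally have "ennreal (r / 2) * ennreal (2 * pi * cmod (h 0)) \<le> ennreal (r / 2) * (ennreal (2 / r) * (H (- s) + V s + H s + V (- s)))"
      by (rule mult_left_mono) simp
    moreover have "ennreal (r / 2) * ennreal (2 * pi * cmod (h 0)) = ennreal (pi * r * cmod (h 0))"
      using r by (subst ennreal_mult[symmetric]) (auto simp: mult_ac)
    moreover have "ennreal (r / 2) * (ennreal (2 / r) * (H (- s) + V s + H s + V (- s))) = H (- s) + V s + H s + V (- s)"
      using r by (subst mult.assoc[symmetric], subst ennreal_mult[symmetric]) auto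
    ultimately show ?thesis by simp
  qed
  have neg: "(\<integral>\<^sup>+s. f (- s) \<partial>lborel) = (\<integral>\<^sup>+s. f s \<partial>lborel)" if "f \<in> borel_measurable borel" for f :: "real \<Rightarrow> ennreal"
    using nn_integral_real_affine[OF that, of "-1" 0] by simp
  have "ennreal (r / 2 * (pi * r * cmod (h 0))) = (\<integral>\<^sup>+s. ennreal (pi * r * cmod (h 0)) * indicator {r/2..<r} s \<partial>lborel)"
    using r by (subst nn_integral_cmult_indicator) (auto simp: ennreal_mult[symmetric] mult.commute)
  \<comment> \<open>Enlarging the range of s to the whole line makes each of the four terms
    integrate to \<open>J\<close>.\<close>
  also have "\<dots> \<le> (\<integral>\<^sup>+s. H (- s) + V s + H s + V (- s) \<partial>lborel)"
    by (rule nn_integral_mono) (use main in \<open>auto split: split_indicator\<close>)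
  also have "\<dots> = J + J + J + J"
    using J1 J2 unfolding V_def[symmetric] H_def[symmetric]
    by (simp add: nn_integral_add neg[of H] neg[of V])
  also have "\<dots> = ennreal 4 * J"
  proof -
    have "ennreal 4 = 1 + 1 + 1 + 1" by simp
    then show ?thesis by (simp only: distrib_right mult_1)
  qed
  finally have "ennreal (2 / (pi * r\<^sup>2)) * ennreal (r / 2 * (pi * r * cmod (h 0))) \<le> ennreal (2 / (pi * r\<^sup>2)) * (ennreal 4 * J)"
    by (rule mult_left_mono) simp
  moreover have "ennreal (2 / (pi * r\<^sup>2)) * ennreal (r / 2 * (pi * r * cmod (h 0))) = ennreal (cmod (h 0))"
    using r by (subst ennreal_mult[symmetric]) (auto simp: power2_eq_square field_simps)
  moreover have "ennreal (2 / (pi * r\<^sup>2)) * (ennreal 4 * J) = ennreal (8 / (pi * r\<^sup>2)) * J"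
    using r by (subst mult.assoc[symmetric], subst ennreal_mult[symmetric]) auto
  ultimately show ?thesis by (simp add: J_def q_def Q_def)
qed

definition square :: "complex \<Rightarrow> real \<Rightarrow> complex set" where
  "square z r = cbox (z - Complex r r) (z + Complex r r)"

text \<open>The estimate at 0 is applied to w \<mapsto> h(z + w)^2, which is again holomorphic, so
  |h|^2 obeys it directly.\<close>

lemma norm_le_square_mean:
  assumes r: "r > 0" and h: "h holomorphic_on square z r"
  shows "ennreal ((cmod (h z))\<^sup>2) \<le> ennreal (8 / (pi * r\<^sup>2)) * (\<integral>\<^sup>+v. ennreal ((cmod (h v))\<^sup>2) * indicator (square z r) v \<partial>lborel)"
proof -
  define g where "g w = (h (z + w))\<^sup>2" for w
  have sq: "z + w \<in> square z r \<longleftrightarrow> w \<in> cbox (- Complex r r) (Complex r r)" for w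
    by (auto simp: square_def in_cbox_complex_iff)
  have hol: "g holomorphic_on cbox (- Complex r r) (Complex r r)"
    unfolding g_def by (intro holomorphic_intros holomorphic_on_compose_gen[OF _ h, unfolded comp_def]) (use sq in auto)
  have "(\<lambda>v. ennreal ((cmod (h v))\<^sup>2) * indicator (square z r) v) \<in> borel_measurable borel"
  proof -
    have "(\<lambda>v. indicator (square z r) v *\<^sub>R (cmod (h v))\<^sup>2) \<in> borel_measurable borel"
      by (intro borel_measurable_continuous_on_indicator continuous_intros holomorphic_on_imp_continuous_on[OF h]) (simp add: square_def)
    then have "(\<lambda>v. ennreal (indicator (square z r) v *\<^sub>R (cmod (h v))\<^sup>2)) \<in> borel_measurable borel" by measurable
    also have "(\<lambda>v. ennreal (indicator (square z r) v *\<^sub>R (cmod (h v))\<^sup>2)) = (\<lambda>v. ennreal ((cmod (h v))\<^sup>2) * indicator (square z r) v)"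
      by (auto simp: fun_eq_iff split: split_indicator)
    finally show ?thesis .
  qed
  then have "(\<integral>\<^sup>+v. ennreal ((cmod (h v))\<^sup>2) * indicator (square z r) v \<partial>lborel) = (\<integral>\<^sup>+w. ennreal ((cmod (h (z + w)))\<^sup>2) * indicator (square z r) (z + w) \<partial>lborel)"
    by (subst lborel_distr_plus[symmetric, of z]) (simp add: nn_integral_distr)
  with norm_le_square_mean_0[OF r hol] show ?thesis
    by (simp add: g_def norm_power sq indicator_def)
qed

section \<open>Locally integrable functions that vanish weakly\<close>

text \<open>Open boxes form an intersection-stable generator of the Borel sets, so the claim spreads
  to all of them. Complements need the total integral, which vanishes as a limit over growing
  boxes.\<close>

lemma AE_zero_if_box_integrals_zero:
  fixes h :: "'a::euclidean_space \<Rightarrow> complex"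
  assumes int: "integrable lborel h"
    and z: "\<And>a b. (LINT x|lborel. indicator (box a b) x *\<^sub>R h x) = 0"
  shows "AE x in lborel. h x = 0"
proof (rule sigma_finite_measure.density_zero[OF sigma_finite_lborel int])
  fix A :: "'a set" assume "A \<in> sets lborel"
  then have A: "A \<in> sigma_sets UNIV (range (\<lambda>(a, b). box a b :: 'a set))" by (simp add: borel_eq_box)
  have inti: "integrable lborel (\<lambda>x. indicator B x *\<^sub>R h x)" if "B \<in> sets borel" for B
    using integrable_mult_indicator[of B lborel h] int that by simp
  have sb: "sigma_sets UNIV (range (\<lambda>(a, b). box a b :: 'a set)) = sets borel"
    by (simp add: borel_eq_box)
  have "(\<lambda>n. LINT x|lborel. indicator (box (- (real n *\<^sub>R One)) (real n *\<^sub>R One)) x *\<^sub>R h x) \<longlonglongrightarrow> (LINT x|lborel. h x)"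
  proof (rule integral_dominated_convergence[where w="\<lambda>x. norm (h x)"])
    show "AE x in lborel. (\<lambda>n. indicator (box (- (real n *\<^sub>R One)) (real n *\<^sub>R One)) x *\<^sub>R h x) \<longlonglongrightarrow> h x"
    proof (rule AE_I2)
      fix x :: 'a
      obtain N where N: "x \<in> box (- (real N *\<^sub>R One)) (real N *\<^sub>R One)"
        using UN_box_eq_UNIV by blast
      have "x \<in> box (- (real n *\<^sub>R One)) (real n *\<^sub>R One)" if "n \<ge> N" for n
        using N that by (force simp: mem_box)
      then have "\<forall>\<^sub>F n in sequentially. indicator (box (- (real n *\<^sub>R One)) (real n *\<^sub>R One)) x *\<^sub>R h x = h x"
        by (auto simp: eventually_sequentially intro!: exI[of _ N])
      then show "(\<lambda>n. indicator (box (- (real n *\<^sub>R One)) (real n *\<^sub>R One)) x *\<^sub>R h x) \<longlonglongrightarrow> h x"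
        by (rule tendsto_eventually)
    qed
  qed (use int inti in \<open>auto split: split_indicator\<close>)
  then have tot: "(LINT x|lborel. h x) = 0" by (simp add: z LIMSEQ_const_iff)
  have st: "Int_stable (range (\<lambda>(a, b). box a b :: 'a set))" by (auto simp: Int_stable_def box_Int_box)
  have sub: "range (\<lambda>(a, b). box a b :: 'a set) \<subseteq> Pow UNIV" by simp
  have "(LINT x|lborel. indicator A x *\<^sub>R h x) = 0"
  proof (rule sigma_sets_induct_disjoint[where P="\<lambda>A. (LINT x|lborel. indicator A x *\<^sub>R h x) = 0", OF st sub A])
    fix B :: "'a set" assume B: "B \<in> sigma_sets UNIV (range (\<lambda>(a, b). box a b))" "(LINT x|lborel. indicator B x *\<^sub>R h x) = 0"
    have "(LINT x|lborel. indicator (UNIV - B) x *\<^sub>R h x) = (LINT x|lborel. h x - indicator B x *\<^sub>R h x)"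
      by (intro Bochner_Integration.integral_cong) (auto split: split_indicator)
    also have "\<dots> = 0" using int inti[of B] B tot by (subst Bochner_Integration.integral_diff) (auto simp: sb)
    finally show "(LINT x|lborel. indicator (UNIV - B) x *\<^sub>R h x) = 0" .
  next
    fix B :: "nat \<Rightarrow> 'a set"
    assume B: "disjoint_family B" "range B \<subseteq> sigma_sets UNIV (range (\<lambda>(a, b). box a b))" "\<And>i. (LINT x|lborel. indicator (B i) x *\<^sub>R h x) = 0"
    have "(LINT x:(\<Union>i. B i)|lborel. h x) = (\<Sum>i. LINT x:B i|lborel. h x)"
    proof (rule lebesgue_integral_countable_add)
      show "set_integrable lborel (\<Union> (range B)) h"
        unfolding set_integrable_def using B(2) by (intro inti) (auto simp: sb)
    qed (use B in \<open>auto simp: sb disjoint_family_on_def\<close>)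
    then show "(LINT x|lborel. indicator (\<Union>i. B i) x *\<^sub>R h x) = 0"
      using B(3) by (simp add: set_lebesgue_integral_def)
  qed (auto simp: z)
  then show "set_lebesgue_integral lborel A h = 0" by (simp add: set_lebesgue_integral_def)
qed

lemma box_Pair_eq: "box (a, c) (b, d) = box a b \<times> box c (d :: 'b::euclidean_space)"
  by (force simp: box_def Basis_prod_def)

lemma eq_0_if_notin_supp: "x \<notin> supp f \<Longrightarrow> f x = 0"
  unfolding supp_def by (meson closure_subset mem_Collect_eq subsetD)

text \<open>The distance to the complement, scaled by n and cut off at 1. Continuity is all that
  \<open>test_function\<close> asks for, so no smoothing is involved.\<close>

lemma box_bump:
  fixes a b :: "'a::euclidean_space"
  obtains \<phi> :: "nat \<Rightarrow> 'a \<Rightarrow> complex" where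
    "\<And>n. continuous_on UNIV (\<phi> n)" "\<And>n. supp (\<phi> n) \<subseteq> cbox a b" "\<And>n x. cmod (\<phi> n x) \<le> 1"
    "\<And>x. (\<lambda>n. \<phi> n x) \<longlonglongrightarrow> indicator (box a b) x"
proof
  define \<phi> where "\<phi> n x = complex_of_real (min 1 (real n * infdist x (- box a b)))" for n x
  have cl: "closed (- box a b)" by (simp add: closed_Compl open_box)
  have ne: "- box a b \<noteq> {}" by (metis bounded_box not_bounded_UNIV Compl_empty_eq double_compl)
  have z: "\<phi> n x = 0" if "x \<notin> box a b" for n x using that by (simp add: \<phi>_def)
  show "continuous_on UNIV (\<phi> n)" for n unfolding \<phi>_def by (intro continuous_intros)
  have "{x. \<phi> n x \<noteq> 0} \<subseteq> cbox a b" for n using z box_subset_cbox[of a b] by blast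
  then show "supp (\<phi> n) \<subseteq> cbox a b" for n unfolding supp_def by (rule closure_minimal) (rule closed_cbox)
  show "cmod (\<phi> n x) \<le> 1" for n x by (simp add: \<phi>_def infdist_nonneg)
  show "(\<lambda>n. \<phi> n x) \<longlonglongrightarrow> indicator (box a b) x" for x
  proof (cases "x \<in> box a b")
    case True
    then have pos: "infdist x (- box a b) > 0"
      using in_closed_iff_infdist_zero[OF cl ne, of x] infdist_nonneg[of x "- box a b"] by (auto simp: less_le)
    obtain N where N: "1 / infdist x (- box a b) < real N" using reals_Archimedean2 by blast
    have "\<phi> n x = 1" if "n \<ge> N" for n
    proof -
      have "1 / infdist x (- box a b) \<le> real n" using N that by linarith
      then have "1 \<le> real n * infdist x (- box a b)" using pos by (simp add: divide_le_eq)
      then show ?thesis by (simp add: \<phi>_def)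
    qed
    then have "\<forall>\<^sub>F n in sequentially. \<phi> n x = 1" by (auto simp: eventually_sequentially)
    then show ?thesis using True by (simp add: tendsto_eventually)
  qed (simp add: z)
qed

text \<open>A box in the product is a product of boxes, so its indicator is a limit of tensor
  products of bumps; on a small box the criterion by box integrals then applies. As D is only
  locally integrable in U, this is done for boxes whose closure lies in U, and countably many of
  them cover U.\<close>

lemma AE_zero_if_tensor_integrals_zero:
  fixes D :: "'a::euclidean_space \<times> 'b::euclidean_space \<Rightarrow> complex"
  assumes U: "open U"
    and loc: "\<And>C. compact C \<Longrightarrow> C \<subseteq> U \<Longrightarrow> set_integrable lborel C D"
    and zero: "\<And>f g. continuous_on UNIV f \<Longrightarrow> compact (supp f) \<Longrightarrow> continuous_on UNIV g \<Longrightarrow> compact (supp g) \<Longrightarrow> supp g \<times> supp f \<subseteq> U \<Longrightarrow>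
      (LINT (x, y)|lborel. D (x, y) * f y * cnj (g x)) = 0"
  shows "AE q in lborel. q \<in> U \<longrightarrow> D q = 0"
proof -
  have box: "(LINT q|lborel. indicator (box (a, c) (b, d)) q *\<^sub>R D q) = 0" if sub: "cbox (a, c) (b, d) \<subseteq> U" for a b :: 'a and c d :: 'b
  proof -
    obtain \<phi> where \<phi>: "\<And>n. continuous_on UNIV (\<phi> n)" "\<And>n. supp (\<phi> n) \<subseteq> cbox a b" "\<And>n x. cmod (\<phi> n x) \<le> 1"
      "\<And>x. (\<lambda>n. \<phi> n x) \<longlonglongrightarrow> indicator (box a b) x" by (rule box_bump) blast
    obtain \<psi> where \<psi>: "\<And>n. continuous_on UNIV (\<psi> n)" "\<And>n. supp (\<psi> n) \<subseteq> cbox c d" "\<And>n x. cmod (\<psi> n x) \<le> 1"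
      "\<And>x. (\<lambda>n. \<psi> n x) \<longlonglongrightarrow> indicator (box c d) x" by (rule box_bump) blast
    define C where "C = cbox (a, c) (b, d)"
    have int: "integrable lborel (\<lambda>q. indicator C q *\<^sub>R D q)"
      using loc[of C] sub by (simp add: C_def set_integrable_def)
    have C: "(x, y) \<in> C \<longleftrightarrow> x \<in> cbox a b \<and> y \<in> cbox c d" for x y by (simp add: C_def cbox_Pair_eq)
    have van: "\<phi> n x = 0" if "x \<notin> cbox a b" for n x using \<phi>(2)[of n] that by (intro eq_0_if_notin_supp) blast
    have van': "\<psi> n x = 0" if "x \<notin> cbox c d" for n x using \<psi>(2)[of n] that by (intro eq_0_if_notin_supp) blast
    have Deq: "D (x, y) * \<psi> n y * cnj (\<phi> n x) = indicator C (x, y) *\<^sub>R D (x, y) * \<psi> n y * cnj (\<phi> n x)" for x y n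
      by (cases "(x, y) \<in> C") (auto simp: C van van')
    have comp: "compact (supp (\<phi> n))" "compact (supp (\<psi> n))" for n
      using \<phi>(2)[of n] \<psi>(2)[of n] bounded_subset[OF bounded_cbox] unfolding compact_eq_bounded_closed
      by (auto simp: supp_def)
    have m\<phi>: "(\<lambda>q. \<phi> n (fst q)) \<in> borel_measurable borel" "(\<lambda>q. \<psi> n (snd q)) \<in> borel_measurable borel" for n
      by (intro borel_measurable_continuous_onI continuous_on_compose2[OF \<phi>(1)] continuous_on_compose2[OF \<psi>(1)] continuous_intros; simp)+
    have "(\<lambda>n. LINT q|lborel. D q * \<psi> n (snd q) * cnj (\<phi> n (fst q))) \<longlonglongrightarrow> (LINT q|lborel. indicator (box (a, c) (b, d)) q *\<^sub>R D q)"
    proof (rule integral_dominated_convergence[where w="\<lambda>q. norm (indicator C q *\<^sub>R D q)"])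
      have "(\<lambda>q. indicator C q *\<^sub>R D q) \<in> borel_measurable borel" using int by simp
      then have "(\<lambda>q. indicator (box (a, c) (b, d)) q *\<^sub>R (indicator C q *\<^sub>R D q)) \<in> borel_measurable borel"
        by measurable
      also have "(\<lambda>q. indicator (box (a, c) (b, d)) q *\<^sub>R (indicator C q *\<^sub>R D q)) = (\<lambda>q. indicator (box (a, c) (b, d)) q *\<^sub>R D q)"
        using box_subset_cbox[of "(a, c)" "(b, d)"] by (auto simp: C_def fun_eq_iff split: split_indicator)
      finally show "(\<lambda>q. indicator (box (a, c) (b, d)) q *\<^sub>R D q) \<in> borel_measurable lborel" by simp
      show "(\<lambda>q. D q * \<psi> n (snd q) * cnj (\<phi> n (fst q))) \<in> borel_measurable lborel" for n
      proof -
        have "(\<lambda>q. indicator C q *\<^sub>R D q * \<psi> n (snd q) * cnj (\<phi> n (fst q))) \<in> borel_measurable borel"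
          using int m\<phi>[of n] by (intro borel_measurable_times measurable_compose[OF _ measurable_cnj]) auto
        then show ?thesis using Deq[of "fst q" "snd q" n for q] by simp
      qed
      show "integrable lborel (\<lambda>q. norm (indicator C q *\<^sub>R D q))" using int by (rule integrable_norm)
      show "AE q in lborel. (\<lambda>n. D q * \<psi> n (snd q) * cnj (\<phi> n (fst q))) \<longlonglongrightarrow> indicator (box (a, c) (b, d)) q *\<^sub>R D q"
      proof (rule AE_I2)
        fix q :: "'a \<times> 'b"
        have "(\<lambda>n. D q * \<psi> n (snd q) * cnj (\<phi> n (fst q))) \<longlonglongrightarrow> D q * indicator (box c d) (snd q) * cnj (indicator (box a b) (fst q))"
          by (intro tendsto_intros \<phi> \<psi>)
        also have "D q * indicator (box c d) (snd q) * cnj (indicator (box a b) (fst q)) = indicator (box (a, c) (b, d)) q *\<^sub>R D q"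
          by (cases q) (auto simp: box_Pair_eq split: split_indicator)
        finally show "(\<lambda>n. D q * \<psi> n (snd q) * cnj (\<phi> n (fst q))) \<longlonglongrightarrow> indicator (box (a, c) (b, d)) q *\<^sub>R D q" .
      qed
      show "AE q in lborel. norm (D q * \<psi> n (snd q) * cnj (\<phi> n (fst q))) \<le> norm (indicator C q *\<^sub>R D q)" for n
      proof (rule AE_I2)
        fix q :: "'a \<times> 'b"
        have "norm (indicator C q *\<^sub>R D q) * (cmod (\<psi> n (snd q)) * cmod (\<phi> n (fst q))) \<le> norm (indicator C q *\<^sub>R D q) * (1 * 1)"
          by (intro mult_left_mono mult_mono \<phi> \<psi>) auto
        then show "norm (D q * \<psi> n (snd q) * cnj (\<phi> n (fst q))) \<le> norm (indicator C q *\<^sub>R D q)"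
          by (subst Deq[of "fst q" "snd q" n, simplified]) (simp add: norm_mult mult.assoc)
      qed
    qed
    moreover have "(LINT q|lborel. D q * \<psi> n (snd q) * cnj (\<phi> n (fst q))) = 0" for n
    proof -
      have "supp (\<phi> n) \<times> supp (\<psi> n) \<subseteq> U" using \<phi>(2)[of n] \<psi>(2)[of n] sub by (auto simp: cbox_Pair_eq)
      from zero[OF \<psi>(1) comp(2) \<phi>(1) comp(1) this] show ?thesis by (simp add: case_prod_beta')
    qed
    ultimately show ?thesis by (simp add: LIMSEQ_const_iff)
  qed
  have local: "AE q in lborel. q \<in> box p p' \<longrightarrow> D q = 0" if sub: "cbox p p' \<subseteq> U" for p p'
  proof -
    have int: "integrable lborel (\<lambda>q. indicator (box p p') q *\<^sub>R D q)"
    proof -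
      have "integrable lborel (\<lambda>q. indicator (box p p') q *\<^sub>R (indicator (cbox p p') q *\<^sub>R D q))"
        using integrable_mult_indicator[OF _ loc[of "cbox p p'", unfolded set_integrable_def], of "box p p'"] sub by simp
      also have "(\<lambda>q. indicator (box p p') q *\<^sub>R (indicator (cbox p p') q *\<^sub>R D q)) = (\<lambda>q. indicator (box p p') q *\<^sub>R D q)"
        using box_subset_cbox[of p p'] by (auto simp: fun_eq_iff split: split_indicator)
      finally show ?thesis .
    qed
    have "AE q in lborel. indicator (box p p') q *\<^sub>R D q = 0"
    proof (rule AE_zero_if_box_integrals_zero[OF int])
      fix u v :: "'a \<times> 'b"
      obtain s t where st: "box u v \<inter> box p p' = box s t" using box_Int_box by blast
      show "(LINT x|lborel. indicator (box u v) x *\<^sub>R indicator (box p p') x *\<^sub>R D x) = 0"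
      proof (cases "box s t = {}")
        case True
        then have eq: "indicator (box u v) x *\<^sub>R indicator (box p p') x *\<^sub>R D x = 0" for x using st by (auto split: split_indicator)
        show ?thesis unfolding eq by simp
      next
        case False
        \<comment> \<open>A closed box is the closure of the open one only if the latter is
          nonempty, hence the separate empty case. The closure keeps \<open>cbox s t\<close> inside
          \<open>cbox p p'\<close>.\<close>
        have "cbox s t = closure (box s t)" using closure_box[OF False] by simp
        also have "\<dots> \<subseteq> closure (box p p')" by (rule closure_mono) (use st in blast)
        also have "\<dots> \<subseteq> cbox p p'" by (rule closure_minimal) (auto simp: box_subset_cbox)
        finally have "cbox (fst s, snd s) (fst t, snd t) \<subseteq> U" using sub by auto
        from box[OF this] have "(LINT q|lborel. indicator (box s t) q *\<^sub>R D q) = 0" by simp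
        moreover have "indicator (box s t) q *\<^sub>R D q = indicator (box u v) q *\<^sub>R indicator (box p p') q *\<^sub>R D q" for q
          unfolding st[symmetric] by (auto split: split_indicator)
        ultimately show ?thesis by simp
      qed
    qed
    then show ?thesis by eventually_elim (auto simp: indicator_def)
  qed
  define F where "F = {box p p' |p p'. cbox p p' \<subseteq> U}"
  have "\<And>S. S \<in> F \<Longrightarrow> open S" by (auto simp: F_def open_box)
  \<comment> \<open>Countably many boxes suffice by Lindelof, so the exceptional null sets may be
    united.\<close>
  then obtain F' where F': "F' \<subseteq> F" "countable F'" "\<Union>F' = \<Union>F" by (rule Lindelof)
  have "U \<subseteq> \<Union>F"
  proof
    fix x assume "x \<in> U"
    then obtain p p' where "cbox p p' \<subseteq> U" "x \<in> box p p'"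
      by (rule open_contains_cbox[OF U])
    then show "x \<in> \<Union>F" unfolding F_def by blast
  qed
  have "AE q in lborel. q \<in> S \<longrightarrow> D q = 0" if "S \<in> F'" for S
    using that F'(1) local unfolding F_def by blast
  then have "AE q in lborel. \<forall>S\<in>F'. q \<in> S \<longrightarrow> D q = 0"
    by (subst AE_ball_countable[OF F'(2)]) simp
  then show ?thesis
  proof eventually_elim
    case (elim q)
    show ?case
    proof
      assume "q \<in> U"
      then have "q \<in> \<Union>F'" using \<open>U \<subseteq> \<Union>F\<close> unfolding F'(3) by (rule rev_subsetD)
      then show "D q = 0" using elim by blast
    qed
  qed
qed

section \<open>Weighted spaces of entire functions\<close>

locale continuous_weight =
  fixes p :: "complex \<Rightarrow> real"
  assumes cont_p: "continuous_on UNIV p" and p_nonneg: "0 \<le> p z"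
begin

lemma p_measurable [measurable]: "p \<in> borel_measurable borel"
  using cont_p by (rule borel_measurable_continuous_onI)

text \<open>Inner product of the weighted space, written exactly as the integral in
  \<open>bergman_kernel\<close>, so that unfolding the latter gives a condition on
  \<open>win\<close>; linear in the first argument.\<close>

definition win :: "real \<Rightarrow> (complex \<Rightarrow> complex) \<Rightarrow> (complex \<Rightarrow> complex) \<Rightarrow> complex" where
  "win \<tau> f g = (LINT v|lborel. f v * cnj (g v) * complex_of_real (exp (- 2 * \<tau> * p v)))"

definition wnorm2 :: "real \<Rightarrow> (complex \<Rightarrow> complex) \<Rightarrow> real" where
  "wnorm2 \<tau> f = (LINT v|lborel. (cmod (f v))\<^sup>2 * exp (- 2 * \<tau> * p v))"

abbreviation "WE \<equiv> weighted_entire p"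

lemma exp_weight: "exp (- 2 * \<tau> * p v) = exp (- \<tau> * p v) * exp (- \<tau> * p v)"
  by (simp flip: exp_add)

lemma WE_holomorphic: "f \<in> WE \<tau> \<Longrightarrow> f holomorphic_on UNIV"
  by (simp add: weighted_entire_def)

lemma WE_continuous: "f \<in> WE \<tau> \<Longrightarrow> continuous_on UNIV f"
  by (intro holomorphic_on_imp_continuous_on WE_holomorphic)

lemma WE_measurable: "f \<in> WE \<tau> \<Longrightarrow> f \<in> borel_measurable borel"
  by (intro borel_measurable_continuous_onI WE_continuous)

lemma WE_integrable: "f \<in> WE \<tau> \<Longrightarrow> integrable lborel (\<lambda>v. (cmod (f v))\<^sup>2 * exp (- 2 * \<tau> * p v))"
  by (simp add: weighted_entire_def)

lemma WE_L2:
  assumes "f \<in> WE \<tau>"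
  shows "(\<lambda>v. f v * complex_of_real (exp (- \<tau> * p v))) \<in> borel_measurable lborel"
    and "integrable lborel (\<lambda>v. (cmod (f v * complex_of_real (exp (- \<tau> * p v))))\<^sup>2)"
proof -
  have "(cmod (f v * complex_of_real (exp (- \<tau> * p v))))\<^sup>2 = (cmod (f v))\<^sup>2 * exp (- 2 * \<tau> * p v)" for v
    unfolding exp_weight by (simp add: norm_mult power2_eq_square)
  then show "integrable lborel (\<lambda>v. (cmod (f v * complex_of_real (exp (- \<tau> * p v))))\<^sup>2)"
    by (simp only: WE_integrable[OF assms])
qed (use WE_measurable[OF assms] in auto)

lemma WE_integrable_mult:
  assumes "f \<in> WE \<tau>" "g \<in> WE \<tau>"
  shows "integrable lborel (\<lambda>v. f v * cnj (g v) * complex_of_real (exp (- 2 * \<tau> * p v)))"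
    and "(cmod (win \<tau> f g))\<^sup>2 \<le> wnorm2 \<tau> f * wnorm2 \<tau> g"
proof -
  have m: "(\<lambda>v. cnj (g v * complex_of_real (exp (- \<tau> * p v)))) \<in> borel_measurable lborel"
    by (rule measurable_compose[OF WE_L2(1)[OF assms(2)] measurable_cnj])
  have i: "integrable lborel (\<lambda>v. (cmod (cnj (g v * complex_of_real (exp (- \<tau> * p v)))))\<^sup>2)"
    using WE_L2(2)[OF assms(2)] by (simp only: complex_mod_cnj)
  have eq: "f v * complex_of_real (exp (- \<tau> * p v)) * cnj (g v * complex_of_real (exp (- \<tau> * p v)))
     = f v * cnj (g v) * complex_of_real (exp (- 2 * \<tau> * p v))" for v
    unfolding exp_weight by simp
  have n: "(cmod (f v * complex_of_real (exp (- \<tau> * p v))))\<^sup>2 = (cmod (f v))\<^sup>2 * exp (- 2 * \<tau> * p v)" for f v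
    unfolding exp_weight by (simp add: norm_mult power2_eq_square)
  from Cauchy_Schwarz_integral[OF WE_L2[OF assms(1)] m i]
  show "integrable lborel (\<lambda>v. f v * cnj (g v) * complex_of_real (exp (- 2 * \<tau> * p v)))"
    and "(cmod (win \<tau> f g))\<^sup>2 \<le> wnorm2 \<tau> f * wnorm2 \<tau> g"
    unfolding eq complex_mod_cnj n win_def wnorm2_def by blast+
qed

lemma WE_I:
  assumes "f holomorphic_on UNIV" "(\<integral>\<^sup>+v. ennreal ((cmod (f v))\<^sup>2 * exp (- 2 * \<tau> * p v)) \<partial>lborel) \<le> ennreal B" "0 \<le> B"
  shows "f \<in> WE \<tau>" "wnorm2 \<tau> f \<le> B"
proof -
  have [measurable]: "f \<in> borel_measurable borel"
    using assms(1) by (intro borel_measurable_continuous_onI holomorphic_on_imp_continuous_on)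
  have "integrable lborel (\<lambda>v. (cmod (f v))\<^sup>2 * exp (- 2 * \<tau> * p v))"
    using assms(2) by (intro integrableI_bounded) (auto simp: top_unique less_top le_less_trans)
  then show "f \<in> WE \<tau>" using assms(1) by (simp add: weighted_entire_def)
  then have "ennreal (wnorm2 \<tau> f) \<le> ennreal B"
    using assms(2) nn_integral_eq_integral[OF WE_integrable] by (simp add: wnorm2_def)
  then show "wnorm2 \<tau> f \<le> B" using assms(3) by simp
qed

lemma nn_integral_wnorm2:
  "f \<in> WE \<tau> \<Longrightarrow> (\<integral>\<^sup>+v. ennreal ((cmod (f v))\<^sup>2 * exp (- 2 * \<tau> * p v)) \<partial>lborel) = ennreal (wnorm2 \<tau> f)"
  unfolding wnorm2_def by (rule nn_integral_eq_integral[OF WE_integrable]) auto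

lemma wnorm2_nonneg: "0 \<le> wnorm2 \<tau> f"
  unfolding wnorm2_def by (rule Bochner_Integration.integral_nonneg) simp

lemma win_self: "win \<tau> f f = complex_of_real (wnorm2 \<tau> f)"
  unfolding win_def wnorm2_def integral_complex_of_real[symmetric]
  by (intro Bochner_Integration.integral_cong refl) (simp only: of_real_mult complex_norm_square)

lemma win_commute: "win \<tau> g f = cnj (win \<tau> f g)"
  unfolding win_def by (subst Bochner_Integration.integral_cnj[symmetric]) (simp add: mult.commute)

lemma WE_zero: "(\<lambda>_. 0) \<in> WE \<tau>"
  by (simp add: weighted_entire_def)

lemma WE_add_scaled:
  assumes f: "f \<in> WE \<tau>" and g: "g \<in> WE \<tau>"
  shows "(\<lambda>v. f v + c * g v) \<in> WE \<tau>"
proof -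
  have hol: "(\<lambda>v. f v + c * g v) holomorphic_on UNIV"
    using f g by (intro holomorphic_intros WE_holomorphic)
  have [measurable]: "f \<in> borel_measurable borel" "g \<in> borel_measurable borel"
    using f g by (auto intro: WE_measurable)
  have "integrable lborel (\<lambda>v. (cmod (f v + c * g v))\<^sup>2 * exp (- 2 * \<tau> * p v))"
  proof (rule Bochner_Integration.integrable_bound)
    show "integrable lborel (\<lambda>v. 2 * ((cmod (f v))\<^sup>2 * exp (- 2 * \<tau> * p v)) + 2 * (cmod c)\<^sup>2 * ((cmod (g v))\<^sup>2 * exp (- 2 * \<tau> * p v)))"
      using f g by (intro Bochner_Integration.integrable_add integrable_mult_right WE_integrable)
    show "AE v in lborel. norm ((cmod (f v + c * g v))\<^sup>2 * exp (- 2 * \<tau> * p v)) \<le> norm (2 * ((cmod (f v))\<^sup>2 * exp (- 2 * \<tau> * p v)) + 2 * (cmod c)\<^sup>2 * ((cmod (g v))\<^sup>2 * exp (- 2 * \<tau> * p v)))"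
    proof (rule AE_I2)
      fix v
      have "(cmod (f v + c * g v))\<^sup>2 \<le> (cmod (f v) + cmod (c * g v))\<^sup>2"
        by (intro power_mono norm_triangle_ineq) auto
      also have "\<dots> \<le> 2 * (cmod (f v))\<^sup>2 + 2 * (cmod c)\<^sup>2 * (cmod (g v))\<^sup>2"
        using sum_squares_bound[of "cmod (f v)" "cmod (c * g v)"] by (simp add: power2_sum norm_mult power_mult_distrib)
      finally have "(cmod (f v + c * g v))\<^sup>2 * exp (- 2 * \<tau> * p v) \<le> (2 * (cmod (f v))\<^sup>2 + 2 * (cmod c)\<^sup>2 * (cmod (g v))\<^sup>2) * exp (- 2 * \<tau> * p v)"
        by (rule mult_right_mono) simp
      then show "norm ((cmod (f v + c * g v))\<^sup>2 * exp (- 2 * \<tau> * p v)) \<le> norm (2 * ((cmod (f v))\<^sup>2 * exp (- 2 * \<tau> * p v)) + 2 * (cmod c)\<^sup>2 * ((cmod (g v))\<^sup>2 * exp (- 2 * \<tau> * p v)))"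
        by (simp add: distrib_right mult.assoc abs_of_nonneg)
    qed
  qed measurable
  then show ?thesis using hol by (simp add: weighted_entire_def)
qed

lemma WE_scaled: "g \<in> WE \<tau> \<Longrightarrow> (\<lambda>v. c * g v) \<in> WE \<tau>"
  using WE_add_scaled[OF WE_zero, of g \<tau> c] by simp

lemma win_add_scaled_left:
  assumes "f \<in> WE \<tau>" "g \<in> WE \<tau>" "k \<in> WE \<tau>"
  shows "win \<tau> (\<lambda>v. f v + c * g v) k = win \<tau> f k + c * win \<tau> g k"
proof -
  have "win \<tau> (\<lambda>v. f v + c * g v) k = (LINT v|lborel. f v * cnj (k v) * complex_of_real (exp (- 2 * \<tau> * p v)) + c * (g v * cnj (k v) * complex_of_real (exp (- 2 * \<tau> * p v))))"
    unfolding win_def by (intro Bochner_Integration.integral_cong) (auto simp: algebra_simps)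
  also have "\<dots> = win \<tau> f k + c * win \<tau> g k"
    unfolding win_def
    by (subst Bochner_Integration.integral_add[OF WE_integrable_mult(1)[OF assms(1,3)] integrable_mult_right[OF WE_integrable_mult(1)[OF assms(2,3)]]]) simp
  finally show ?thesis .
qed

lemma win_add_scaled_right:
  assumes "f \<in> WE \<tau>" "g \<in> WE \<tau>" "k \<in> WE \<tau>"
  shows "win \<tau> k (\<lambda>v. f v + c * g v) = win \<tau> k f + cnj c * win \<tau> k g"
  using win_add_scaled_left[OF assms, of c] by (simp add: win_commute[of \<tau> k])

text \<open>Used for the variation of a norm minimiser and for recovering the values of the kernel
  from norms by polarisation.\<close>

lemma wnorm2_add_scaled:
  assumes "f \<in> WE \<tau>" "g \<in> WE \<tau>"
  shows "wnorm2 \<tau> (\<lambda>v. f v + c * g v) = wnorm2 \<tau> f + 2 * Re (c * win \<tau> g f) + (cmod c)\<^sup>2 * wnorm2 \<tau> g"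
proof -
  have "complex_of_real (wnorm2 \<tau> (\<lambda>v. f v + c * g v)) = win \<tau> f f + cnj c * win \<tau> f g + c * (win \<tau> g f + cnj c * win \<tau> g g)"
    unfolding win_self[symmetric] using assms
    by (simp add: win_add_scaled_left win_add_scaled_right WE_add_scaled)
  also have "\<dots> = complex_of_real (wnorm2 \<tau> f) + (c * win \<tau> g f + cnj (c * win \<tau> g f)) + c * cnj c * complex_of_real (wnorm2 \<tau> g)"
    by (simp add: win_self win_commute[of \<tau> f g] algebra_simps)
  also have "\<dots> = complex_of_real (wnorm2 \<tau> f + 2 * Re (c * win \<tau> g f) + (cmod c)\<^sup>2 * wnorm2 \<tau> g)"
    by (simp only: complex_add_cnj complex_norm_square of_real_add of_real_mult)
  finally show ?thesis by (simp only: of_real_eq_iff)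
qed

section \<open>Pointwise bounds for entire functions, uniform in the frequency\<close>

lemma p_oscillation:
  assumes "compact K" "\<delta> > 0"
  obtains r where "r > 0" "\<And>z v. z \<in> K \<Longrightarrow> v \<in> square z r \<Longrightarrow> \<bar>p v - p z\<bar> \<le> \<delta>"
    "\<And>z v. v \<in> square z r \<Longrightarrow> cmod (v - z) \<le> 1"
proof -
  \<comment> \<open>Squares around points of K leave K, so uniform continuity is taken on its closed
    1-neighbourhood.\<close>
  define K1 where "K1 = {x + y | x y. x \<in> K \<and> y \<in> cball 0 1}"
  have "compact K1" unfolding K1_def by (intro compact_sums assms compact_cball)
  then have "uniformly_continuous_on K1 p"
    by (intro compact_uniformly_continuous continuous_on_subset[OF cont_p]) auto
  then obtain d where d: "d > 0" "\<And>x x'. x \<in> K1 \<Longrightarrow> x' \<in> K1 \<Longrightarrow> dist x' x < d \<Longrightarrow> dist (p x') (p x) < \<delta>"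
    using assms(2) unfolding uniformly_continuous_on_def by metis
  \<comment> \<open>Points of \<open>square z r\<close> are within 2 r of z, because |Re| + |Im|
    bounds the modulus; with this r that is at most 1 and less than d.\<close>
  define r where "r = min 1 d / 4"
  have r: "r > 0" using d(1) by (simp add: r_def)
  have close: "cmod (v - z) \<le> 2 * r" if "v \<in> square z r" for v z
  proof -
    have "\<bar>Re (v - z)\<bar> \<le> r" "\<bar>Im (v - z)\<bar> \<le> r"
      using that by (auto simp: square_def in_cbox_complex_iff)
    then show ?thesis using cmod_le[of "v - z"] by linarith
  qed
  show ?thesis
  proof
    show "r > 0" by fact
    show "cmod (v - z) \<le> 1" if "v \<in> square z r" for z v
      using close[OF that] by (simp add: r_def min_def split: if_splits)
    fix z v assume z: "z \<in> K" and v: "v \<in> square z r"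
    have c: "cmod (v - z) \<le> 1" "cmod (v - z) < d"
      using close[OF v] d(1) by (auto simp: r_def min_def split: if_splits)
    have "z \<in> K1" unfolding K1_def using z by (force intro: exI[of _ z] exI[of _ 0])
    moreover have "v \<in> K1"
    proof -
      have "v = z + (v - z) \<and> z \<in> K \<and> v - z \<in> cball 0 1" using z c(1) by simp
      then show ?thesis unfolding K1_def by blast
    qed
    ultimately have "dist (p v) (p z) < \<delta>" using c(2) by (intro d(2)) (auto simp: dist_norm)
    then show "\<bar>p v - p z\<bar> \<le> \<delta>" by (simp add: dist_real_def)
  qed
qed

text \<open>The mean value estimate on a square so small that p varies there by at most \<delta>.
  The constant C does not depend on \<tau>: the whole price is the factor exp (2 \<tau> \<delta>),
  which any positive distance from the boundary can pay.\<close>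

lemma WE_pointwise_bound:
  assumes K: "compact K" and \<delta>: "\<delta> > 0"
  obtains C where "C > 0" "\<And>\<tau> f z. \<tau> > 0 \<Longrightarrow> f \<in> WE \<tau> \<Longrightarrow> z \<in> K \<Longrightarrow> (cmod (f z))\<^sup>2 \<le> C * exp (2 * \<tau> * (p z + \<delta>)) * wnorm2 \<tau> f"
proof -
  obtain r where r: "r > 0" "\<And>z v. z \<in> K \<Longrightarrow> v \<in> square z r \<Longrightarrow> \<bar>p v - p z\<bar> \<le> \<delta>"
    by (rule p_oscillation[OF K \<delta>]) blast
  define C where "C = 8 / (pi * r\<^sup>2)"
  have "C > 0" using r by (simp add: C_def)
  moreover have "(cmod (f z))\<^sup>2 \<le> C * exp (2 * \<tau> * (p z + \<delta>)) * wnorm2 \<tau> f"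
    if \<tau>: "\<tau> > 0" and f: "f \<in> WE \<tau>" and z: "z \<in> K" for \<tau> f z
  proof -
    have [measurable]: "f \<in> borel_measurable borel" using f by (rule WE_measurable)
    have "ennreal ((cmod (f z))\<^sup>2) \<le> ennreal C * (\<integral>\<^sup>+v. ennreal ((cmod (f v))\<^sup>2) * indicator (square z r) v \<partial>lborel)"
      unfolding C_def by (intro norm_le_square_mean r holomorphic_on_subset[OF WE_holomorphic[OF f]]) simp
    also have "\<dots> \<le> ennreal C * (\<integral>\<^sup>+v. ennreal (exp (2 * \<tau> * (p z + \<delta>))) * ennreal ((cmod (f v))\<^sup>2 * exp (- 2 * \<tau> * p v)) \<partial>lborel)"
    proof (intro mult_left_mono nn_integral_mono)
      fix v
      show "ennreal ((cmod (f v))\<^sup>2) * indicator (square z r) v \<le> ennreal (exp (2 * \<tau> * (p z + \<delta>))) * ennreal ((cmod (f v))\<^sup>2 * exp (- 2 * \<tau> * p v))"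
      proof (cases "v \<in> square z r")
        case True
        then have "p v \<le> p z + \<delta>" using r(2)[OF z True] by linarith
        then have "1 \<le> exp (2 * \<tau> * (p z + \<delta>) + (- 2 * \<tau> * p v))" using \<tau> by simp
        then have "(cmod (f v))\<^sup>2 * 1 \<le> (cmod (f v))\<^sup>2 * (exp (2 * \<tau> * (p z + \<delta>)) * exp (- 2 * \<tau> * p v))"
          unfolding exp_add[symmetric] by (rule mult_left_mono) simp
        then show ?thesis using True by (subst ennreal_mult[symmetric]) (auto simp: mult_ac intro!: ennreal_leI)
      qed simp
    qed simp
    also have "\<dots> = ennreal C * (ennreal (exp (2 * \<tau> * (p z + \<delta>))) * ennreal (wnorm2 \<tau> f))"
      by (subst nn_integral_cmult) (measurable, simp only: nn_integral_wnorm2[OF f])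
    also have "\<dots> = ennreal (C * exp (2 * \<tau> * (p z + \<delta>)) * wnorm2 \<tau> f)"
      using \<open>C > 0\<close> wnorm2_nonneg by (simp add: ennreal_mult mult.assoc)
    finally show ?thesis using \<open>C > 0\<close> wnorm2_nonneg by (subst (asm) ennreal_le_iff) auto
  qed
  ultimately show ?thesis using that by blast
qed

lemma WE_eq_0:
  assumes "\<tau> > 0" "f \<in> WE \<tau>" "wnorm2 \<tau> f = 0"
  shows "f z = 0"
  using WE_pointwise_bound[of "{z}" 1] assms by (metis compact_insert compact_empty insertI1 less_numeral_extra(1) mult_zero_right norm_ge_zero power2_less_eq_zero_iff norm_eq_zero zero_less_one)

text \<open>For a fixed frequency the exponential is absorbed in the constant; this is the local
  boundedness that Montel's theorem asks for.\<close>

lemma WE_locally_bounded: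
  assumes "\<tau> > 0" "compact K"
  obtains C where "C > 0" "\<And>f z. f \<in> WE \<tau> \<Longrightarrow> z \<in> K \<Longrightarrow> (cmod (f z))\<^sup>2 \<le> C * wnorm2 \<tau> f"
proof -
  obtain C where C: "C > 0" "\<And>\<tau> f z. \<tau> > 0 \<Longrightarrow> f \<in> WE \<tau> \<Longrightarrow> z \<in> K \<Longrightarrow> (cmod (f z))\<^sup>2 \<le> C * exp (2 * \<tau> * (p z + 1)) * wnorm2 \<tau> f"
    using WE_pointwise_bound[OF assms(2), of 1] by auto
  have "compact (p ` K)" using cont_p assms(2) by (meson compact_continuous_image continuous_on_subset top_greatest)
  then obtain M where M: "\<And>z. z \<in> K \<Longrightarrow> p z \<le> M" by (meson bounded_imp_bdd_above bdd_above.E compact_imp_bounded imageI)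
  show ?thesis
  proof
    show "0 < C * exp (2 * \<tau> * (M + 1))" using C(1) by simp
    fix f z assume f: "f \<in> WE \<tau>" and z: "z \<in> K"
    have "(cmod (f z))\<^sup>2 \<le> C * exp (2 * \<tau> * (p z + 1)) * wnorm2 \<tau> f" using C(2) assms(1) f z by blast
    also have "\<dots> \<le> C * exp (2 * \<tau> * (M + 1)) * wnorm2 \<tau> f"
      using C(1) assms(1) M[OF z] by (intro mult_right_mono mult_left_mono wnorm2_nonneg) auto
    finally show "(cmod (f z))\<^sup>2 \<le> C * exp (2 * \<tau> * (M + 1)) * wnorm2 \<tau> f" .
  qed
qed

text \<open>The norm is minimised on the hyperplane \<Lambda> = 1. Montel's theorem takes the place
  of completeness: a minimising sequence has a locally uniform limit, and this mode of convergence
  is enough because \<Lambda> is controlled by the supremum over a compact set. The minimiser is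
  orthogonal to the kernel of \<Lambda>, hence a multiple of it represents \<Lambda>.\<close>

lemma WE_Riesz:
  assumes \<tau>: "\<tau> > 0"
    and lin: "\<And>f g c. f \<in> WE \<tau> \<Longrightarrow> g \<in> WE \<tau> \<Longrightarrow> \<Lambda> (\<lambda>v. f v + c * g v) = \<Lambda> f + c * \<Lambda> g"
    and K: "compact K" and bd: "\<And>f B. f \<in> WE \<tau> \<Longrightarrow> 0 \<le> B \<Longrightarrow> (\<And>z. z \<in> K \<Longrightarrow> cmod (f z) \<le> B) \<Longrightarrow> cmod (\<Lambda> f) \<le> C * B"
  obtains k where "k \<in> WE \<tau>" "\<And>f. f \<in> WE \<tau> \<Longrightarrow> \<Lambda> f = win \<tau> f k"
proof (cases "\<forall>f\<in>WE \<tau>. \<Lambda> f = 0")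
  case True
  then show ?thesis using that[OF WE_zero] by (simp add: win_def)
next
  case False
  then obtain f0 where f0: "f0 \<in> WE \<tau>" "\<Lambda> f0 \<noteq> 0" by blast
  have \<Lambda>0: "\<Lambda> (\<lambda>_. 0) = 0" using bd[OF WE_zero, of 0] by simp
  have \<Lambda>scale: "\<Lambda> (\<lambda>v. c * g v) = c * \<Lambda> g" if "g \<in> WE \<tau>" for g c
    using lin[OF WE_zero that, of c] \<Lambda>0 by simp
  define A where "A = {f \<in> WE \<tau>. \<Lambda> f = 1}"
  have "(\<lambda>v. (1 / \<Lambda> f0) * f0 v) \<in> A" unfolding A_def
  proof (intro CollectI conjI WE_scaled f0)
    show "\<Lambda> (\<lambda>v. (1 / \<Lambda> f0) * f0 v) = 1" unfolding \<Lambda>scale[OF f0(1)] using f0(2) by simp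
  qed
  then have ne: "A \<noteq> {}" by blast
  define d where "d = (INF f\<in>A. wnorm2 \<tau> f)"
  have bdd: "bdd_below (wnorm2 \<tau> ` A)" using wnorm2_nonneg by (auto intro: bdd_belowI2[where m=0])
  have d_le: "d \<le> wnorm2 \<tau> f" if "f \<in> A" for f unfolding d_def using bdd that by (rule cINF_lower)
  have d0: "d \<ge> 0" unfolding d_def using ne wnorm2_nonneg by (intro cINF_greatest) auto
  have "\<exists>f\<in>A. wnorm2 \<tau> f < d + 1 / real (Suc n)" for n
    using cINF_less_iff[OF ne bdd, of "d + 1 / real (Suc n)"] unfolding d_def by simp
  then obtain F where F: "\<And>n. F n \<in> A" "\<And>n. wnorm2 \<tau> (F n) < d + 1 / real (Suc n)" by metis
  define \<H> where "\<H> = {f \<in> WE \<tau>. wnorm2 \<tau> f \<le> d + 1}"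
  have FH: "range F \<subseteq> \<H>"
  proof -
    have "wnorm2 \<tau> (F n) \<le> d + 1" for n using F(2)[of n] by (rule less_imp_le[THEN order_trans]) simp
    then show ?thesis using F(1) by (auto simp: \<H>_def A_def)
  qed
  obtain g r where g: "g holomorphic_on UNIV" "strict_mono (r :: nat \<Rightarrow> nat)" "\<And>x. (\<lambda>n. F (r n) x) \<longlonglongrightarrow> g x"
    "\<And>K. compact K \<Longrightarrow> uniform_limit K (F \<circ> r) g sequentially"
  proof (rule Montel[of UNIV \<H> F])
    show "\<exists>B. \<forall>h\<in>\<H>. \<forall>z\<in>K. cmod (h z) \<le> B" if cK: "compact K" for K
    proof -
      obtain C where C: "C > 0" "\<And>f z. f \<in> WE \<tau> \<Longrightarrow> z \<in> K \<Longrightarrow> (cmod (f z))\<^sup>2 \<le> C * wnorm2 \<tau> f"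
        by (rule WE_locally_bounded[OF \<tau> cK]) blast
      have "cmod (h z) \<le> sqrt (C * (d + 1))" if "h \<in> \<H>" "z \<in> K" for h z
      proof (rule real_le_rsqrt)
        have "(cmod (h z))\<^sup>2 \<le> C * wnorm2 \<tau> h" using C(2) that by (auto simp: \<H>_def)
        also have "\<dots> \<le> C * (d + 1)" using C(1) that by (intro mult_left_mono) (auto simp: \<H>_def)
        finally show "(cmod (h z))\<^sup>2 \<le> C * (d + 1)" .
      qed
      then show ?thesis by blast
    qed
  qed (use FH in \<open>auto simp: \<H>_def WE_holomorphic\<close>)
  have FWE: "F n \<in> WE \<tau>" for n using F(1) by (simp add: A_def)
  have lim_d: "(\<lambda>n. ennreal (d + 1 / real (Suc (r n)))) \<longlonglongrightarrow> ennreal d"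
  proof -
    have "(\<lambda>n. 1 / real (Suc n)) \<longlonglongrightarrow> 0" using LIMSEQ_inverse_real_of_nat by (simp add: inverse_eq_divide)
    then have "(\<lambda>n. 1 / real (Suc (r n))) \<longlonglongrightarrow> 0"
      using LIMSEQ_subseq_LIMSEQ[OF _ g(2)] by (fastforce simp: comp_def)
    then have "(\<lambda>n. d + 1 / real (Suc (r n))) \<longlonglongrightarrow> d + 0" by (intro tendsto_intros)
    then show ?thesis by (intro tendsto_ennrealI) simp
  qed
  have "(\<integral>\<^sup>+v. ennreal ((cmod (g v))\<^sup>2 * exp (- 2 * \<tau> * p v)) \<partial>lborel) = (\<integral>\<^sup>+v. liminf (\<lambda>n. ennreal ((cmod (F (r n) v))\<^sup>2 * exp (- 2 * \<tau> * p v))) \<partial>lborel)"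
  proof (intro nn_integral_cong)
    fix v
    have "(\<lambda>n. ennreal ((cmod (F (r n) v))\<^sup>2 * exp (- 2 * \<tau> * p v))) \<longlonglongrightarrow> ennreal ((cmod (g v))\<^sup>2 * exp (- 2 * \<tau> * p v))"
      by (intro tendsto_ennrealI tendsto_intros g)
    then show "ennreal ((cmod (g v))\<^sup>2 * exp (- 2 * \<tau> * p v)) = liminf (\<lambda>n. ennreal ((cmod (F (r n) v))\<^sup>2 * exp (- 2 * \<tau> * p v)))"
      by (rule lim_imp_Liminf[symmetric, rotated]) simp
  qed
  also have "\<dots> \<le> liminf (\<lambda>n. \<integral>\<^sup>+v. ennreal ((cmod (F (r n) v))\<^sup>2 * exp (- 2 * \<tau> * p v)) \<partial>lborel)"
    by (rule nn_integral_liminf) (use WE_measurable[OF FWE] p_measurable in measurable)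
  also have "\<dots> \<le> liminf (\<lambda>n. ennreal (d + 1 / real (Suc (r n))))"
    unfolding nn_integral_wnorm2[OF FWE] using F(2) by (intro Liminf_mono always_eventually allI ennreal_leI less_imp_le)
  also have "\<dots> = ennreal d" by (rule lim_imp_Liminf[OF _ lim_d]) simp
  \<comment> \<open>By Fatou's lemma the limit has squared norm at most the infimum, so it is a
    minimiser once \<open>\<Lambda> g = 1\<close> is known.\<close>
  finally have gWE: "g \<in> WE \<tau>" and gd: "wnorm2 \<tau> g \<le> d" using WE_I[OF g(1) _ d0] by auto
  have "(\<lambda>n. \<Lambda> (F (r n)) - \<Lambda> g) \<longlonglongrightarrow> 0"
  proof (rule tendstoI)
    fix e :: real assume "e > 0"
    \<comment> \<open>No sign is assumed for \<open>C\<close>, hence the modulus; the 1 avoids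
      division by zero.\<close>
    define e' where "e' = e / (\<bar>C\<bar> + 1)"
    have e': "e' > 0" using \<open>e > 0\<close> by (simp add: e'_def)
    have "\<forall>\<^sub>F n in sequentially. \<forall>x\<in>K. dist ((F \<circ> r) n x) (g x) < e'"
      using uniform_limitD[OF g(4)[OF K] e'] .
    then show "\<forall>\<^sub>F n in sequentially. dist (\<Lambda> (F (r n)) - \<Lambda> g) 0 < e"
    proof eventually_elim
      case (elim n)
      have eq: "\<Lambda> (\<lambda>v. F (r n) v + (-1) * g v) = \<Lambda> (F (r n)) - \<Lambda> g" using lin[OF FWE gWE, of "r n" "-1"] by simp
      have "cmod (\<Lambda> (\<lambda>v. F (r n) v + (-1) * g v)) \<le> C * e'"
        using elim e' by (intro bd WE_add_scaled FWE gWE) (auto simp: dist_norm less_imp_le)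
      also have "\<dots> \<le> \<bar>C\<bar> * e'" using e' by (intro mult_right_mono) auto
      also have "\<dots> < (\<bar>C\<bar> + 1) * e'" using e' by (intro mult_strict_right_mono) auto
      also have "\<dots> = e" by (simp add: e'_def)
      finally show ?case unfolding eq by simp
    qed
  qed
  moreover have "\<Lambda> (F n) = 1" for n using F(1) by (simp add: A_def)
  ultimately have \<Lambda>g: "\<Lambda> g = 1" by (simp add: LIMSEQ_const_iff)
  then have gA: "g \<in> A" using gWE by (simp add: A_def)
  have dg: "wnorm2 \<tau> g = d" using gd d_le[OF gA] by simp
  have orth: "win \<tau> h g = 0" if h: "h \<in> WE \<tau>" "\<Lambda> h = 0" for h
  proof (rule ccontr)
    define w where "w = win \<tau> h g"
    assume "win \<tau> h g \<noteq> 0"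
    then have w: "(cmod w)\<^sup>2 > 0" by (simp add: w_def)
    \<comment> \<open>A step along h of this size makes the quadratic term of
      \<open>wnorm2_add_scaled\<close> smaller than the linear one, so a nonzero inner product with
      h would lower the minimal norm.\<close>
    define t where "t = 1 / (wnorm2 \<tau> h + 1)"
    have t: "t > 0" "t * wnorm2 \<tau> h < 1" using wnorm2_nonneg[of \<tau> h] by (auto simp: t_def)
    define c where "c = - complex_of_real t * cnj w"
    have "(\<lambda>v. g v + c * h v) \<in> A" unfolding A_def using lin[OF gWE h(1)] h(2) \<Lambda>g WE_add_scaled[OF gWE h(1)] by simp
    then have "wnorm2 \<tau> g \<le> wnorm2 \<tau> (\<lambda>v. g v + c * h v)" using d_le dg by simp
    also have "\<dots> = wnorm2 \<tau> g + 2 * Re (c * w) + (cmod c)\<^sup>2 * wnorm2 \<tau> h"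
      unfolding wnorm2_add_scaled[OF gWE h(1)] w_def ..
    also have "Re (c * w) = - t * (cmod w)\<^sup>2"
    proof -
      have "c * w = complex_of_real (- t * (cmod w)\<^sup>2)"
        unfolding c_def of_real_mult complex_norm_square by simp
      then show ?thesis by (simp only: Re_complex_of_real)
    qed
    also have "(cmod c)\<^sup>2 = t\<^sup>2 * (cmod w)\<^sup>2" unfolding c_def by (simp add: norm_mult power_mult_distrib)
    finally have "0 \<le> t * (cmod w)\<^sup>2 * (t * wnorm2 \<tau> h - 2)" by (simp add: power2_eq_square algebra_simps)
    moreover have "t * (cmod w)\<^sup>2 * (t * wnorm2 \<tau> h - 2) < 0" using t w by (intro mult_pos_neg mult_pos_pos) auto
    ultimately show False by simp
  qed
  have "d \<noteq> 0"
  proof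
    assume "d = 0"
    then have "g v = 0" for v using WE_eq_0[OF \<tau> gWE] dg by simp
    then have "g = (\<lambda>_. 0)" by auto
    then show False using \<Lambda>g \<Lambda>0 by simp
  qed
  show ?thesis
  proof
    show "(\<lambda>v. complex_of_real (1 / d) * g v) \<in> WE \<tau>" by (rule WE_scaled[OF gWE])
    fix f assume f: "f \<in> WE \<tau>"
    \<comment> \<open>Subtracting \<open>\<Lambda> f\<close> times g lands in the kernel of
      \<Lambda>, which is orthogonal to g; the representer is therefore g divided by its squared
      norm d.\<close>
    have "win \<tau> (\<lambda>v. f v + (- \<Lambda> f) * g v) g = 0"
    proof (rule orth[OF WE_add_scaled[OF f gWE]])
      show "\<Lambda> (\<lambda>v. f v + (- \<Lambda> f) * g v) = 0" unfolding lin[OF f gWE] \<Lambda>g by simp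
    qed
    then have eq: "win \<tau> f g = \<Lambda> f * complex_of_real d"
      unfolding win_add_scaled_left[OF f gWE gWE] win_self dg by simp
    have "win \<tau> f (\<lambda>v. complex_of_real (1 / d) * g v) = win \<tau> f (\<lambda>v. 0 + complex_of_real (1 / d) * g v)" by simp
    also have "\<dots> = win \<tau> f (\<lambda>_. 0) + complex_of_real (1 / d) * win \<tau> f g"
      by (subst win_add_scaled_right[OF WE_zero gWE f]) simp
    also have "\<dots> = \<Lambda> f" using eq \<open>d \<noteq> 0\<close> by (simp add: win_def)
    finally show "\<Lambda> f = win \<tau> f (\<lambda>v. complex_of_real (1 / d) * g v)" by simp
  qed
qed

end

section \<open>The Bergman kernel\<close>

context continuous_weight
begin

text \<open>The second point comes first, so that \<open>kernel \<tau> w\<close> is the element of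
  the space that represents evaluation at w.\<close>

definition kernel :: "real \<Rightarrow> complex \<Rightarrow> complex \<Rightarrow> complex" where
  "kernel \<tau> w = (\<lambda>z. bergman_kernel p \<tau> z w)"

text \<open>Evaluation at w is bounded by the supremum over {w}, so a representer exists; its
  uniqueness is what gives the definite description in \<open>bergman_kernel\<close> a
  value.\<close>

lemma
  assumes \<tau>: "\<tau> > 0"
  shows kernel_WE: "kernel \<tau> w \<in> WE \<tau>"
    and kernel_reproducing: "f \<in> WE \<tau> \<Longrightarrow> win \<tau> f (kernel \<tau> w) = f w"
proof -
  obtain k where k: "k \<in> WE \<tau>" "\<And>f. f \<in> WE \<tau> \<Longrightarrow> f w = win \<tau> f k"
  proof (rule WE_Riesz[OF \<tau>, of "\<lambda>f. f w" "{w}" 1])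
    show "f w + c * g w = f w + c * g w" for f g :: "complex \<Rightarrow> complex" and c ..
  qed auto
  have "\<exists>!k. k \<in> WE \<tau> \<and> (\<forall>f\<in>WE \<tau>. f w = win \<tau> f k)"
  proof (rule ex1I[of _ k])
    show "k \<in> WE \<tau> \<and> (\<forall>f\<in>WE \<tau>. f w = win \<tau> f k)" using k by auto
    fix k' assume k': "k' \<in> WE \<tau> \<and> (\<forall>f\<in>WE \<tau>. f w = win \<tau> f k')"
    define d where "d = (\<lambda>v. k' v + (-1) * k v)"
    have d: "d \<in> WE \<tau>" unfolding d_def using k k' by (intro WE_add_scaled) auto
    \<comment> \<open>The difference of two representers is orthogonal to every element of the
      space, in particular to itself.\<close>
    have "win \<tau> d d = win \<tau> d k' + cnj (-1) * win \<tau> d k"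
      unfolding d_def using k k' d by (subst win_add_scaled_right) (auto simp: d_def)
    also have "\<dots> = 0" using k k' d by (metis add.right_inverse complex_cnj_minus complex_cnj_one mult_minus1)
    finally have "wnorm2 \<tau> d = 0" by (simp add: win_self)
    then have "d v = 0" for v using WE_eq_0[OF \<tau> d] by blast
    then show "k' = k" by (auto simp: d_def fun_eq_iff)
  qed
  then have "(THE k. k \<in> WE \<tau> \<and> (\<forall>f\<in>WE \<tau>. f w = win \<tau> f k)) \<in> WE \<tau> \<and>
      (\<forall>f\<in>WE \<tau>. f w = win \<tau> f (THE k. k \<in> WE \<tau> \<and> (\<forall>f\<in>WE \<tau>. f w = win \<tau> f k)))"
    by (rule theI')
  moreover have "kernel \<tau> w = (THE k. k \<in> WE \<tau> \<and> (\<forall>f\<in>WE \<tau>. f w = win \<tau> f k))"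
    unfolding kernel_def bergman_kernel_def win_def ..
  ultimately show "kernel \<tau> w \<in> WE \<tau>" and "f \<in> WE \<tau> \<Longrightarrow> win \<tau> f (kernel \<tau> w) = f w" by auto
qed

lemma kernel_hermitian: "\<tau> > 0 \<Longrightarrow> kernel \<tau> w z = cnj (kernel \<tau> z w)"
  by (metis kernel_WE kernel_reproducing win_commute)

lemma kernel_diagonal: "\<tau> > 0 \<Longrightarrow> kernel \<tau> w w = complex_of_real (wnorm2 \<tau> (kernel \<tau> w))"
  by (metis kernel_WE kernel_reproducing win_self)

text \<open>The pointwise bound is used twice on \<open>kernel \<tau> w\<close>: at w, where its
  value is its squared norm, it bounds that norm; then at z it bounds the value.\<close>

lemma kernel_bound:
  assumes "compact K" "\<delta> > 0"
  obtains C where "C > 0" "\<And>\<tau> z w. \<tau> > 0 \<Longrightarrow> z \<in> K \<Longrightarrow> w \<in> K \<Longrightarrow> cmod (kernel \<tau> w z) \<le> C * exp (\<tau> * (p z + p w + 2 * \<delta>))"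
proof -
  obtain C where C: "C > 0" "\<And>\<tau> f z. \<tau> > 0 \<Longrightarrow> f \<in> WE \<tau> \<Longrightarrow> z \<in> K \<Longrightarrow> (cmod (f z))\<^sup>2 \<le> C * exp (2 * \<tau> * (p z + \<delta>)) * wnorm2 \<tau> f"
    by (rule WE_pointwise_bound[OF assms]) blast
  have "cmod (kernel \<tau> w z) \<le> C * exp (\<tau> * (p z + p w + 2 * \<delta>))" if \<tau>: "\<tau> > 0" and zw: "z \<in> K" "w \<in> K" for \<tau> z w
  proof -
    define N where "N = wnorm2 \<tau> (kernel \<tau> w)"
    define E where "E z = exp (2 * \<tau> * (p z + \<delta>))" for z
    have "(cmod (kernel \<tau> w w))\<^sup>2 \<le> C * E w * N" unfolding E_def N_def by (intro C \<tau> zw kernel_WE)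
    then have "N * N \<le> C * E w * N" unfolding kernel_diagonal[OF \<tau>] N_def[symmetric] by (simp add: power2_eq_square)
    moreover have "N \<ge> 0" unfolding N_def by (rule wnorm2_nonneg)
    ultimately have N: "N \<le> C * E w" using C(1)
      by (cases "N = 0") (auto simp: E_def)
    have "(cmod (kernel \<tau> w z))\<^sup>2 \<le> C * E z * N" unfolding E_def N_def by (intro C \<tau> zw kernel_WE)
    also have "\<dots> \<le> C * E z * (C * E w)" using N C(1) by (intro mult_left_mono) (auto simp: E_def)
    also have "\<dots> = (C * exp (\<tau> * (p z + p w + 2 * \<delta>)))\<^sup>2"
    proof -
      have "E z * E w = exp (\<tau> * (p z + p w + 2 * \<delta>)) * exp (\<tau> * (p z + p w + 2 * \<delta>))"
        unfolding E_def exp_add[symmetric] by (simp add: algebra_simps)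
      then show ?thesis unfolding power2_eq_square by (simp add: mult_ac)
    qed
    finally show ?thesis by (rule power2_le_imp_le) (use C(1) in simp)
  qed
  then show ?thesis using that C(1) by blast
qed

lemma WE_mono:
  assumes "0 < \<tau>" "\<tau> \<le> \<sigma>" "f \<in> WE \<tau>"
  shows "f \<in> WE \<sigma>" "wnorm2 \<sigma> f \<le> wnorm2 \<tau> f"
proof -
  have "(\<integral>\<^sup>+v. ennreal ((cmod (f v))\<^sup>2 * exp (- 2 * \<sigma> * p v)) \<partial>lborel) \<le> (\<integral>\<^sup>+v. ennreal ((cmod (f v))\<^sup>2 * exp (- 2 * \<tau> * p v)) \<partial>lborel)"
    using assms p_nonneg by (intro nn_integral_mono ennreal_leI mult_left_mono) (auto intro!: mult_right_mono)
  also have "\<dots> = ennreal (wnorm2 \<tau> f)" by (rule nn_integral_wnorm2[OF assms(3)])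
  finally show "f \<in> WE \<sigma>" "wnorm2 \<sigma> f \<le> wnorm2 \<tau> f"
    using WE_I[OF WE_holomorphic[OF assms(3)] _ wnorm2_nonneg] by auto
qed

text \<open>Since \<open>p \<ge> 0\<close>, the weights decrease in \<open>\<tau>\<close>, so the kernels increase as Hermitian
  forms; this is what makes them measurable in \<open>\<tau>\<close>.\<close>

lemma kernel_form_mono:
  assumes "0 < \<tau>" "\<tau> \<le> \<sigma>"
  shows "wnorm2 \<tau> (\<lambda>v. kernel \<tau> z v + c * kernel \<tau> w v) \<le> wnorm2 \<sigma> (\<lambda>v. kernel \<sigma> z v + c * kernel \<sigma> w v)"
proof -
  have \<sigma>: "\<sigma> > 0" using assms by simp
  define k where "k \<tau> = (\<lambda>v. kernel \<tau> z v + c * kernel \<tau> w v)" for \<tau>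
  have kWE: "k \<tau> \<in> WE \<tau>" if "\<tau> > 0" for \<tau>
    unfolding k_def using that by (intro WE_add_scaled kernel_WE)
  have rep: "win \<tau> f (k \<tau>) = f z + cnj c * f w" if "\<tau> > 0" "f \<in> WE \<tau>" for \<tau> f
    unfolding k_def using that by (simp add: win_add_scaled_right kernel_WE kernel_reproducing)
  define N where "N \<tau> = wnorm2 \<tau> (k \<tau>)" for \<tau>
  have nn: "N \<tau> \<ge> 0" for \<tau> unfolding N_def by (rule wnorm2_nonneg)
  have k\<sigma>: "k \<tau> \<in> WE \<sigma>" "wnorm2 \<sigma> (k \<tau>) \<le> N \<tau>" unfolding N_def using WE_mono[OF assms kWE[OF assms(1)]] by auto
  \<comment> \<open>Both sides evaluate the same functional, the value at z plus
    \<open>cnj c\<close> times the value at w, on \<open>k \<tau>\<close>. Cauchy-Schwarz in the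
    space of \<sigma> then compares the norms.\<close>
  have "win \<sigma> (k \<tau>) (k \<sigma>) = win \<tau> (k \<tau>) (k \<tau>)"
    using rep[OF \<sigma> k\<sigma>(1)] rep[OF assms(1) kWE[OF assms(1)]] by simp
  then have "(N \<tau>)\<^sup>2 = (cmod (win \<sigma> (k \<tau>) (k \<sigma>)))\<^sup>2" by (simp add: win_self N_def)
  also have "\<dots> \<le> wnorm2 \<sigma> (k \<tau>) * N \<sigma>" unfolding N_def by (intro WE_integrable_mult k\<sigma> kWE \<sigma>)
  also have "\<dots> \<le> N \<tau> * N \<sigma>" by (intro mult_right_mono k\<sigma> nn)
  finally have "N \<tau> * N \<tau> \<le> N \<tau> * N \<sigma>" by (simp add: power2_eq_square)
  then have "N \<tau> \<le> N \<sigma>" using nn[of \<tau>] nn[of \<sigma>] by (cases "N \<tau> = 0") auto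
  then show ?thesis by (simp add: N_def k_def)
qed

text \<open>Extension by 0 to \<tau> \<le> 0, so that measurability and integrals over the positive
  axis can be stated on the whole line.\<close>

definition kernel0 :: "real \<Rightarrow> complex \<Rightarrow> complex \<Rightarrow> complex" where
  "kernel0 \<tau> w z = (if \<tau> > 0 then kernel \<tau> w z else 0)"

text \<open>Polarisation: real and imaginary part of the kernel are combinations of squared norms
  \<open>N c z w\<close> with c = 0, 1, \<i>, each of which is monotone in \<tau> and hence
  Borel.\<close>

lemma kernel0_measurable_parameter: "(\<lambda>\<tau>. kernel0 \<tau> w z) \<in> borel_measurable borel"
proof -
  define N where "N c z w \<tau> = (if \<tau> > 0 then wnorm2 \<tau> (\<lambda>v. kernel \<tau> z v + c * kernel \<tau> w v) else 0)" for c z w \<tau>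
  have "mono (N c z w)" for c z w
    unfolding N_def by (rule monoI) (use kernel_form_mono wnorm2_nonneg in auto)
  then have [measurable]: "N c z w \<in> borel_measurable borel" for c z w by (rule borel_measurable_mono)
  have N: "N c z w \<tau> = wnorm2 \<tau> (kernel \<tau> z) + 2 * Re (c * kernel \<tau> w z) + (cmod c)\<^sup>2 * wnorm2 \<tau> (kernel \<tau> w)"
    if "\<tau> > 0" for c z w \<tau>
    unfolding N_def using that by (simp add: wnorm2_add_scaled kernel_WE kernel_reproducing)
  have C: "kernel0 \<tau> w z = Complex ((N 1 z w \<tau> - N 0 z w \<tau> - N 0 w z \<tau>) / 2) (- (N \<i> z w \<tau> - N 0 z w \<tau> - N 0 w z \<tau>) / 2)" for \<tau>
  proof (cases "\<tau> > 0")
    case True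
    then show ?thesis by (simp add: kernel0_def N complex_eq_iff)
  qed (simp add: kernel0_def N_def complex_eq_iff)
  have eq: "(\<lambda>\<tau>. kernel0 \<tau> w z) = (\<lambda>\<tau>. complex_of_real ((N 1 z w \<tau> - N 0 z w \<tau> - N 0 w z \<tau>) / 2)
      + \<i> * complex_of_real (- (N \<i> z w \<tau> - N 0 z w \<tau> - N 0 w z \<tau>) / 2))"
    by (rule ext) (simp only: C Complex_eq)
  show ?thesis unfolding eq by measurable
qed

text \<open>The Caratheodory argument is applied in z, where the kernel is holomorphic, and then in
  w, where it is continuous by Hermitian symmetry.\<close>

lemma kernel0_measurable [measurable (raw)]:
  assumes "t \<in> borel_measurable M" "w \<in> borel_measurable M" "z \<in> borel_measurable M"
  shows "(\<lambda>x. kernel0 (t x) (w x) (z x)) \<in> borel_measurable M"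
proof -
  have c1: "continuous_on UNIV (\<lambda>z. kernel0 \<tau> w z)" for \<tau> w
    using WE_continuous[OF kernel_WE, of \<tau> w] by (cases "\<tau> > 0") (auto simp: kernel0_def)
  have "kernel0 \<tau> w z = cnj (kernel0 \<tau> z w)" for \<tau> w z
    using kernel_hermitian[of \<tau> w z] by (simp add: kernel0_def)
  then have c2: "continuous_on UNIV (\<lambda>w. kernel0 \<tau> w z)" for \<tau> z
    using continuous_on_cnj[OF c1] by (metis (no_types, lifting) continuous_on_cong)
  have 1: "(\<lambda>q. kernel0 (fst q) w (snd q)) \<in> borel_measurable (borel \<Otimes>\<^sub>M borel)" for w
    by (rule measurable_Caratheodory) (auto simp: kernel0_measurable_parameter c1)
  have 2: "(\<lambda>q. kernel0 (fst (fst q)) (snd q) (snd (fst q))) \<in> borel_measurable ((borel \<Otimes>\<^sub>M borel) \<Otimes>\<^sub>M borel)"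
    by (rule measurable_Caratheodory) (auto simp: 1 c2)
  have "(\<lambda>x. ((t x, z x), w x)) \<in> measurable M ((borel \<Otimes>\<^sub>M borel) \<Otimes>\<^sub>M borel)"
    using assms by measurable
  from measurable_compose[OF this 2] show ?thesis by simp
qed

text \<open>The Bergman projection of exp (\<tau> p) \<psi>: the growth of this function and the
  weight exp (- 2 \<tau> p) leave exp (- \<tau> p) under the integral.\<close>

definition proj :: "real \<Rightarrow> (complex \<Rightarrow> complex) \<Rightarrow> complex \<Rightarrow> complex" where
  "proj \<tau> \<psi> z = (LINT w|lborel. kernel \<tau> w z * \<psi> w * complex_of_real (exp (- \<tau> * p w)))"

text \<open>The integral against the kernel is recognised as the Riesz representer of the functional
  \<open>\<Lambda>\<close>. That makes it entire without differentiating under the integral and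
  gives the reproducing identity by construction; testing it on itself with Cauchy-Schwarz yields
  contractivity.\<close>

lemma
  assumes \<tau>: "\<tau> > 0" and \<psi>: "\<psi> \<in> borel_measurable borel" "\<And>v. cmod (\<psi> v) \<le> B" "\<And>v. v \<notin> K \<Longrightarrow> \<psi> v = 0" and K: "compact K"
  shows proj_WE: "proj \<tau> \<psi> \<in> WE \<tau>"
    and proj_reproducing: "h \<in> WE \<tau> \<Longrightarrow> win \<tau> h (proj \<tau> \<psi>) = (LINT w|lborel. h w * cnj (\<psi> w) * complex_of_real (exp (- \<tau> * p w)))"
    and proj_wnorm2: "wnorm2 \<tau> (proj \<tau> \<psi>) \<le> (LINT w|lborel. (cmod (\<psi> w))\<^sup>2)"
proof -
  note [measurable] = \<psi>(1)
  have B: "B \<ge> 0" using \<psi>(2)[of 0] norm_ge_zero[of "\<psi> 0"] by linarith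
  have indK: "integrable lborel (\<lambda>v. indicator K v * c)" for c :: real
    using emeasure_compact_finite[OF K] borel_compact[OF K] by (intro integrable_mult_left integrable_real_indicator) auto
  define \<Lambda> where "\<Lambda> h = (LINT w|lborel. h w * cnj (\<psi> w) * complex_of_real (exp (- \<tau> * p w)))" for h
  have le: "cmod (h w * cnj (\<psi> w) * complex_of_real (exp (- \<tau> * p w))) \<le> indicator K w * (M * B)"
    if "0 \<le> M" "\<And>z. z \<in> K \<Longrightarrow> cmod (h z) \<le> M" for h M w
  proof (cases "w \<in> K")
    case True
    have "cmod (h w) * cmod (\<psi> w) * exp (- \<tau> * p w) \<le> M * B * 1"
      using True that \<tau> p_nonneg[of w] \<psi>(2) B by (intro mult_mono) auto
    then show ?thesis using True by (simp add: norm_mult)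
  qed (simp add: \<psi>(3))
  have bounded: "\<exists>M\<ge>0. \<forall>z\<in>K. cmod (h z) \<le> M" if "h \<in> WE \<tau>" for h
  proof -
    have "bounded (h ` K)"
      using WE_continuous[OF that] K by (intro compact_imp_bounded compact_continuous_image continuous_on_subset[OF WE_continuous[OF that]]) auto
    then show ?thesis unfolding bounded_pos by (auto intro: less_imp_le)
  qed
  have int: "integrable lborel (\<lambda>w. h w * cnj (\<psi> w) * complex_of_real (exp (- \<tau> * p w)))" if h: "h \<in> WE \<tau>" for h
  proof -
    obtain M where M: "M \<ge> 0" "\<And>z. z \<in> K \<Longrightarrow> cmod (h z) \<le> M" using bounded[OF h] by blast
    note [measurable] = WE_measurable[OF h]
    show ?thesis
      by (rule Bochner_Integration.integrable_bound[OF indK[of "M * B"]])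
         (measurable, use le[of M h, OF M] in \<open>auto intro!: AE_I2 intro: order_trans[OF _ abs_ge_self]\<close>)
  qed
  obtain k where k: "k \<in> WE \<tau>" "\<And>f. f \<in> WE \<tau> \<Longrightarrow> \<Lambda> f = win \<tau> f k"
  proof (rule WE_Riesz[OF \<tau> _ K, of \<Lambda> "LINT w|lborel. indicator K w * B"])
    fix f g c assume f: "f \<in> WE \<tau>" and g: "g \<in> WE \<tau>"
    have "\<Lambda> (\<lambda>v. f v + c * g v) = (LINT w|lborel. f w * cnj (\<psi> w) * complex_of_real (exp (- \<tau> * p w)) + c * (g w * cnj (\<psi> w) * complex_of_real (exp (- \<tau> * p w))))"
      unfolding \<Lambda>_def by (intro Bochner_Integration.integral_cong) (auto simp: algebra_simps)
    also have "\<dots> = \<Lambda> f + c * \<Lambda> g"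
      unfolding \<Lambda>_def by (subst Bochner_Integration.integral_add[OF int[OF f] integrable_mult_right[OF int[OF g]]]) simp
    finally show "\<Lambda> (\<lambda>v. f v + c * g v) = \<Lambda> f + c * \<Lambda> g" .
  next
    fix f M assume f: "f \<in> WE \<tau>" "0 \<le> M" "\<And>z. z \<in> K \<Longrightarrow> cmod (f z) \<le> M"
    have "cmod (\<Lambda> f) \<le> (LINT w|lborel. indicator K w * (M * B))"
      unfolding \<Lambda>_def using int[OF f(1)] indK le[of M f, OF f(2,3)] by (rule Bochner_Integration.integral_norm_bound_integral)
    also have "\<dots> = (LINT w|lborel. indicator K w * B) * M" by simp
    finally show "cmod (\<Lambda> f) \<le> (LINT w|lborel. indicator K w * B) * M" .
  qed blast
  have "proj \<tau> \<psi> z = k z" for z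
  proof -
    \<comment> \<open>Evaluation at z is the pairing with \<open>kernel \<tau> z\<close>, and
      exchanging the arguments of \<open>win\<close> brings in \<Lambda>.\<close>
    have "k z = cnj (\<Lambda> (kernel \<tau> z))"
      using k(2)[OF kernel_WE[OF \<tau>]] kernel_reproducing[OF \<tau> k(1)] win_commute by metis
    also have "\<dots> = (LINT w|lborel. cnj (kernel \<tau> z w) * \<psi> w * complex_of_real (exp (- \<tau> * p w)))"
      unfolding \<Lambda>_def by (subst Bochner_Integration.integral_cnj[symmetric]) simp
    also have "\<dots> = proj \<tau> \<psi> z" unfolding proj_def kernel_hermitian[OF \<tau>, symmetric] ..
    finally show ?thesis ..
  qed
  then have pk: "proj \<tau> \<psi> = k" by auto
  show "proj \<tau> \<psi> \<in> WE \<tau>" "h \<in> WE \<tau> \<Longrightarrow> win \<tau> h (proj \<tau> \<psi>) = (LINT w|lborel. h w * cnj (\<psi> w) * complex_of_real (exp (- \<tau> * p w)))"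
    unfolding pk using k by (auto simp: \<Lambda>_def)
  define N where "N = wnorm2 \<tau> k"
  have N0: "N \<ge> 0" unfolding N_def by (rule wnorm2_nonneg)
  have \<psi>2: "integrable lborel (\<lambda>w. (cmod (cnj (\<psi> w)))\<^sup>2)"
  proof (rule Bochner_Integration.integrable_bound[OF indK[of "B\<^sup>2"]])
    show "AE w in lborel. norm ((cmod (cnj (\<psi> w)))\<^sup>2) \<le> norm (indicator K w * B\<^sup>2)"
      using \<psi>(2,3) by (intro AE_I2) (auto split: split_indicator intro!: power_mono)
  qed measurable
  have "complex_of_real N = (LINT w|lborel. k w * complex_of_real (exp (- \<tau> * p w)) * cnj (\<psi> w))"
    using k(2)[OF k(1)] unfolding win_self N_def \<Lambda>_def by (simp add: mult_ac)
  then have "N\<^sup>2 = (cmod (LINT w|lborel. k w * complex_of_real (exp (- \<tau> * p w)) * cnj (\<psi> w)))\<^sup>2"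
    using N0 by (metis abs_of_nonneg norm_of_real)
  also have "\<dots> \<le> (LINT w|lborel. (cmod (k w * complex_of_real (exp (- \<tau> * p w))))\<^sup>2) * (LINT w|lborel. (cmod (cnj (\<psi> w)))\<^sup>2)"
    by (rule Cauchy_Schwarz_integral[OF WE_L2[OF k(1)] _ \<psi>2]) measurable
  also have "(LINT w|lborel. (cmod (k w * complex_of_real (exp (- \<tau> * p w))))\<^sup>2) = N"
    unfolding N_def wnorm2_def exp_weight by (simp add: norm_mult power_mult_distrib power2_eq_square mult_ac)
  finally have "N * N \<le> N * (LINT w|lborel. (cmod (\<psi> w))\<^sup>2)" by (simp add: power2_eq_square)
  then show "wnorm2 \<tau> (proj \<tau> \<psi>) \<le> (LINT w|lborel. (cmod (\<psi> w))\<^sup>2)"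
    unfolding pk N_def[symmetric] using N0 by (cases "N = 0") auto
qed

end

section \<open>The holomorphic extension of the projection of a test function\<close>

lemma measurable_fst_borel [measurable]: "fst \<in> borel_measurable (borel :: ('a::second_countable_topology \<times> 'b::second_countable_topology) measure)"
  by (simp flip: borel_prod)

lemma measurable_snd_borel [measurable]: "snd \<in> borel_measurable (borel :: ('a::second_countable_topology \<times> 'b::second_countable_topology) measure)"
  by (simp flip: borel_prod)

lemma nn_integral_lborel_pair:
  fixes f :: "'a::euclidean_space \<times> 'b::euclidean_space \<Rightarrow> ennreal"
  assumes "f \<in> borel_measurable borel"
  shows "(\<integral>\<^sup>+q. f q \<partial>lborel) = (\<integral>\<^sup>+x. \<integral>\<^sup>+y. f (x, y) \<partial>lborel \<partial>lborel)"
  using lborel.nn_integral_fst[of f lborel] assms by (simp add: lborel_prod borel_prod)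

lemma isCont_integral_dominated:
  fixes f :: "'b::metric_space \<Rightarrow> 'a \<Rightarrow> complex"
  assumes r: "r > 0" and meas: "\<And>y. y \<in> ball x r \<Longrightarrow> f y \<in> borel_measurable M"
    and g: "integrable M g" and dom: "\<And>y a. y \<in> ball x r \<Longrightarrow> a \<in> space M \<Longrightarrow> cmod (f y a) \<le> g a"
    and cont: "\<And>a. a \<in> space M \<Longrightarrow> isCont (\<lambda>y. f y a) x"
  shows "isCont (\<lambda>y. LINT a|M. f y a) x"
proof -
  have "((\<lambda>y. LINT a|M. f y a) \<longlongrightarrow> (LINT a|M. f x a)) (at x within ball x r)"
    unfolding tendsto_at_iff_sequentially
  proof (intro allI impI)
    fix X :: "nat \<Rightarrow> 'b" assume X: "\<forall>i. X i \<in> ball x r - {x}" "X \<longlonglongrightarrow> x"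
    show "((\<lambda>y. LINT a|M. f y a) \<circ> X) \<longlonglongrightarrow> (LINT a|M. f x a)"
      unfolding comp_def
    proof (rule integral_dominated_convergence[OF _ _ g])
      show "AE a in M. (\<lambda>i. f (X i) a) \<longlonglongrightarrow> f x a"
        using isCont_tendsto_compose[OF cont X(2)] by auto
      show "f x \<in> borel_measurable M" using r by (intro meas) simp
      show "f (X i) \<in> borel_measurable M" for i using X(1) by (intro meas) blast
      show "AE a in M. norm (f (X i) a) \<le> g a" for i using X(1) by (intro AE_I2 dom) blast+
    qed
  qed
  then show ?thesis
    using r by (simp add: isCont_def at_within_open[of x "ball x r"])
qed

lemma integrable_exp_decay:
  assumes "\<delta> > 0"
  shows "integrable lborel (\<lambda>\<tau>::real. indicator {0<..} \<tau> * exp (- \<delta> * \<tau>))"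
proof -
  have "set_integrable lborel {0<..} (\<lambda>\<tau>::real. exp (- (\<tau> * \<delta>)))"
    using integrable_I0i_exp_mscale[OF assms] .
  then show ?thesis by (simp add: set_integrable_def mult.commute)
qed

text \<open>Half of the decay absorbs the factor \<tau> that differentiation in the second variable
  produces.\<close>

lemma mult_exp_decay_le:
  fixes \<delta> \<tau> :: real
  assumes "\<delta> > 0" "\<tau> \<ge> 0"
  shows "\<tau> * exp (- \<delta> * \<tau>) \<le> 2 / \<delta> * exp (- (\<delta> / 2) * \<tau>)"
proof -
  have "\<delta> / 2 * \<tau> \<le> exp (\<delta> / 2 * \<tau>)" using exp_ge_add_one_self[of "\<delta> / 2 * \<tau>"] by linarith
  then have "\<delta> / 2 * \<tau> * exp (- \<delta> * \<tau>) \<le> exp (\<delta> / 2 * \<tau>) * exp (- \<delta> * \<tau>)" by (rule mult_right_mono) simp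
  also have "\<dots> = exp (- (\<delta> / 2) * \<tau>)" by (simp flip: exp_add)
  finally show ?thesis using assms by (simp add: field_simps)
qed

section \<open>Test functions and their partial Fourier transforms\<close>

lemma test_function_bounds:
  assumes "test_function f"
  obtains B R where "B > 0" "R > 0" "\<And>q. cmod (f q) \<le> B" "\<And>w s. f (w, s) \<noteq> 0 \<Longrightarrow> cmod w \<le> R \<and> \<bar>s\<bar> \<le> R"
proof -
  have c: "continuous_on UNIV f" and k: "compact (supp f)" using assms by (auto simp: test_function_def)
  have "bounded (f ` supp f)" by (intro compact_imp_bounded compact_continuous_image continuous_on_subset[OF c] k) simp
  then obtain B where B: "B > 0" "\<And>q. q \<in> supp f \<Longrightarrow> cmod (f q) \<le> B" unfolding bounded_pos by auto
  obtain R where R: "R > 0" "\<And>q. q \<in> supp f \<Longrightarrow> norm q \<le> R" using compact_imp_bounded[OF k] unfolding bounded_pos by auto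
  show ?thesis
  proof
    show "cmod (f q) \<le> B" for q using B eq_0_if_notin_supp[of q f] by (cases "q \<in> supp f") auto
    fix w s assume "f (w, s) \<noteq> 0"
    then have "norm (w, s) \<le> R" using R(2) eq_0_if_notin_supp by blast
    then show "cmod w \<le> R \<and> \<bar>s\<bar> \<le> R"
      using norm_fst_le[of w s] norm_snd_le[of s w] by (auto simp: real_norm_def)
  qed (fact B(1) R(1))+
qed

lemma test_function_measurable: "test_function f \<Longrightarrow> f \<in> borel_measurable borel"
  by (auto simp: test_function_def intro: borel_measurable_continuous_onI)

definition tfourier :: "(complex \<times> real \<Rightarrow> complex) \<Rightarrow> real \<Rightarrow> complex \<Rightarrow> complex" where
  "tfourier f \<tau> w = fourier (\<lambda>s. f (w, s)) \<tau>"

lemma tfourier_measurable [measurable (raw)]: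
  assumes f: "f \<in> borel_measurable borel" and "t \<in> borel_measurable M" "w \<in> borel_measurable M"
  shows "(\<lambda>x. tfourier f (t x) (w x)) \<in> borel_measurable M"
proof -
  have [measurable]: "f \<in> borel_measurable (borel \<Otimes>\<^sub>M borel)" using f by (simp add: borel_prod)
  note [measurable] = assms(2,3)
  show ?thesis unfolding tfourier_def fourier_def by measurable
qed

lemma test_function_slice:
  assumes "test_function f"
  shows "integrable lborel (\<lambda>s. f (w, s))"
proof -
  obtain B R where BR: "B > 0" "R > 0" "\<And>q. cmod (f q) \<le> B" "\<And>w s. f (w, s) \<noteq> 0 \<Longrightarrow> cmod w \<le> R \<and> \<bar>s\<bar> \<le> R"
    by (rule test_function_bounds[OF assms]) blast
  have [measurable]: "f \<in> borel_measurable (borel \<Otimes>\<^sub>M borel)" using test_function_measurable[OF assms] by (simp add: borel_prod)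
  show ?thesis
  proof (rule Bochner_Integration.integrable_bound[of lborel "\<lambda>s. indicator {-R..R} s * B"])
    show "AE s in lborel. norm (f (w, s)) \<le> norm (indicator {-R..R} s * B)"
      using BR by (intro AE_I2) (fastforce split: split_indicator)
    show "integrable lborel (\<lambda>s. indicator {-R..R} s * B)"
      by (intro integrable_mult_left integrable_real_indicator) (auto simp: emeasure_lborel_Icc_eq)
  qed measurable
qed

lemma tfourier_bounds:
  assumes "test_function f"
  obtains B R where "B > 0" "\<And>\<tau> w. cmod (tfourier f \<tau> w) \<le> B" "\<And>\<tau> w. w \<notin> cball 0 R \<Longrightarrow> tfourier f \<tau> w = 0"
    "\<And>w s. w \<notin> cball 0 R \<Longrightarrow> f (w, s) = 0"
proof -
  obtain B R where BR: "B > 0" "R > 0" "\<And>q. cmod (f q) \<le> B" "\<And>w s. f (w, s) \<noteq> 0 \<Longrightarrow> cmod w \<le> R \<and> \<bar>s\<bar> \<le> R"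
    by (rule test_function_bounds[OF assms]) blast
  have z: "f (w, s) = 0" if "w \<notin> cball 0 R" for w s using BR(4)[of w s] that by auto
  show ?thesis
  proof
    show "0 < 2 * R * B" using BR by simp
    fix \<tau> w
    have "cmod (tfourier f \<tau> w) \<le> (LINT s|lborel. cmod (f (w, s)))"
      unfolding tfourier_def by (rule fourier_norm_le)
    also have "\<dots> \<le> (LINT s|lborel. indicator {-R..R} s * B)"
    proof (rule integral_mono)
      show "integrable lborel (\<lambda>s. cmod (f (w, s)))" by (intro integrable_norm test_function_slice assms)
      show "cmod (f (w, s)) \<le> indicator {-R..R} s * B" for s
        using BR by (fastforce split: split_indicator)
      show "integrable lborel (\<lambda>s. indicator {-R..R} s * B)"
        by (intro integrable_mult_left integrable_real_indicator) (auto simp: emeasure_lborel_Icc_eq)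
    qed
    also have "\<dots> = 2 * R * B" using BR by simp
    finally show "cmod (tfourier f \<tau> w) \<le> 2 * R * B" .
    show "tfourier f \<tau> w = 0" if "w \<notin> cball 0 R" using z[OF that] by (simp add: tfourier_def fourier_def)
    show "f (w, s) = 0" if "w \<notin> cball 0 R" for s by (rule z[OF that])
  qed
qed

lemma test_function_L2:
  assumes "test_function f"
  shows "f \<in> L2" and "(\<integral>\<^sup>+q. ennreal ((cmod (f q))\<^sup>2) \<partial>lborel) < \<infinity>"
proof -
  have c: "continuous_on UNIV f" and k: "compact (supp f)" using assms by (auto simp: test_function_def)
  obtain B R where BR: "B > 0" "R > 0" "\<And>q. cmod (f q) \<le> B" "\<And>w s. f (w, s) \<noteq> 0 \<Longrightarrow> cmod w \<le> R \<and> \<bar>s\<bar> \<le> R"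
    by (rule test_function_bounds[OF assms]) blast
  have m [measurable]: "f \<in> borel_measurable borel" by (rule test_function_measurable[OF assms])
  have i: "integrable lborel (\<lambda>q. (cmod (f q))\<^sup>2)"
  proof (rule Bochner_Integration.integrable_bound[of lborel "\<lambda>q. indicator (supp f) q * B\<^sup>2"])
    show "integrable lborel (\<lambda>q. indicator (supp f) q * B\<^sup>2)"
      using emeasure_compact_finite[OF k] borel_compact[OF k] by (intro integrable_mult_left integrable_real_indicator) (auto simp: emeasure_lborel_Icc_eq)
    show "AE q in lborel. norm ((cmod (f q))\<^sup>2) \<le> norm (indicator (supp f) q * B\<^sup>2)"
      using BR(3) eq_0_if_notin_supp[of _ f] by (intro AE_I2) (auto split: split_indicator intro!: power_mono)
  qed measurable
  then show "f \<in> L2" by (simp add: L2_def m)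
  show "(\<integral>\<^sup>+q. ennreal ((cmod (f q))\<^sup>2) \<partial>lborel) < \<infinity>"
    using nn_integral_eq_integral[OF i] by simp
qed

text \<open>The one-dimensional inequality on each slice, followed by Tonelli. It is applied to test
  functions and to regularised Hardy functions alike.\<close>

lemma nn_integral_tfourier_le:
  assumes f: "f \<in> borel_measurable borel" and "\<And>w. integrable lborel (\<lambda>s. f (w, s))"
  shows "(\<integral>\<^sup>+\<tau>. \<integral>\<^sup>+w. ennreal ((cmod (tfourier f \<tau> w))\<^sup>2) \<partial>lborel \<partial>lborel) \<le> ennreal (2 * pi) * (\<integral>\<^sup>+q. ennreal ((cmod (f q))\<^sup>2) \<partial>lborel)"
proof -
  note [measurable] = f
  have [measurable]: "f \<in> borel_measurable (borel \<Otimes>\<^sub>M borel)" using f by (simp add: borel_prod)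
  have "(\<integral>\<^sup>+\<tau>. \<integral>\<^sup>+w. ennreal ((cmod (tfourier f \<tau> w))\<^sup>2) \<partial>lborel \<partial>lborel) = (\<integral>\<^sup>+w. \<integral>\<^sup>+\<tau>. ennreal ((cmod (tfourier f \<tau> w))\<^sup>2) \<partial>lborel \<partial>lborel)"
    by (rule lborel_pair.Fubini') measurable
  also have "\<dots> \<le> (\<integral>\<^sup>+w. ennreal (2 * pi) * (\<integral>\<^sup>+s. ennreal ((cmod (f (w, s)))\<^sup>2) \<partial>lborel) \<partial>lborel)"
    unfolding tfourier_def by (intro nn_integral_mono nn_integral_fourier_le assms)
  also have "\<dots> = ennreal (2 * pi) * (\<integral>\<^sup>+q. ennreal ((cmod (f q))\<^sup>2) \<partial>lborel)"
    by (subst nn_integral_cmult, measurable) (simp add: nn_integral_lborel_pair)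
  finally show ?thesis .
qed

context continuous_weight
begin

lemma Omega_nbhd:
  assumes "p z0 < Im \<zeta>0"
  obtains r \<delta> where "r > 0" "\<delta> > 0" "\<And>z \<zeta>. z \<in> cball z0 r \<Longrightarrow> \<zeta> \<in> cball \<zeta>0 r \<Longrightarrow> p z + 2 * \<delta> \<le> Im \<zeta>"
proof -
  \<comment> \<open>The gap of 4 \<delta> is shared out: p may rise by \<delta>, Im \<zeta> may drop
    by \<delta>, and 2 \<delta> remain. Of these, one \<delta> pays for the growth of the frequency
    components and the other is left as exponential decay.\<close>
  define \<delta> where "\<delta> = (Im \<zeta>0 - p z0) / 4"
  have \<delta>: "\<delta> > 0" using assms by (simp add: \<delta>_def)
  have "isCont p z0" using cont_p by (simp add: continuous_on_eq_continuous_at)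
  then obtain d where d: "d > 0" "\<And>z. dist z z0 < d \<Longrightarrow> dist (p z) (p z0) < \<delta>"
    using \<delta> unfolding continuous_at_eps_delta by metis
  define r where "r = min (d / 2) \<delta>"
  show ?thesis
  proof
    show "r > 0" using d \<delta> by (simp add: r_def)
    show "\<delta> > 0" by (fact \<delta>)
    fix z \<zeta> assume z: "z \<in> cball z0 r" and \<zeta>: "\<zeta> \<in> cball \<zeta>0 r"
    have "dist z z0 < d" using z d(1) by (auto simp: r_def dist_commute)
    then have "p z < p z0 + \<delta>" using d(2)[of z] by (auto simp: dist_real_def)
    moreover have "\<bar>Im (\<zeta>0 - \<zeta>)\<bar> \<le> \<delta>" using abs_Im_le_cmod[of "\<zeta>0 - \<zeta>"] \<zeta> by (auto simp: r_def dist_norm)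
    moreover have "Im \<zeta>0 = p z0 + 4 * \<delta>" by (simp add: \<delta>_def field_simps)
    ultimately show "p z + 2 * \<delta> \<le> Im \<zeta>" by (simp add: abs_le_iff)
  qed
qed

end

locale szego_data = continuous_weight +
  fixes f :: "complex \<times> real \<Rightarrow> complex"
  assumes test: "test_function f"
begin

lemma f_measurable [measurable]: "f \<in> borel_measurable borel"
  by (rule test_function_measurable[OF test])

definition u :: "real \<Rightarrow> complex \<Rightarrow> complex" where
  "u \<tau> z = (LINT w|lborel. kernel0 \<tau> w z * tfourier f \<tau> w * complex_of_real (exp (- \<tau> * p w)))"

lemma u_measurable [measurable (raw)]:
  assumes [measurable]: "t \<in> borel_measurable M" "z \<in> borel_measurable M"
  shows "(\<lambda>x. u (t x) (z x)) \<in> borel_measurable M"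
  unfolding u_def by measurable

lemma u_nonpos: "\<tau> \<le> 0 \<Longrightarrow> u \<tau> z = 0"
  by (simp add: u_def kernel0_def)

lemma u_eq_proj: "\<tau> > 0 \<Longrightarrow> u \<tau> = proj \<tau> (tfourier f \<tau>)"
  by (simp add: u_def kernel0_def proj_def fun_eq_iff)

lemma
  assumes \<tau>: "\<tau> > 0"
  shows u_WE: "u \<tau> \<in> WE \<tau>"
    and u_reproducing: "h \<in> WE \<tau> \<Longrightarrow> win \<tau> h (u \<tau>) = (LINT w|lborel. h w * cnj (tfourier f \<tau> w) * complex_of_real (exp (- \<tau> * p w)))"
    and u_wnorm2: "ennreal (wnorm2 \<tau> (u \<tau>)) \<le> (\<integral>\<^sup>+w. ennreal ((cmod (tfourier f \<tau> w))\<^sup>2) \<partial>lborel)"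
proof -
  obtain B R where B: "B > 0" "\<And>\<tau> w. cmod (tfourier f \<tau> w) \<le> B" "\<And>\<tau> w. w \<notin> cball 0 R \<Longrightarrow> tfourier f \<tau> w = 0"
    by (rule tfourier_bounds[OF test]) blast
  have m: "tfourier f \<tau> \<in> borel_measurable borel" by measurable
  note P = \<tau> m B(2) B(3)[of _ \<tau>] compact_cball[of 0 R]
  show "u \<tau> \<in> WE \<tau>" unfolding u_eq_proj[OF \<tau>] by (rule proj_WE[OF P])
  show "h \<in> WE \<tau> \<Longrightarrow> win \<tau> h (u \<tau>) = (LINT w|lborel. h w * cnj (tfourier f \<tau> w) * complex_of_real (exp (- \<tau> * p w)))"
    unfolding u_eq_proj[OF \<tau>] by (rule proj_reproducing[OF P])
  have "ennreal (wnorm2 \<tau> (u \<tau>)) \<le> ennreal (LINT w|lborel. (cmod (tfourier f \<tau> w))\<^sup>2)"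
    unfolding u_eq_proj[OF \<tau>] by (rule ennreal_leI[OF proj_wnorm2[OF P]])
  also have "\<dots> \<le> (\<integral>\<^sup>+w. ennreal ((cmod (tfourier f \<tau> w))\<^sup>2) \<partial>lborel)"
    using integral_norm_bound_ennreal[of lborel "\<lambda>w. (cmod (tfourier f \<tau> w))\<^sup>2"]
    by (cases "integrable lborel (\<lambda>w. (cmod (tfourier f \<tau> w))\<^sup>2)") (auto simp: not_integrable_integral_eq)
  finally show "ennreal (wnorm2 \<tau> (u \<tau>)) \<le> (\<integral>\<^sup>+w. ennreal ((cmod (tfourier f \<tau> w))\<^sup>2) \<partial>lborel)" .
qed

lemma nn_integral_u_le:
  "(\<integral>\<^sup>+z. ennreal ((cmod (u \<tau> z * complex_of_real (exp (- \<tau> * p z))))\<^sup>2) \<partial>lborel) \<le> indicator {0<..} \<tau> * (\<integral>\<^sup>+w. ennreal ((cmod (tfourier f \<tau> w))\<^sup>2) \<partial>lborel)"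
proof (cases "\<tau> > 0")
  case True
  have eq: "(cmod (u \<tau> z * complex_of_real (exp (- \<tau> * p z))))\<^sup>2 = (cmod (u \<tau> z))\<^sup>2 * exp (- 2 * \<tau> * p z)" for z
    unfolding exp_weight by (simp add: norm_mult power2_eq_square)
  show ?thesis using u_wnorm2[OF True] nn_integral_wnorm2[OF u_WE[OF True]] True unfolding eq by simp
qed (simp add: u_nonpos)

text \<open>The norms of \<open>u \<tau>\<close> are bounded independently of \<tau>, because the
  transforms of f are bounded and live on one ball; the pointwise bound then costs only \<delta> in
  the exponent.\<close>

lemma u_bound:
  assumes "compact K" "\<delta> > 0"
  obtains C where "C > 0" "\<And>\<tau> z. z \<in> K \<Longrightarrow> cmod (u \<tau> z) \<le> indicator {0<..} \<tau> * (C * exp (\<tau> * (p z + \<delta>)))"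
proof -
  obtain C where C: "C > 0" "\<And>\<tau> f z. \<tau> > 0 \<Longrightarrow> f \<in> WE \<tau> \<Longrightarrow> z \<in> K \<Longrightarrow> (cmod (f z))\<^sup>2 \<le> C * exp (2 * \<tau> * (p z + \<delta>)) * wnorm2 \<tau> f"
    by (rule WE_pointwise_bound[OF assms]) blast
  obtain B R where B: "B > 0" "\<And>\<tau> w. cmod (tfourier f \<tau> w) \<le> B" "\<And>\<tau> w. w \<notin> cball 0 R \<Longrightarrow> tfourier f \<tau> w = 0"
    by (rule tfourier_bounds[OF test]) blast
  define M where "M = B\<^sup>2 * measure lborel (cball 0 R :: complex set) + 1"
  have M: "M > 0" unfolding M_def by (intro add_nonneg_pos) auto
  have Mb: "wnorm2 \<tau> (u \<tau>) \<le> M" if "\<tau> > 0" for \<tau>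
  proof -
    have "ennreal (wnorm2 \<tau> (u \<tau>)) \<le> (\<integral>\<^sup>+w. ennreal ((cmod (tfourier f \<tau> w))\<^sup>2) \<partial>lborel)" by (rule u_wnorm2[OF that])
    also have "\<dots> \<le> (\<integral>\<^sup>+w. ennreal (B\<^sup>2) * indicator (cball (0::complex) R) w \<partial>lborel)"
    proof (rule nn_integral_mono)
      show "ennreal ((cmod (tfourier f \<tau> w))\<^sup>2) \<le> ennreal (B\<^sup>2) * indicator (cball 0 R) w" for w
        using B by (cases "w \<in> cball 0 R") (auto intro!: ennreal_leI power_mono)
    qed
    also have "\<dots> = ennreal (B\<^sup>2) * ennreal (measure lborel (cball 0 R :: complex set))"
      using emeasure_compact_finite[OF compact_cball[of "0::complex" R]] by (subst nn_integral_cmult_indicator) (auto simp: emeasure_eq_ennreal_measure)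
    also have "\<dots> \<le> ennreal M" unfolding M_def by (subst ennreal_mult[symmetric]) (auto intro!: ennreal_leI)
    finally show ?thesis using M by simp
  qed
  show ?thesis
  proof
    show "sqrt (C * M) > 0" using C(1) M by simp
    fix \<tau> z assume z: "z \<in> K"
    show "cmod (u \<tau> z) \<le> indicator {0<..} \<tau> * (sqrt (C * M) * exp (\<tau> * (p z + \<delta>)))"
    proof (cases "\<tau> > 0")
      case True
      have "(cmod (u \<tau> z))\<^sup>2 \<le> C * exp (2 * \<tau> * (p z + \<delta>)) * wnorm2 \<tau> (u \<tau>)" by (intro C True u_WE z)
      also have "\<dots> \<le> C * exp (2 * \<tau> * (p z + \<delta>)) * M" using C(1) Mb[OF True] by (intro mult_left_mono) auto
      also have "exp (2 * \<tau> * (p z + \<delta>)) = (exp (\<tau> * (p z + \<delta>)))\<^sup>2" by (simp add: power2_eq_square flip: exp_add)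
      also have "C * (exp (\<tau> * (p z + \<delta>)))\<^sup>2 * M = (sqrt (C * M) * exp (\<tau> * (p z + \<delta>)))\<^sup>2"
        using C(1) M by (simp add: power_mult_distrib)
      finally show ?thesis using True C(1) M by (auto intro: power2_le_imp_le)
    qed (simp add: u_nonpos)
  qed
qed

definition ext :: "complex \<times> complex \<Rightarrow> complex" where
  "ext = (\<lambda>(z, \<zeta>). 1 / (2 * pi) * (LINT \<tau>|lborel. u \<tau> z * exp (\<i> * complex_of_real \<tau> * \<zeta>)))"

lemma integrand_bound:
  assumes "p z0 < Im \<zeta>0"
  obtains r C \<delta> where "r > 0" "C > 0" "\<delta> > 0"
    "\<And>z \<zeta> \<tau>. z \<in> cball z0 r \<Longrightarrow> \<zeta> \<in> cball \<zeta>0 r \<Longrightarrow> cmod (u \<tau> z * exp (\<i> * complex_of_real \<tau> * \<zeta>)) \<le> C * (indicator {0<..} \<tau> * exp (- \<delta> * \<tau>))"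
proof -
  obtain r \<delta> where r: "r > 0" "\<delta> > 0" "\<And>z \<zeta>. z \<in> cball z0 r \<Longrightarrow> \<zeta> \<in> cball \<zeta>0 r \<Longrightarrow> p z + 2 * \<delta> \<le> Im \<zeta>"
    by (rule Omega_nbhd[OF assms]) blast
  obtain C where C: "C > 0" "\<And>\<tau> z. z \<in> cball z0 r \<Longrightarrow> cmod (u \<tau> z) \<le> indicator {0<..} \<tau> * (C * exp (\<tau> * (p z + \<delta>)))"
    by (rule u_bound[OF compact_cball r(2)]) blast
  have "cmod (u \<tau> z * exp (\<i> * complex_of_real \<tau> * \<zeta>)) \<le> C * (indicator {0<..} \<tau> * exp (- \<delta> * \<tau>))"
    if zz: "z \<in> cball z0 r" "\<zeta> \<in> cball \<zeta>0 r" for z \<zeta> \<tau>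
  proof (cases "\<tau> > 0")
    case True
    have "cmod (u \<tau> z * exp (\<i> * complex_of_real \<tau> * \<zeta>)) \<le> C * exp (\<tau> * (p z + \<delta>)) * exp (- \<tau> * Im \<zeta>)"
      using C(2)[OF zz(1), of \<tau>] True by (simp add: norm_mult mult_right_mono)
    also have "\<dots> = C * exp (\<tau> * (p z + \<delta> - Im \<zeta>))" by (simp add: right_diff_distrib distrib_left flip: exp_add)
    also have "\<dots> \<le> C * exp (\<tau> * (- \<delta>))"
    proof -
      have "\<tau> * (p z + \<delta> - Im \<zeta>) \<le> \<tau> * (- \<delta>)" using r(3)[OF zz] True by (intro mult_left_mono) auto
      then show ?thesis using C(1) by simp
    qed
    finally show ?thesis using True by (simp add: mult.commute)
  qed (simp add: u_nonpos)
  then show ?thesis using that r C by blast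
qed

lemma integrand_measurable [measurable]: "(\<lambda>\<tau>. u \<tau> z * exp (\<i> * complex_of_real \<tau> * \<zeta>)) \<in> borel_measurable lborel"
proof -
  have [measurable]: "(\<lambda>\<tau>. exp (\<i> * complex_of_real \<tau> * \<zeta>)) \<in> borel_measurable borel"
    by (intro borel_measurable_continuous_onI continuous_intros)
  show ?thesis by measurable
qed

lemma integrand_holomorphic: "(\<lambda>z. u \<tau> z * exp (\<i> * complex_of_real \<tau> * \<zeta>)) holomorphic_on A"
proof (cases "\<tau> > 0")
  case True
  then show ?thesis using holomorphic_on_subset[OF WE_holomorphic[OF u_WE[OF True]]] by (intro holomorphic_intros) auto
qed (simp add: u_nonpos)

lemma ext_partial_fst:
  assumes "p z0 < Im \<zeta>0"
  shows "\<exists>a. ((\<lambda>z. ext (z, \<zeta>0)) has_field_derivative a) (at z0)"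
proof -
  obtain r C \<delta> where b: "r > 0" "C > 0" "\<delta> > 0"
    "\<And>z \<zeta> \<tau>. z \<in> cball z0 r \<Longrightarrow> \<zeta> \<in> cball \<zeta>0 r \<Longrightarrow> cmod (u \<tau> z * exp (\<i> * complex_of_real \<tau> * \<zeta>)) \<le> C * (indicator {0<..} \<tau> * exp (- \<delta> * \<tau>))"
    by (rule integrand_bound[OF assms]) blast
  have "(\<lambda>z. LINT \<tau>|lborel. u \<tau> z * exp (\<i> * complex_of_real \<tau> * \<zeta>0)) holomorphic_on ball z0 r"
  proof (rule holomorphic_on_integral[OF open_ball integrand_holomorphic integrand_measurable])
    fix z1 assume z1: "z1 \<in> ball z0 r"
    \<comment> \<open>Any radius serves, since the bound is uniform on the whole ball around
      z0.\<close>
    show "\<exists>r'>0. \<exists>g. integrable lborel g \<and> (\<forall>z\<in>ball z1 r' \<inter> ball z0 r. \<forall>\<tau>\<in>space lborel. cmod (u \<tau> z * exp (\<i> * complex_of_real \<tau> * \<zeta>0)) \<le> g \<tau>)"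
      by (rule exI[of _ "1::real"], rule conjI, simp, rule exI[of _ "\<lambda>\<tau>. C * (indicator {0<..} \<tau> * exp (- \<delta> * \<tau>))"])
         (use b in \<open>intro conjI integrable_mult_right integrable_exp_decay ballI b; simp\<close>)
  qed
  then have "(\<lambda>z. ext (z, \<zeta>0)) holomorphic_on ball z0 r" unfolding ext_def by (simp add: holomorphic_intros)
  then show ?thesis using b(1) holomorphic_derivI[of _ "ball z0 r" z0] by auto
qed

text \<open>The derivative in the second variable, taken under the integral; a function of the pair,
  so that its joint continuity can be stated.\<close>

definition ext' :: "complex \<times> complex \<Rightarrow> complex" where
  "ext' q = 1 / (2 * pi) * (LINT \<tau>|lborel. \<i> * complex_of_real \<tau> * (u \<tau> (fst q) * exp (\<i> * complex_of_real \<tau> * snd q)))"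

lemma ext_partial_snd:
  assumes "p z0 < Im \<zeta>0"
  shows "((\<lambda>\<zeta>. ext (z0, \<zeta>)) has_field_derivative ext' (z0, \<zeta>0)) (at \<zeta>0)"
proof -
  obtain r C \<delta> where b: "r > 0" "C > 0" "\<delta> > 0"
    "\<And>z \<zeta> \<tau>. z \<in> cball z0 r \<Longrightarrow> \<zeta> \<in> cball \<zeta>0 r \<Longrightarrow> cmod (u \<tau> z * exp (\<i> * complex_of_real \<tau> * \<zeta>)) \<le> C * (indicator {0<..} \<tau> * exp (- \<delta> * \<tau>))"
    by (rule integrand_bound[OF assms]) blast
  have "((\<lambda>\<zeta>. LINT \<tau>|lborel. u \<tau> z0 * exp (\<i> * complex_of_real \<tau> * \<zeta>)) has_field_derivative
      (LINT \<tau>|lborel. deriv (\<lambda>\<zeta>. u \<tau> z0 * exp (\<i> * complex_of_real \<tau> * \<zeta>)) \<zeta>0)) (at \<zeta>0)"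
  proof (rule holomorphic_integral_has_field_derivative[of "ball \<zeta>0 r", OF open_ball _ integrand_measurable])
    show "(\<lambda>\<zeta>. u \<tau> z0 * exp (\<i> * complex_of_real \<tau> * \<zeta>)) holomorphic_on ball \<zeta>0 r" for \<tau>
      by (intro holomorphic_intros)
    show "\<exists>r'>0. \<exists>g. integrable lborel g \<and> (\<forall>\<zeta>\<in>ball z1 r' \<inter> ball \<zeta>0 r. \<forall>\<tau>\<in>space lborel. cmod (u \<tau> z0 * exp (\<i> * complex_of_real \<tau> * \<zeta>)) \<le> g \<tau>)" for z1
      by (rule exI[of _ "1::real"], rule conjI, simp, rule exI[of _ "\<lambda>\<tau>. C * (indicator {0<..} \<tau> * exp (- \<delta> * \<tau>))"])
         (use b in \<open>intro conjI integrable_mult_right integrable_exp_decay ballI b; simp\<close>)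
  qed (use b in auto)
  moreover have "deriv (\<lambda>\<zeta>. u \<tau> z0 * exp (\<i> * complex_of_real \<tau> * \<zeta>)) \<zeta>0 = \<i> * complex_of_real \<tau> * (u \<tau> z0 * exp (\<i> * complex_of_real \<tau> * \<zeta>0))" for \<tau>
    by (rule DERIV_imp_deriv) (auto intro!: derivative_eq_intros)
  ultimately have "((\<lambda>\<zeta>. LINT \<tau>|lborel. u \<tau> z0 * exp (\<i> * complex_of_real \<tau> * \<zeta>)) has_field_derivative
      (LINT \<tau>|lborel. \<i> * complex_of_real \<tau> * (u \<tau> z0 * exp (\<i> * complex_of_real \<tau> * \<zeta>0)))) (at \<zeta>0)" by simp
  from DERIV_cmult[OF this, of "1 / (2 * complex_of_real pi)"] show ?thesis unfolding ext_def ext'_def by simp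
qed

lemma ext'_isCont:
  assumes "p z0 < Im \<zeta>0"
  shows "isCont ext' (z0, \<zeta>0)"
proof -
  obtain r C \<delta> where b: "r > 0" "C > 0" "\<delta> > 0"
    "\<And>z \<zeta> \<tau>. z \<in> cball z0 r \<Longrightarrow> \<zeta> \<in> cball \<zeta>0 r \<Longrightarrow> cmod (u \<tau> z * exp (\<i> * complex_of_real \<tau> * \<zeta>)) \<le> C * (indicator {0<..} \<tau> * exp (- \<delta> * \<tau>))"
    by (rule integrand_bound[OF assms]) blast
  have "isCont (\<lambda>q. LINT \<tau>|lborel. \<i> * complex_of_real \<tau> * (u \<tau> (fst q) * exp (\<i> * complex_of_real \<tau> * snd q))) (z0, \<zeta>0)"
  proof (rule isCont_integral_dominated[OF b(1)])
    show "integrable lborel (\<lambda>\<tau>. C * (2 / \<delta>) * (indicator {0<..} \<tau> * exp (- (\<delta> / 2) * \<tau>)))"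
      using b by (intro integrable_mult_right integrable_exp_decay) simp
    show "(\<lambda>\<tau>. \<i> * complex_of_real \<tau> * (u \<tau> (fst q) * exp (\<i> * complex_of_real \<tau> * snd q))) \<in> borel_measurable lborel" for q
      by measurable
    fix q \<tau> assume q: "q \<in> ball (z0, \<zeta>0) r"
    have q': "fst q \<in> cball z0 r" "snd q \<in> cball \<zeta>0 r"
      using q dist_fst_le[of "(z0, \<zeta>0)" q] dist_snd_le[of "(z0, \<zeta>0)" q] by auto
    have "cmod (\<i> * complex_of_real \<tau> * (u \<tau> (fst q) * exp (\<i> * complex_of_real \<tau> * snd q))) = \<bar>\<tau>\<bar> * cmod (u \<tau> (fst q) * exp (\<i> * complex_of_real \<tau> * snd q))"
      by (simp add: norm_mult)
    also have "\<dots> \<le> \<bar>\<tau>\<bar> * (C * (indicator {0<..} \<tau> * exp (- \<delta> * \<tau>)))" by (intro mult_left_mono b q') simp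
    also have "\<dots> \<le> C * (2 / \<delta>) * (indicator {0<..} \<tau> * exp (- (\<delta> / 2) * \<tau>))"
    proof (cases "\<tau> > 0")
      case True
      then show ?thesis using mult_left_mono[OF mult_exp_decay_le[OF b(3), of \<tau>], of C] b(2) by (simp add: mult_ac)
    qed simp
    finally show "cmod (\<i> * complex_of_real \<tau> * (u \<tau> (fst q) * exp (\<i> * complex_of_real \<tau> * snd q))) \<le> C * (2 / \<delta>) * (indicator {0<..} \<tau> * exp (- (\<delta> / 2) * \<tau>))" .
  next
    fix \<tau> :: real
    have c: "continuous_on UNIV (u \<tau>)"
      using WE_continuous[OF u_WE, of \<tau>] by (cases "\<tau> > 0") (auto simp: u_nonpos)
    have "continuous_on UNIV (\<lambda>q. \<i> * complex_of_real \<tau> * (u \<tau> (fst q) * exp (\<i> * complex_of_real \<tau> * snd q)))"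
      by (intro continuous_intros continuous_on_compose2[OF c]) auto
    then show "isCont (\<lambda>q. \<i> * complex_of_real \<tau> * (u \<tau> (fst q) * exp (\<i> * complex_of_real \<tau> * snd q))) (z0, \<zeta>0)"
      by (simp add: continuous_on_eq_continuous_at)
  qed
  then show ?thesis unfolding ext'_def[abs_def] by (intro continuous_intros)
qed

text \<open>Joint differentiability from partial derivatives: it suffices that one exists at the
  point and that the other exists nearby and is jointly continuous there. The derivative in \<zeta>
  is an explicit integral, so it takes the second part.\<close>

lemma ext_holomorphic2: "holomorphic2_on ext (Omega p)"
  unfolding holomorphic2_on_def
proof
  fix x assume "x \<in> Omega p"
  then obtain z0 \<zeta>0 where x: "x = (z0, \<zeta>0)" and less: "p z0 < Im \<zeta>0" by (auto simp: Omega_def)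
  obtain r \<delta> where r: "r > 0" "\<delta> > 0" "\<And>z \<zeta>. z \<in> cball z0 r \<Longrightarrow> \<zeta> \<in> cball \<zeta>0 r \<Longrightarrow> p z + 2 * \<delta> \<le> Im \<zeta>"
    by (rule Omega_nbhd[OF less]) blast
  obtain a where a: "((\<lambda>z. ext (z, \<zeta>0)) has_field_derivative a) (at z0)" using ext_partial_fst[OF less] by blast
  have "((\<lambda>(z, \<zeta>). ext (z, \<zeta>)) has_derivative (\<lambda>(tx, ty). a * tx + blinfun_mult_right (ext' (z0, \<zeta>0)) ty)) (at (z0, \<zeta>0) within ball z0 r \<times> ball \<zeta>0 r)"
  proof (rule has_derivative_partialsI[where fy="\<lambda>z \<zeta>. blinfun_mult_right (ext' (z, \<zeta>))"])
    show "((\<lambda>z. ext (z, \<zeta>0)) has_derivative (*) a) (at z0 within ball z0 r)"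
      using a has_derivative_at_withinI has_field_derivative_def by blast
    show "((\<lambda>\<zeta>. ext (z, \<zeta>)) has_derivative blinfun_apply (blinfun_mult_right (ext' (z, \<zeta>)))) (at \<zeta> within ball \<zeta>0 r)"
      if "z \<in> ball z0 r" "\<zeta> \<in> ball \<zeta>0 r" for z \<zeta>
    proof -
      have "p z < Im \<zeta>" using r(2) r(3)[of z \<zeta>] that by auto
      from ext_partial_snd[OF this] show ?thesis
        unfolding has_field_derivative_def by (auto intro: has_derivative_at_withinI simp: blinfun_mult_right.rep_eq)
    qed
    have "isCont (\<lambda>q. blinfun_mult_right (ext' q)) (z0, \<zeta>0)"
      by (rule bounded_linear.isCont[OF bounded_linear_blinfun_mult_right ext'_isCont[OF less]])
    then show "continuous (at (z0, \<zeta>0) within ball z0 r \<times> ball \<zeta>0 r) (\<lambda>(z, \<zeta>). blinfun_mult_right (ext' (z, \<zeta>)))"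
      by (auto intro: continuous_at_imp_continuous_at_within simp: case_prod_beta')
  qed (use r in auto)
  moreover have "at (z0, \<zeta>0) within ball z0 r \<times> ball \<zeta>0 r = at (z0, \<zeta>0)"
    using r(1) by (intro at_within_open open_Times) auto
  ultimately have "(ext has_derivative (\<lambda>(u, v). a * u + ext' (z0, \<zeta>0) * v)) (at (z0, \<zeta>0))"
    by (simp add: blinfun_mult_right.rep_eq case_prod_beta')
  then show "\<exists>a b. (ext has_derivative (\<lambda>(u, v). a * u + b * v)) (at x within Omega p)"
    unfolding x by (blast intro: has_derivative_at_withinI)
qed

end

section \<open>Boundary values\<close>

lemma L2_I:
  assumes [measurable]: "h \<in> borel_measurable borel" and "(\<integral>\<^sup>+q. ennreal ((cmod (h q))\<^sup>2) \<partial>lborel) < \<infinity>"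
  shows "h \<in> L2"
  unfolding L2_def using assms by (auto intro!: integrableI_bounded)

lemma L2_measurable: "h \<in> L2 \<Longrightarrow> h \<in> borel_measurable borel"
  by (simp add: L2_def)

lemma L2_integrable: "h \<in> L2 \<Longrightarrow> integrable lborel (\<lambda>q. (cmod (h q))\<^sup>2)"
  by (simp add: L2_def)

lemma L2_finite: "h \<in> L2 \<Longrightarrow> (\<integral>\<^sup>+q. ennreal ((cmod (h q))\<^sup>2) \<partial>lborel) < \<infinity>"
  using nn_integral_eq_integral[OF L2_integrable] by simp

lemma cmod_add_squared_le: "(cmod (a + b))\<^sup>2 \<le> 2 * (cmod a)\<^sup>2 + 2 * (cmod b)\<^sup>2"
proof -
  have "(cmod (a + b))\<^sup>2 \<le> (cmod a + cmod b)\<^sup>2" by (intro power_mono norm_triangle_ineq) auto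
  also have "\<dots> \<le> 2 * (cmod a)\<^sup>2 + 2 * (cmod b)\<^sup>2"
    using sum_squares_bound[of "cmod a" "cmod b"] by (simp add: power2_sum)
  finally show ?thesis .
qed

lemma nn_integral_cmod_add_squared_le:
  assumes [measurable]: "a \<in> borel_measurable M" "b \<in> borel_measurable M"
  shows "(\<integral>\<^sup>+q. ennreal ((cmod (a q + b q))\<^sup>2) \<partial>M) \<le> 2 * (\<integral>\<^sup>+q. ennreal ((cmod (a q))\<^sup>2) \<partial>M) + 2 * (\<integral>\<^sup>+q. ennreal ((cmod (b q))\<^sup>2) \<partial>M)"
proof -
  have "(\<integral>\<^sup>+q. ennreal ((cmod (a q + b q))\<^sup>2) \<partial>M) \<le> (\<integral>\<^sup>+q. 2 * ennreal ((cmod (a q))\<^sup>2) + 2 * ennreal ((cmod (b q))\<^sup>2) \<partial>M)"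
  proof (rule nn_integral_mono)
    fix q
    have "ennreal ((cmod (a q + b q))\<^sup>2) \<le> ennreal (2 * (cmod (a q))\<^sup>2 + 2 * (cmod (b q))\<^sup>2)"
      by (rule ennreal_leI[OF cmod_add_squared_le])
    also have "\<dots> = 2 * ennreal ((cmod (a q))\<^sup>2) + 2 * ennreal ((cmod (b q))\<^sup>2)"
      by (simp add: ennreal_mult)
    finally show "ennreal ((cmod (a q + b q))\<^sup>2) \<le> 2 * ennreal ((cmod (a q))\<^sup>2) + 2 * ennreal ((cmod (b q))\<^sup>2)" .
  qed
  also have "\<dots> = 2 * (\<integral>\<^sup>+q. ennreal ((cmod (a q))\<^sup>2) \<partial>M) + 2 * (\<integral>\<^sup>+q. ennreal ((cmod (b q))\<^sup>2) \<partial>M)"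
    by (simp add: nn_integral_add nn_integral_cmult)
  finally show ?thesis .
qed

lemma L2_add: assumes "a \<in> L2" "b \<in> L2" shows "(\<lambda>q. a q + b q) \<in> L2"
proof (rule L2_I)
  note [measurable] = L2_measurable[OF assms(1)] L2_measurable[OF assms(2)]
  show "(\<lambda>q. a q + b q) \<in> borel_measurable borel" by measurable
  have "(\<integral>\<^sup>+q. ennreal ((cmod (a q + b q))\<^sup>2) \<partial>lborel) \<le> 2 * (\<integral>\<^sup>+q. ennreal ((cmod (a q))\<^sup>2) \<partial>lborel) + 2 * (\<integral>\<^sup>+q. ennreal ((cmod (b q))\<^sup>2) \<partial>lborel)"
    by (rule nn_integral_cmod_add_squared_le) measurable
  also have "\<dots> < \<infinity>" using L2_finite assms by (simp add: ennreal_mult_less_top)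
  finally show "(\<integral>\<^sup>+q. ennreal ((cmod (a q + b q))\<^sup>2) \<partial>lborel) < \<infinity>" .
qed

lemma L2_uminus: "a \<in> L2 \<Longrightarrow> (\<lambda>q. - a q) \<in> L2"
  by (auto simp: L2_def)

lemma L2_diff: "a \<in> L2 \<Longrightarrow> b \<in> L2 \<Longrightarrow> (\<lambda>q. a q - b q) \<in> L2"
  using L2_add[OF _ L2_uminus, of a b] by simp

lemma L2_inner_integrable:
  assumes "a \<in> L2" "b \<in> L2"
  shows "integrable lborel (\<lambda>q. a q * cnj (b q))"
    and "(cmod (L2_inner a b))\<^sup>2 \<le> (LINT q|lborel. (cmod (a q))\<^sup>2) * (LINT q|lborel. (cmod (b q))\<^sup>2)"
proof -
  have "(\<lambda>q. cnj (b q)) \<in> borel_measurable lborel" using L2_measurable[OF assms(2)] measurable_compose[OF _ measurable_cnj] by auto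
  note CS = Cauchy_Schwarz_integral[OF _ L2_integrable[OF assms(1)] this]
  show "integrable lborel (\<lambda>q. a q * cnj (b q))"
    and "(cmod (L2_inner a b))\<^sup>2 \<le> (LINT q|lborel. (cmod (a q))\<^sup>2) * (LINT q|lborel. (cmod (b q))\<^sup>2)"
    using CS L2_measurable[OF assms(1)] L2_integrable[OF assms(2)] by (auto simp: L2_inner_def)
qed

lemma L2_inner_diff_left:
  assumes "a \<in> L2" "b \<in> L2" "c \<in> L2"
  shows "L2_inner (\<lambda>q. a q - b q) c = L2_inner a c - L2_inner b c"
proof -
  have "L2_inner (\<lambda>q. a q - b q) c = (LINT q|lborel. a q * cnj (c q) - b q * cnj (c q))"
    unfolding L2_inner_def by (simp add: left_diff_distrib)
  also have "\<dots> = L2_inner a c - L2_inner b c"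
    unfolding L2_inner_def by (rule Bochner_Integration.integral_diff) (intro L2_inner_integrable assms)+
  finally show ?thesis .
qed

lemma L2_inner_commute: "L2_inner a b = cnj (L2_inner b a)"
  unfolding L2_inner_def by (subst Bochner_Integration.integral_cnj[symmetric]) (simp add: mult.commute)

text \<open>Cauchy-Schwarz applied to \<open>h y - g\<close>; the extended-valued limit is first
  turned into one of real integrals, which is legitimate where \<open>h y\<close> lies in
  \<open>L2\<close>.\<close>

lemma L2_inner_tendsto:
  assumes h: "\<forall>\<^sub>F y in F. h y \<in> L2" and g: "g \<in> L2" and k: "k \<in> L2"
    and lim: "((\<lambda>y. \<integral>\<^sup>+q. ennreal ((cmod (h y q - g q))\<^sup>2) \<partial>lborel) \<longlongrightarrow> 0) F"
  shows "((\<lambda>y. L2_inner (h y) k) \<longlongrightarrow> L2_inner g k) F"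
proof -
  define N where "N y = (LINT q|lborel. (cmod (h y q - g q))\<^sup>2)" for y
  have ev: "\<forall>\<^sub>F y in F. ennreal (N y) = (\<integral>\<^sup>+q. ennreal ((cmod (h y q - g q))\<^sup>2) \<partial>lborel)"
    using h by eventually_elim (simp add: N_def nn_integral_eq_integral[OF L2_integrable[OF L2_diff[OF _ g]]])
  have "((\<lambda>y. ennreal (N y)) \<longlongrightarrow> ennreal 0) F"
    using iffD2[OF tendsto_cong[OF ev] lim] by simp
  then have N0: "(N \<longlongrightarrow> 0) F" by (rule tendsto_ennrealD) (auto simp: N_def)
  define c where "c = (LINT q|lborel. (cmod (k q))\<^sup>2)"
  have c0: "((\<lambda>y. sqrt (N y * c)) \<longlongrightarrow> 0) F"
    using tendsto_real_sqrt[OF tendsto_mult_right[OF N0, of c]] by simp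
  have "\<forall>\<^sub>F y in F. norm (L2_inner (h y) k - L2_inner g k) \<le> sqrt (N y * c)"
    using h
  proof eventually_elim
    case (elim y)
    have "(cmod (L2_inner (\<lambda>q. h y q - g q) k))\<^sup>2 \<le> N y * c"
      unfolding N_def c_def by (rule L2_inner_integrable[OF L2_diff[OF elim g] k])
    then show ?case using L2_inner_diff_left[OF elim g k] by (simp add: real_le_rsqrt)
  qed
  then have "((\<lambda>y. L2_inner (h y) k - L2_inner g k) \<longlongrightarrow> 0) F"
    by (rule Lim_null_comparison) (fact c0)
  then show ?thesis by (rule LIM_zero_cancel)
qed

context szego_data
begin

text \<open>The energy of f at frequency \<tau>. Its integral is finite, so it is the dominating
  function when the damping is removed.\<close>

definition T :: "real \<Rightarrow> ennreal" where
  "T \<tau> = (\<integral>\<^sup>+w. ennreal ((cmod (tfourier f \<tau> w))\<^sup>2) \<partial>lborel)"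

lemma T_measurable [measurable]: "T \<in> borel_measurable borel"
  unfolding T_def by measurable

lemma T_finite: "(\<integral>\<^sup>+\<tau>. T \<tau> \<partial>lborel) < \<infinity>"
proof -
  have "(\<integral>\<^sup>+\<tau>. T \<tau> \<partial>lborel) \<le> ennreal (2 * pi) * (\<integral>\<^sup>+q. ennreal ((cmod (f q))\<^sup>2) \<partial>lborel)"
    unfolding T_def by (rule nn_integral_tfourier_le[OF f_measurable test_function_slice[OF test]])
  also have "\<dots> < \<infinity>" using test_function_L2(2)[OF test] by (simp add: ennreal_mult_less_top)
  finally show ?thesis .
qed

text \<open>The factor is what exp (i \<tau> \<zeta>) contributes in modulus at a boundary point
  \<zeta> = t + i p(z).\<close>

definition uw :: "real \<Rightarrow> complex \<Rightarrow> complex" where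
  "uw \<tau> z = u \<tau> z * complex_of_real (exp (- \<tau> * p z))"

lemma uw_measurable [measurable (raw)]:
  assumes [measurable]: "t \<in> borel_measurable M" "z \<in> borel_measurable M"
  shows "(\<lambda>x. uw (t x) (z x)) \<in> borel_measurable M"
  unfolding uw_def by measurable

lemma uw_le_T: "(\<integral>\<^sup>+z. ennreal ((cmod (uw \<tau> z))\<^sup>2) \<partial>lborel) \<le> indicator {0<..} \<tau> * T \<tau>"
  unfolding uw_def T_def by (rule nn_integral_u_le)

lemma uw_L2: "(\<integral>\<^sup>+x. ennreal ((cmod (uw (snd x) (fst x)))\<^sup>2) \<partial>(lborel \<Otimes>\<^sub>M lborel)) < \<infinity>"
proof -
  have "(\<integral>\<^sup>+x. ennreal ((cmod (uw (snd x) (fst x)))\<^sup>2) \<partial>(lborel \<Otimes>\<^sub>M lborel)) = (\<integral>\<^sup>+\<tau>. \<integral>\<^sup>+z. ennreal ((cmod (uw \<tau> z))\<^sup>2) \<partial>lborel \<partial>lborel)"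
    by (subst lborel_pair.nn_integral_snd[symmetric]) auto
  also have "\<dots> \<le> (\<integral>\<^sup>+\<tau>. T \<tau> \<partial>lborel)"
    by (intro nn_integral_mono order_trans[OF uw_le_T]) (auto split: split_indicator)
  also have "\<dots> < \<infinity>" by (rule T_finite)
  finally show ?thesis .
qed

text \<open>At a fixed z the components \<open>uw \<tau> z\<close> are only known to be O(exp
  (\<delta> \<tau>)) for every \<delta> > 0, so exponential damping makes the superposition an
  absolutely convergent integral. Signs are allowed, so that Cauchy estimates are instances of the
  norm bound.\<close>

definition multiplier :: "(real \<Rightarrow> real) \<Rightarrow> bool" where
  "multiplier m \<longleftrightarrow> m \<in> borel_measurable borel \<and> (\<exists>y>0. \<exists>M. \<forall>\<tau>>0. \<bar>m \<tau>\<bar> \<le> M * exp (- y * \<tau>))"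

lemma multiplier_exp: "y > 0 \<Longrightarrow> multiplier (\<lambda>\<tau>. exp (- y * \<tau>))"
  unfolding multiplier_def by (rule conjI, measurable, rule exI[of _ y], rule conjI, assumption, rule exI[of _ 1]) simp

lemma multiplier_diff:
  assumes "multiplier m" "multiplier m'"
  shows "multiplier (\<lambda>\<tau>. m \<tau> - m' \<tau>)"
proof -
  obtain y M where m: "m \<in> borel_measurable borel" "y > 0" "\<And>\<tau>. \<tau> > 0 \<Longrightarrow> \<bar>m \<tau>\<bar> \<le> M * exp (- y * \<tau>)"
    using assms(1) unfolding multiplier_def by blast
  obtain y' M' where m': "m' \<in> borel_measurable borel" "y' > 0" "\<And>\<tau>. \<tau> > 0 \<Longrightarrow> \<bar>m' \<tau>\<bar> \<le> M' * exp (- y' * \<tau>)"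
    using assms(2) unfolding multiplier_def by blast
  have "\<bar>m \<tau> - m' \<tau>\<bar> \<le> (\<bar>M\<bar> + \<bar>M'\<bar>) * exp (- min y y' * \<tau>)" if \<tau>: "\<tau> > 0" for \<tau>
  proof -
    have "M * exp (- y * \<tau>) \<le> \<bar>M\<bar> * exp (- min y y' * \<tau>)" "M' * exp (- y' * \<tau>) \<le> \<bar>M'\<bar> * exp (- min y y' * \<tau>)"
      using \<tau> by (intro mult_mono; auto)+
    with m(3)[OF \<tau>] m'(3)[OF \<tau>] show ?thesis unfolding distrib_right by linarith
  qed
  moreover have "min y y' > 0" using m m' by simp
  moreover have "(\<lambda>\<tau>. m \<tau> - m' \<tau>) \<in> borel_measurable borel" using m(1) m'(1) by measurable
  ultimately show ?thesis unfolding multiplier_def by blast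
qed

lemma uw_multiplier_integrable:
  assumes "multiplier m"
  shows "integrable lborel (\<lambda>\<tau>. uw \<tau> z * complex_of_real (m \<tau>))"
proof -
  obtain y M where m [measurable]: "m \<in> borel_measurable borel" and y: "y > 0" and M: "\<And>\<tau>. \<tau> > 0 \<Longrightarrow> \<bar>m \<tau>\<bar> \<le> M * exp (- y * \<tau>)"
    using assms unfolding multiplier_def by blast
  have M0: "M \<ge> 0" using M[of 1] by (smt (verit) abs_ge_zero exp_gt_zero zero_le_mult_iff zero_less_one)
  \<comment> \<open>Half of the damping rate pays for the growth of \<open>u\<close>, the other half
    remains as decay.\<close>
  obtain C where C: "C > 0" "\<And>\<tau>. cmod (u \<tau> z) \<le> indicator {0<..} \<tau> * (C * exp (\<tau> * (p z + y / 2)))"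
    by (rule u_bound[of "{z}" "y / 2"]) (use y in auto)
  show ?thesis
  proof (rule Bochner_Integration.integrable_bound)
    show "integrable lborel (\<lambda>\<tau>. (C * M) * (indicator {0<..} \<tau> * exp (- (y / 2) * \<tau>)))"
      using y by (intro integrable_mult_right integrable_exp_decay) simp
    show "AE \<tau> in lborel. norm (uw \<tau> z * complex_of_real (m \<tau>)) \<le> norm ((C * M) * (indicator {0<..} \<tau> * exp (- (y / 2) * \<tau>)))"
    proof (rule AE_I2)
      fix \<tau> :: real
      show "norm (uw \<tau> z * complex_of_real (m \<tau>)) \<le> norm ((C * M) * (indicator {0<..} \<tau> * exp (- (y / 2) * \<tau>)))"
      proof (cases "\<tau> > 0")
        case True
        have "norm (uw \<tau> z * complex_of_real (m \<tau>)) \<le> C * exp (\<tau> * (p z + y / 2)) * exp (- \<tau> * p z) * (M * exp (- y * \<tau>))"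
          unfolding uw_def norm_mult using C(1) C(2)[of \<tau>] True M[OF True] M0
          by (intro mult_mono mult_nonneg_nonneg) auto
        also have "\<dots> = C * M * (exp (\<tau> * (p z + y / 2)) * exp (- \<tau> * p z) * exp (- y * \<tau>))" by (simp only: mult_ac)
        also have "exp (\<tau> * (p z + y / 2)) * exp (- \<tau> * p z) * exp (- y * \<tau>) = exp (- (y / 2) * \<tau>)"
          unfolding exp_add[symmetric] by (simp add: algebra_simps)
        finally show ?thesis using True C(1) M0 by simp
      qed (simp add: uw_def u_nonpos)
    qed
  qed measurable
qed

text \<open>The superposition on the boundary with its frequencies damped by m; for
  \<open>decay y\<close> it is \<open>ext\<close> on the vertical translate by y.\<close>

definition V :: "(real \<Rightarrow> real) \<Rightarrow> complex \<times> real \<Rightarrow> complex" where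
  "V m q = 1 / (2 * pi) * (LINT \<tau>|lborel. uw \<tau> (fst q) * complex_of_real (m \<tau>) * cis (\<tau> * snd q))"

lemma V_fourier: "V m (z, t) = 1 / (2 * pi) * fourier (\<lambda>\<tau>. uw \<tau> z * complex_of_real (m \<tau>)) (- t)"
  by (simp add: V_def fourier_def mult.commute)

lemma V_measurable:
  assumes "multiplier m"
  shows "V m \<in> borel_measurable borel"
proof -
  have [measurable]: "m \<in> borel_measurable borel" using assms by (simp add: multiplier_def)
  show ?thesis unfolding V_def[abs_def] by measurable
qed

lemma V_diff:
  assumes "multiplier m" "multiplier m'"
  shows "V (\<lambda>\<tau>. m \<tau> - m' \<tau>) q = V m q - V m' q"
proof -
  have i: "integrable lborel (\<lambda>\<tau>. uw \<tau> (fst q) * complex_of_real (m \<tau>) * cis (\<tau> * snd q))" if "multiplier m" for m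
    using integrable_mult_cis[OF uw_multiplier_integrable[OF that], of "fst q" "snd q"] by (simp add: mult.commute)
  have "(LINT \<tau>|lborel. uw \<tau> (fst q) * complex_of_real (m \<tau> - m' \<tau>) * cis (\<tau> * snd q)) =
     (LINT \<tau>|lborel. uw \<tau> (fst q) * complex_of_real (m \<tau>) * cis (\<tau> * snd q) - uw \<tau> (fst q) * complex_of_real (m' \<tau>) * cis (\<tau> * snd q))"
    by (simp add: algebra_simps)
  also have "\<dots> = (LINT \<tau>|lborel. uw \<tau> (fst q) * complex_of_real (m \<tau>) * cis (\<tau> * snd q)) - (LINT \<tau>|lborel. uw \<tau> (fst q) * complex_of_real (m' \<tau>) * cis (\<tau> * snd q))"
    by (rule Bochner_Integration.integral_diff[OF i[OF assms(1)] i[OF assms(2)]])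
  finally show ?thesis unfolding V_def by (simp add: right_diff_distrib diff_divide_distrib)
qed

definition Eg :: "(real \<Rightarrow> real) \<Rightarrow> ennreal" where
  "Eg m = (\<integral>\<^sup>+\<tau>. indicator {0<..} \<tau> * ennreal ((m \<tau>)\<^sup>2) * T \<tau> \<partial>lborel)"

text \<open>The norm inequality in t for each z and, after Tonelli, contractivity of the Bergman
  projection for each \<tau>. The remaining constant 1 / (2 \<pi>) is at most 1 and is
  dropped.\<close>

lemma V_norm_le:
  assumes "multiplier m"
  shows "(\<integral>\<^sup>+q. ennreal ((cmod (V m q))\<^sup>2) \<partial>lborel) \<le> Eg m"
proof -
  have m [measurable]: "m \<in> borel_measurable borel" using assms by (simp add: multiplier_def)
  note [measurable] = V_measurable[OF assms]
  have c: "(1 / (2 * pi))\<^sup>2 * (2 * pi) \<le> 1"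
    using pi_gt3 by (simp add: power2_eq_square field_simps)
  have inner: "(\<integral>\<^sup>+t. ennreal ((cmod (V m (z, t)))\<^sup>2) \<partial>lborel) \<le> (\<integral>\<^sup>+\<tau>. ennreal ((cmod (uw \<tau> z))\<^sup>2) * ennreal ((m \<tau>)\<^sup>2) \<partial>lborel)" for z
  proof -
    define \<phi> where "\<phi> = (\<lambda>\<tau>. uw \<tau> z * complex_of_real (m \<tau>))"
    have i: "integrable lborel \<phi>" unfolding \<phi>_def by (rule uw_multiplier_integrable[OF assms])
    then have [measurable]: "\<phi> \<in> borel_measurable borel" by simp
    have "(\<integral>\<^sup>+t. ennreal ((cmod (V m (z, t)))\<^sup>2) \<partial>lborel) = (\<integral>\<^sup>+t. ennreal ((1 / (2 * pi))\<^sup>2) * ennreal ((cmod (fourier \<phi> (- t)))\<^sup>2) \<partial>lborel)"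
      by (intro nn_integral_cong) (simp add: V_fourier \<phi>_def norm_mult norm_divide power_mult_distrib power_divide ennreal_mult[symmetric])
    also have "\<dots> = ennreal ((1 / (2 * pi))\<^sup>2) * (\<integral>\<^sup>+t. ennreal ((cmod (fourier \<phi> (- t)))\<^sup>2) \<partial>lborel)"
      by (rule nn_integral_cmult) measurable
    also have "(\<integral>\<^sup>+t. ennreal ((cmod (fourier \<phi> (- t)))\<^sup>2) \<partial>lborel) = (\<integral>\<^sup>+t. ennreal ((cmod (fourier \<phi> t))\<^sup>2) \<partial>lborel)"
      using nn_integral_real_affine[of "\<lambda>t. ennreal ((cmod (fourier \<phi> t))\<^sup>2)" "-1" 0] by simp
    also have "ennreal ((1 / (2 * pi))\<^sup>2) * (\<integral>\<^sup>+t. ennreal ((cmod (fourier \<phi> t))\<^sup>2) \<partial>lborel) \<le> ennreal ((1 / (2 * pi))\<^sup>2) * (ennreal (2 * pi) * (\<integral>\<^sup>+t. ennreal ((cmod (\<phi> t))\<^sup>2) \<partial>lborel))"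
      by (intro mult_left_mono nn_integral_fourier_le i) simp
    also have "\<dots> = ennreal ((1 / (2 * pi))\<^sup>2 * (2 * pi)) * (\<integral>\<^sup>+t. ennreal ((cmod (\<phi> t))\<^sup>2) \<partial>lborel)"
      by (subst ennreal_mult) (auto simp: mult.assoc)
    also have "\<dots> \<le> 1 * (\<integral>\<^sup>+t. ennreal ((cmod (\<phi> t))\<^sup>2) \<partial>lborel)"
      using c by (intro mult_right_mono) (auto simp: ennreal_le_1)
    also have "\<dots> = (\<integral>\<^sup>+\<tau>. ennreal ((cmod (uw \<tau> z))\<^sup>2) * ennreal ((m \<tau>)\<^sup>2) \<partial>lborel)"
      by (simp add: \<phi>_def norm_mult power_mult_distrib ennreal_mult)
    finally show ?thesis .
  qed
  have "(\<integral>\<^sup>+q. ennreal ((cmod (V m q))\<^sup>2) \<partial>lborel) = (\<integral>\<^sup>+z. \<integral>\<^sup>+t. ennreal ((cmod (V m (z, t)))\<^sup>2) \<partial>lborel \<partial>lborel)"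
    by (rule nn_integral_lborel_pair) measurable
  also have "\<dots> \<le> (\<integral>\<^sup>+z. \<integral>\<^sup>+\<tau>. ennreal ((cmod (uw \<tau> z))\<^sup>2) * ennreal ((m \<tau>)\<^sup>2) \<partial>lborel \<partial>lborel)"
    by (intro nn_integral_mono inner)
  also have "\<dots> = (\<integral>\<^sup>+\<tau>. \<integral>\<^sup>+z. ennreal ((cmod (uw \<tau> z))\<^sup>2) * ennreal ((m \<tau>)\<^sup>2) \<partial>lborel \<partial>lborel)"
    by (rule lborel_pair.Fubini') measurable
  also have "\<dots> = (\<integral>\<^sup>+\<tau>. (\<integral>\<^sup>+z. ennreal ((cmod (uw \<tau> z))\<^sup>2) \<partial>lborel) * ennreal ((m \<tau>)\<^sup>2) \<partial>lborel)"
    by (intro nn_integral_cong nn_integral_multc) measurable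
  also have "\<dots> \<le> Eg m"
    unfolding Eg_def
  proof (rule nn_integral_mono)
    fix \<tau>
    have "(\<integral>\<^sup>+z. ennreal ((cmod (uw \<tau> z))\<^sup>2) \<partial>lborel) * ennreal ((m \<tau>)\<^sup>2) \<le> indicator {0<..} \<tau> * T \<tau> * ennreal ((m \<tau>)\<^sup>2)"
      by (intro mult_right_mono uw_le_T) simp
    then show "(\<integral>\<^sup>+z. ennreal ((cmod (uw \<tau> z))\<^sup>2) \<partial>lborel) * ennreal ((m \<tau>)\<^sup>2) \<le> indicator {0<..} \<tau> * ennreal ((m \<tau>)\<^sup>2) * T \<tau>"
      by (simp only: mult_ac)
  qed
  finally show ?thesis .
qed

lemma Eg_le_T:
  assumes "\<And>\<tau>. \<tau> > 0 \<Longrightarrow> \<bar>m \<tau>\<bar> \<le> 1"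
  shows "Eg m \<le> (\<integral>\<^sup>+\<tau>. T \<tau> \<partial>lborel)"
  unfolding Eg_def
proof (rule nn_integral_mono)
  fix \<tau> :: real
  have "(m \<tau>)\<^sup>2 \<le> 1" if "\<tau> > 0" using assms[OF that] by (simp add: abs_square_le_1)
  then have "indicator {0<..} \<tau> * ennreal ((m \<tau>)\<^sup>2) \<le> 1" by (auto split: split_indicator simp: ennreal_le_1)
  from mult_right_mono[OF this, of "T \<tau>"] show "indicator {0<..} \<tau> * ennreal ((m \<tau>)\<^sup>2) * T \<tau> \<le> T \<tau>" by simp
qed

abbreviation "decay y \<equiv> (\<lambda>\<tau>::real. exp (- y * \<tau>))"

lemma ext_lift: "ext (lift p y q) = V (decay y) q"
proof -
  obtain z t where q: "q = (z, t)" by force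
  have "exp (\<i> * complex_of_real \<tau> * (complex_of_real t + \<i> * complex_of_real (p z) + \<i> * complex_of_real y))
     = complex_of_real (exp (- \<tau> * p z)) * complex_of_real (exp (- y * \<tau>)) * cis (\<tau> * t)" for \<tau>
  proof -
    have "\<i> * complex_of_real \<tau> * (complex_of_real t + \<i> * complex_of_real (p z) + \<i> * complex_of_real y)
      = complex_of_real (- \<tau> * p z) + (complex_of_real (- y * \<tau>) + \<i> * complex_of_real (\<tau> * t))"
      by (simp add: algebra_simps)
    then show ?thesis by (simp only: exp_add exp_of_real cis_conv_exp mult.assoc)
  qed
  then show ?thesis
    unfolding q ext_def lift_def V_def uw_def by (simp add: mult.assoc)
qed

lemma V_decay_L2: "y > 0 \<Longrightarrow> V (decay y) \<in> L2"
  by (rule L2_I[OF V_measurable[OF multiplier_exp]], assumption,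
      rule le_less_trans[OF order_trans[OF V_norm_le[OF multiplier_exp] Eg_le_T] T_finite]) auto

text \<open>The energy removed by damping. It controls the distance of two translates and, in the
  limit, of a translate from its boundary value.\<close>

definition E :: "real \<Rightarrow> ennreal" where "E y = Eg (\<lambda>\<tau>. 1 - exp (- y * \<tau>))"

lemma E_tendsto: "(E \<longlongrightarrow> 0) (at_right 0)"
  unfolding tendsto_at_iff_sequentially
proof (intro allI impI)
  fix X :: "nat \<Rightarrow> real" assume X: "\<forall>i. X i \<in> {0<..} - {0}" "X \<longlonglongrightarrow> 0"
  have "(\<lambda>i. \<integral>\<^sup>+\<tau>. indicator {0<..} \<tau> * ennreal ((1 - exp (- X i * \<tau>))\<^sup>2) * T \<tau> \<partial>lborel) \<longlonglongrightarrow> (\<integral>\<^sup>+\<tau>. 0 \<partial>(lborel :: real measure))"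
  proof (rule nn_integral_dominated_convergence[where w=T])
    show "AE \<tau> in lborel. indicator {0<..} \<tau> * ennreal ((1 - exp (- X i * \<tau>))\<^sup>2) * T \<tau> \<le> T \<tau>" for i
    proof (rule AE_I2)
      fix \<tau> :: real
      have "(1 - exp (- X i * \<tau>))\<^sup>2 \<le> 1" if "\<tau> > 0"
        using X(1) that by (intro power_le_one) (auto simp: less_imp_le)
      then have "indicator {0<..} \<tau> * ennreal ((1 - exp (- X i * \<tau>))\<^sup>2) \<le> 1" by (auto split: split_indicator simp: ennreal_le_1)
      from mult_right_mono[OF this, of "T \<tau>"] show "indicator {0<..} \<tau> * ennreal ((1 - exp (- X i * \<tau>))\<^sup>2) * T \<tau> \<le> T \<tau>" by simp
    qed
    have "AE \<tau> in lborel. T \<tau> \<noteq> \<infinity>" using T_finite by (intro nn_integral_PInf_AE) auto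
    then show "AE \<tau> in lborel. (\<lambda>i. indicator {0<..} \<tau> * ennreal ((1 - exp (- X i * \<tau>))\<^sup>2) * T \<tau>) \<longlonglongrightarrow> 0"
    proof eventually_elim
      case (elim \<tau>)
      have "(\<lambda>i. (1 - exp (- X i * \<tau>))\<^sup>2) \<longlonglongrightarrow> (1 - exp (- 0 * \<tau>))\<^sup>2" by (intro tendsto_intros X)
      then have "(\<lambda>i. ennreal ((1 - exp (- X i * \<tau>))\<^sup>2)) \<longlonglongrightarrow> ennreal 0" by (intro tendsto_ennrealI) simp
      then have "(\<lambda>i. T \<tau> * ennreal ((1 - exp (- X i * \<tau>))\<^sup>2)) \<longlonglongrightarrow> T \<tau> * ennreal 0"
        using elim by (intro ennreal_tendsto_cmult) (auto simp: less_top)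
      then show ?case by (cases "\<tau> > 0") (auto simp: mult.commute)
    qed
  qed (use T_finite in auto)
  then show "(E \<circ> X) \<longlonglongrightarrow> 0" by (simp add: E_def Eg_def comp_def)
qed

lemma V_decay_diff_le:
  assumes "y > 0" "y' > 0"
  shows "(\<integral>\<^sup>+q. ennreal ((cmod (V (decay y) q - V (decay y') q))\<^sup>2) \<partial>lborel) \<le> E y + E y'"
proof -
  have "(\<integral>\<^sup>+q. ennreal ((cmod (V (decay y) q - V (decay y') q))\<^sup>2) \<partial>lborel) \<le> Eg (\<lambda>\<tau>. exp (- y * \<tau>) - exp (- y' * \<tau>))"
    using V_norm_le[OF multiplier_diff[OF multiplier_exp[OF assms(1)] multiplier_exp[OF assms(2)]]]
    unfolding V_diff[OF multiplier_exp[OF assms(1)] multiplier_exp[OF assms(2)]] .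
  also have "\<dots> \<le> (\<integral>\<^sup>+\<tau>. indicator {0<..} \<tau> * ennreal ((1 - exp (- y * \<tau>))\<^sup>2) * T \<tau> + indicator {0<..} \<tau> * ennreal ((1 - exp (- y' * \<tau>))\<^sup>2) * T \<tau> \<partial>lborel)"
    unfolding Eg_def
  proof (rule nn_integral_mono)
    fix \<tau> :: real
    have "(exp (- y * \<tau>) - exp (- y' * \<tau>))\<^sup>2 \<le> (1 - exp (- y * \<tau>))\<^sup>2 + (1 - exp (- y' * \<tau>))\<^sup>2" if "\<tau> > 0"
    proof -
      define a b where "a = 1 - exp (- y * \<tau>)" and "b = 1 - exp (- y' * \<tau>)"
      have "a \<ge> 0" "b \<ge> 0" using assms that by (auto simp: a_def b_def less_imp_le)
      then have "(b - a)\<^sup>2 \<le> a\<^sup>2 + b\<^sup>2" by (simp add: power2_diff)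
      then show ?thesis by (simp add: a_def b_def)
    qed
    then have "indicator {0<..} \<tau> * ennreal ((exp (- y * \<tau>) - exp (- y' * \<tau>))\<^sup>2) \<le> indicator {0<..} \<tau> * ennreal ((1 - exp (- y * \<tau>))\<^sup>2) + indicator {0<..} \<tau> * ennreal ((1 - exp (- y' * \<tau>))\<^sup>2)"
      by (auto split: split_indicator simp flip: ennreal_plus intro!: ennreal_leI)
    from mult_right_mono[OF this, of "T \<tau>"]
    show "indicator {0<..} \<tau> * ennreal ((exp (- y * \<tau>) - exp (- y' * \<tau>))\<^sup>2) * T \<tau> \<le> indicator {0<..} \<tau> * ennreal ((1 - exp (- y * \<tau>))\<^sup>2) * T \<tau> + indicator {0<..} \<tau> * ennreal ((1 - exp (- y' * \<tau>))\<^sup>2) * T \<tau>"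
      by (simp add: distrib_right)
  qed
  also have "\<dots> = E y + E y'"
    unfolding E_def Eg_def by (rule nn_integral_add) measurable
  finally show ?thesis .
qed

text \<open>Completeness by hand: heights \<open>Y n\<close> whose lost energy is at most 4^-n / 2
  give an almost everywhere limit g. Fatou's lemma along \<open>Y\<close> then bounds the squared
  distance of every translate from g by \<open>E y\<close>, so convergence holds for the whole
  family and not only along the sequence.\<close>

lemma boundary_value:
  obtains g where "g \<in> L2" "((\<lambda>y. \<integral>\<^sup>+q. ennreal ((cmod (V (decay y) q - g q))\<^sup>2) \<partial>lborel) \<longlongrightarrow> 0) (at_right 0)"
proof -
  have "\<exists>y>0. y < 1 / real (Suc n) \<and> E y \<le> ennreal ((1/4) ^ n / 2)" for n
  proof -
    have "\<forall>\<^sub>F y in at_right 0. E y < ennreal ((1/4) ^ n / 2)"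
      using E_tendsto by (rule order_tendstoD) simp
    moreover have "\<forall>\<^sub>F y in at_right (0::real). y \<in> {0<..<1 / real (Suc n)}"
      by (rule eventually_at_right_real) simp
    ultimately have "\<forall>\<^sub>F y in at_right 0. y > 0 \<and> y < 1 / real (Suc n) \<and> E y \<le> ennreal ((1/4) ^ n / 2)"
      by eventually_elim auto
    then show ?thesis using eventually_happens[of _ "at_right (0::real)"] by fastforce
  qed
  then obtain Y where Y: "\<And>n. Y n > 0" "\<And>n. Y n < 1 / real (Suc n)" "\<And>n. E (Y n) \<le> ennreal ((1/4) ^ n / 2)" by metis
  obtain g where g: "g \<in> borel_measurable lborel" "AE q in lborel. (\<lambda>n. V (decay (Y n)) q) \<longlonglongrightarrow> g q"
  proof (rule L2_Cauchy_AE_convergent[where F="\<lambda>n. V (decay (Y n))" and M=lborel])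
    show "V (decay (Y n)) \<in> borel_measurable lborel" for n using V_measurable[OF multiplier_exp[OF Y(1)]] by simp
    fix n
    have "(\<integral>\<^sup>+q. ennreal ((cmod (V (decay (Y (Suc n))) q - V (decay (Y n)) q))\<^sup>2) \<partial>lborel) \<le> E (Y (Suc n)) + E (Y n)"
      by (rule V_decay_diff_le[OF Y(1) Y(1)])
    also have "\<dots> \<le> ennreal ((1/4) ^ Suc n / 2) + ennreal ((1/4) ^ n / 2)" by (intro add_mono Y)
    also have "\<dots> = ennreal ((1/4) ^ Suc n / 2 + (1/4) ^ n / 2)" by (rule ennreal_plus[symmetric]) auto
    also have "\<dots> \<le> ennreal ((1/4) ^ n)" by (intro ennreal_leI) simp
    finally show "(\<integral>\<^sup>+q. ennreal ((cmod (V (decay (Y (Suc n))) q - V (decay (Y n)) q))\<^sup>2) \<partial>lborel) \<le> ennreal ((1/4) ^ n)" .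
  qed
  have [measurable]: "g \<in> borel_measurable borel" using g(1) by simp
  have EY: "(\<lambda>n. E (Y n)) \<longlonglongrightarrow> 0"
  proof -
    have "(\<lambda>n. 1 / real (Suc n)) \<longlonglongrightarrow> 0" using LIMSEQ_inverse_real_of_nat by (simp add: inverse_eq_divide)
    then have "Y \<longlonglongrightarrow> 0" by (rule tendsto_sandwich[rotated 2, OF tendsto_const]) (use Y in \<open>auto intro!: always_eventually less_imp_le\<close>)
    then have "(E \<circ> Y) \<longlonglongrightarrow> 0" using E_tendsto Y(1) unfolding tendsto_at_iff_sequentially by force
    then show ?thesis by (simp add: comp_def)
  qed
  have bound: "(\<integral>\<^sup>+q. ennreal ((cmod (V (decay y) q - g q))\<^sup>2) \<partial>lborel) \<le> E y" if y: "y > 0" for y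
  proof -
    note [measurable] = V_measurable[OF multiplier_exp[OF y]] V_measurable[OF multiplier_exp[OF Y(1)]]
    have "(\<integral>\<^sup>+q. ennreal ((cmod (V (decay y) q - g q))\<^sup>2) \<partial>lborel) = (\<integral>\<^sup>+q. liminf (\<lambda>n. ennreal ((cmod (V (decay y) q - V (decay (Y n)) q))\<^sup>2)) \<partial>lborel)"
    proof (rule nn_integral_cong_AE)
      show "AE q in lborel. ennreal ((cmod (V (decay y) q - g q))\<^sup>2) = liminf (\<lambda>n. ennreal ((cmod (V (decay y) q - V (decay (Y n)) q))\<^sup>2))"
        using g(2)
      proof eventually_elim
        case (elim q)
        have "(\<lambda>n. ennreal ((cmod (V (decay y) q - V (decay (Y n)) q))\<^sup>2)) \<longlonglongrightarrow> ennreal ((cmod (V (decay y) q - g q))\<^sup>2)"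
          by (intro tendsto_ennrealI tendsto_intros elim)
        then show ?case by (rule lim_imp_Liminf[symmetric, rotated]) simp
      qed
    qed
    also have "\<dots> \<le> liminf (\<lambda>n. \<integral>\<^sup>+q. ennreal ((cmod (V (decay y) q - V (decay (Y n)) q))\<^sup>2) \<partial>lborel)"
      by (rule nn_integral_liminf) measurable
    also have "\<dots> \<le> liminf (\<lambda>n. E y + E (Y n))"
      by (intro Liminf_mono always_eventually allI V_decay_diff_le y Y)
    also have "\<dots> = E y + 0"
      by (rule lim_imp_Liminf[OF _ tendsto_add[OF tendsto_const EY]]) simp
    finally show ?thesis by simp
  qed
  have Vg: "(\<lambda>q. V (decay 1) q - g q) \<in> L2"
  proof (rule L2_I)
    show "(\<lambda>q. V (decay 1) q - g q) \<in> borel_measurable borel" using V_measurable[OF multiplier_exp[of 1]] by measurable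
    have "E 1 \<le> (\<integral>\<^sup>+\<tau>. T \<tau> \<partial>lborel)" unfolding E_def by (rule Eg_le_T) auto
    then show "(\<integral>\<^sup>+q. ennreal ((cmod (V (decay 1) q - g q))\<^sup>2) \<partial>lborel) < \<infinity>"
      using bound[of 1] T_finite by (auto intro: le_less_trans order_trans)
  qed
  show ?thesis
  proof
    show "g \<in> L2" using L2_diff[OF V_decay_L2[of 1] Vg] by simp
    show "((\<lambda>y. \<integral>\<^sup>+q. ennreal ((cmod (V (decay y) q - g q))\<^sup>2) \<partial>lborel) \<longlongrightarrow> 0) (at_right 0)"
      by (rule tendsto_sandwich[OF _ eventually_mono[OF eventually_at_right_less bound] tendsto_const E_tendsto]) simp
  qed
qed

definition g :: "complex \<times> real \<Rightarrow> complex" where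
  "g = (SOME g. g \<in> L2 \<and> ((\<lambda>y. \<integral>\<^sup>+q. ennreal ((cmod (V (decay y) q - g q))\<^sup>2) \<partial>lborel) \<longlongrightarrow> 0) (at_right 0))"

lemma g_L2: "g \<in> L2"
  and g_limit: "((\<lambda>y. \<integral>\<^sup>+q. ennreal ((cmod (V (decay y) q - g q))\<^sup>2) \<partial>lborel) \<longlongrightarrow> 0) (at_right 0)"
proof -
  have "\<exists>g. g \<in> L2 \<and> ((\<lambda>y. \<integral>\<^sup>+q. ennreal ((cmod (V (decay y) q - g q))\<^sup>2) \<partial>lborel) \<longlongrightarrow> 0) (at_right 0)"
    by (rule boundary_value) blast
  from someI_ex[OF this] have "g \<in> L2 \<and> ((\<lambda>y. \<integral>\<^sup>+q. ennreal ((cmod (V (decay y) q - g q))\<^sup>2) \<partial>lborel) \<longlongrightarrow> 0) (at_right 0)"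
    unfolding g_def .
  then show "g \<in> L2" "((\<lambda>y. \<integral>\<^sup>+q. ennreal ((cmod (V (decay y) q - g q))\<^sup>2) \<partial>lborel) \<longlongrightarrow> 0) (at_right 0)"
    by simp_all
qed

lemma g_H2: "g \<in> H2 p"
proof -
  have "(SUP y\<in>{0<..}. \<integral>\<^sup>+x. ennreal ((cmod (V (decay y) x))\<^sup>2) \<partial>lborel) \<le> (\<integral>\<^sup>+\<tau>. T \<tau> \<partial>lborel)"
  proof (rule SUP_least)
    fix y :: real assume "y \<in> {0<..}"
    then show "(\<integral>\<^sup>+x. ennreal ((cmod (V (decay y) x))\<^sup>2) \<partial>lborel) \<le> (\<integral>\<^sup>+\<tau>. T \<tau> \<partial>lborel)"
      by (intro order_trans[OF V_norm_le[OF multiplier_exp] Eg_le_T]) auto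
  qed
  also have "\<dots> < \<infinity>" by (rule T_finite)
  finally show ?thesis
    unfolding H2_def mem_Collect_eq using g_L2 g_limit ext_holomorphic2
    by (intro conjI exI[of _ ext]) (simp_all only: ext_lift infinity_ennreal_def)
qed

definition pairing :: "(complex \<times> real \<Rightarrow> complex) \<Rightarrow> real \<Rightarrow> complex" where
  "pairing k \<tau> = (LINT z|lborel. uw \<tau> z * cnj (tfourier k \<tau> z))"

text \<open>Parseval's formula for g and k. For the damped function \<open>V (decay y)\<close> it
  follows from the multiplication formula on each slice and Fubini; then y tends to 0, on the left
  by convergence in \<open>L2\<close>, on the right by dominated convergence.\<close>

lemma
  assumes k: "k \<in> L2" and slice: "\<And>z. integrable lborel (\<lambda>t. k (z, t))"
  shows pairing_integrable: "integrable lborel (pairing k)"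
    and L2_inner_g: "L2_inner g k = 1 / (2 * pi) * (LINT \<tau>|lborel. pairing k \<tau>)"
proof -
  note km [measurable] = L2_measurable[OF k]
  define P where "P x = uw (snd x) (fst x) * cnj (tfourier k (snd x) (fst x))" for x
  have Pm [measurable]: "P \<in> borel_measurable (lborel \<Otimes>\<^sub>M lborel)" unfolding P_def by measurable
  have i1: "integrable (lborel \<Otimes>\<^sub>M lborel) (\<lambda>x. (cmod (uw (snd x) (fst x)))\<^sup>2)"
    using uw_L2 by (intro integrableI_bounded) auto
  have i2: "integrable (lborel \<Otimes>\<^sub>M lborel) (\<lambda>x. (cmod (cnj (tfourier k (snd x) (fst x))))\<^sup>2)"
  proof (intro integrableI_bounded)
    have "(\<integral>\<^sup>+x. ennreal (norm ((cmod (cnj (tfourier k (snd x) (fst x))))\<^sup>2)) \<partial>(lborel \<Otimes>\<^sub>M lborel)) = (\<integral>\<^sup>+\<tau>. \<integral>\<^sup>+z. ennreal ((cmod (tfourier k \<tau> z))\<^sup>2) \<partial>lborel \<partial>lborel)"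
      by (subst lborel_pair.nn_integral_snd[symmetric]) auto
    also have "\<dots> \<le> ennreal (2 * pi) * (\<integral>\<^sup>+q. ennreal ((cmod (k q))\<^sup>2) \<partial>lborel)"
      by (rule nn_integral_tfourier_le[OF km slice])
    also have "\<dots> < \<infinity>" using L2_finite[OF k] by (simp add: ennreal_mult_less_top)
    finally show "(\<integral>\<^sup>+x. ennreal (norm ((cmod (cnj (tfourier k (snd x) (fst x))))\<^sup>2)) \<partial>(lborel \<Otimes>\<^sub>M lborel)) < \<infinity>" .
  qed measurable
  have Pint: "integrable (lborel \<Otimes>\<^sub>M lborel) P"
    unfolding P_def by (rule Cauchy_Schwarz_integral(1)[OF _ i1 _ i2]) measurable
  have pint: "integrable lborel (\<lambda>\<tau>. LINT z|lborel. P (z, \<tau>))"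
    using lborel_pair.integrable_snd[of "\<lambda>z \<tau>. P (z, \<tau>)"] Pint by simp
  then show pi: "integrable lborel (pairing k)"
    unfolding pairing_def[abs_def] P_def by simp
  have key: "L2_inner (V (decay y)) k = 1 / (2 * pi) * (LINT \<tau>|lborel. complex_of_real (exp (- y * \<tau>)) * pairing k \<tau>)" if y: "y > 0" for y
  proof -
    define \<Phi> where "\<Phi> z \<tau> = uw \<tau> z * complex_of_real (exp (- y * \<tau>))" for z \<tau>
    have \<Phi>i: "integrable lborel (\<Phi> z)" for z unfolding \<Phi>_def by (rule uw_multiplier_integrable[OF multiplier_exp[OF y]])
    \<comment> \<open>\<open>V\<close> contains cis (\<tau> t) while \<open>fourier\<close> has the
      opposite sign; reflecting t reconciles them.\<close>
    have cF: "fourier (\<lambda>t. cnj (k (z, - t))) \<tau> = cnj (tfourier k \<tau> z)" for z \<tau>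
    proof -
      have "fourier (\<lambda>t. cnj (k (z, - t))) \<tau> = (LINT s|lborel. cnj (k (z, s)) * cis (\<tau> * s))"
        unfolding fourier_def by (subst lborel_integral_real_affine[where t=0 and c="-1"]) auto
      also have "\<dots> = cnj (tfourier k \<tau> z)"
        unfolding tfourier_def fourier_def by (subst Bochner_Integration.integral_cnj[symmetric]) (simp add: cis_cnj)
      finally show ?thesis .
    qed
    have slice_eq: "(LINT t|lborel. V (decay y) (z, t) * cnj (k (z, t))) = 1 / (2 * pi) * (LINT \<tau>|lborel. \<Phi> z \<tau> * cnj (tfourier k \<tau> z))" for z
    proof -
      have ci: "integrable lborel (\<lambda>t. cnj (k (z, - t)))"
        using lborel_integrable_real_affine[of "\<lambda>t. cnj (k (z, t))" "-1" 0] slice[of z] by simp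
      have "(LINT t|lborel. V (decay y) (z, t) * cnj (k (z, t))) = (LINT t|lborel. V (decay y) (z, - t) * cnj (k (z, - t)))"
        by (subst lborel_integral_real_affine[where t=0 and c="-1"]) auto
      also have "\<dots> = (LINT t|lborel. 1 / (2 * pi) * (cnj (k (z, - t)) * fourier (\<Phi> z) t))"
        unfolding V_fourier \<Phi>_def by (simp add: mult_ac)
      also have "\<dots> = 1 / (2 * pi) * (LINT t|lborel. cnj (k (z, - t)) * fourier (\<Phi> z) t)" by simp
      also have "(LINT t|lborel. cnj (k (z, - t)) * fourier (\<Phi> z) t) = (LINT \<tau>|lborel. \<Phi> z \<tau> * fourier (\<lambda>t. cnj (k (z, - t))) \<tau>)"
        by (rule fourier_multiplication[OF \<Phi>i ci])
      finally show ?thesis unfolding cF .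
    qed
    have pair_eq: "(LINT z|lborel. \<Phi> z \<tau> * cnj (tfourier k \<tau> z)) = complex_of_real (exp (- y * \<tau>)) * pairing k \<tau>" for \<tau>
      unfolding pairing_def integral_mult_right_zero[symmetric] \<Phi>_def
      by (intro Bochner_Integration.integral_cong) (simp_all add: mult_ac)
    have "L2_inner (V (decay y)) k = (LINT z|lborel. LINT t|lborel. V (decay y) (z, t) * cnj (k (z, t)))"
      unfolding L2_inner_def lborel_prod[symmetric]
      by (rule lborel_pair.integral_fst'[symmetric]) (use L2_inner_integrable(1)[OF V_decay_L2[OF y] k] in \<open>simp add: lborel_prod\<close>)
    also have "\<dots> = (LINT z|lborel. 1 / (2 * pi) * (LINT \<tau>|lborel. \<Phi> z \<tau> * cnj (tfourier k \<tau> z)))"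
      unfolding slice_eq ..
    also have "(LINT z|lborel. 1 / (2 * pi) * (LINT \<tau>|lborel. \<Phi> z \<tau> * cnj (tfourier k \<tau> z))) = 1 / (2 * pi) * (LINT z|lborel. LINT \<tau>|lborel. \<Phi> z \<tau> * cnj (tfourier k \<tau> z))"
      by simp
    also have "(LINT z|lborel. LINT \<tau>|lborel. \<Phi> z \<tau> * cnj (tfourier k \<tau> z)) = (LINT \<tau>|lborel. LINT z|lborel. \<Phi> z \<tau> * cnj (tfourier k \<tau> z))"
    proof (rule lborel_pair.Fubini_integral[symmetric])
      \<comment> \<open>The indicator makes the damping factor at most 1, and changes nothing
        because \<open>uw\<close> vanishes for \<tau> \<le> 0.\<close>
      have "integrable (lborel \<Otimes>\<^sub>M lborel) (\<lambda>x. complex_of_real (indicator {0<..} (snd x) * exp (- y * snd x)) * P x)"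
      proof (rule Bochner_Integration.integrable_bound[OF Pint])
        show "AE x in lborel \<Otimes>\<^sub>M lborel. norm (complex_of_real (indicator {0<..} (snd x) * exp (- y * snd x)) * P x) \<le> norm (P x)"
          using y by (intro AE_I2) (auto simp: norm_mult intro!: mult_left_le_one_le split: split_indicator)
      qed measurable
      also have "(\<lambda>x. complex_of_real (indicator {0<..} (snd x) * exp (- y * snd x)) * P x) = (\<lambda>(z, \<tau>). \<Phi> z \<tau> * cnj (tfourier k \<tau> z))"
        by (auto simp: P_def \<Phi>_def fun_eq_iff uw_def u_nonpos split: split_indicator)
      finally show "integrable (lborel \<Otimes>\<^sub>M lborel) (\<lambda>(z, \<tau>). \<Phi> z \<tau> * cnj (tfourier k \<tau> z))" .
    qed
    finally show ?thesis unfolding pair_eq .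
  qed
  have lim1: "((\<lambda>y. L2_inner (V (decay y)) k) \<longlongrightarrow> L2_inner g k) (at_right 0)"
    by (rule L2_inner_tendsto[OF eventually_mono[OF eventually_at_right_less V_decay_L2] g_L2 k g_limit])
  have "((\<lambda>y. LINT \<tau>|lborel. complex_of_real (exp (- y * \<tau>)) * pairing k \<tau>) \<longlongrightarrow> (LINT \<tau>|lborel. pairing k \<tau>)) (at_right 0)"
    unfolding tendsto_at_iff_sequentially
  proof (intro allI impI)
    fix X :: "nat \<Rightarrow> real" assume X: "\<forall>i. X i \<in> {0<..} - {0}" "X \<longlonglongrightarrow> 0"
    note [measurable] = borel_measurable_integrable[OF pi]
    have p0: "pairing k \<tau> = 0" if "\<tau> \<le> 0" for \<tau> using that by (simp add: pairing_def uw_def u_nonpos)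
    show "((\<lambda>y. LINT \<tau>|lborel. complex_of_real (exp (- y * \<tau>)) * pairing k \<tau>) \<circ> X) \<longlonglongrightarrow> (LINT \<tau>|lborel. pairing k \<tau>)"
      unfolding comp_def
    proof (rule integral_dominated_convergence[where w="\<lambda>\<tau>. cmod (pairing k \<tau>)"])
      show "AE \<tau> in lborel. (\<lambda>i. complex_of_real (exp (- X i * \<tau>)) * pairing k \<tau>) \<longlonglongrightarrow> pairing k \<tau>"
      proof (rule AE_I2)
        fix \<tau>
        have "(\<lambda>i. complex_of_real (exp (- X i * \<tau>)) * pairing k \<tau>) \<longlonglongrightarrow> complex_of_real (exp (- 0 * \<tau>)) * pairing k \<tau>"
          by (intro tendsto_intros X)
        then show "(\<lambda>i. complex_of_real (exp (- X i * \<tau>)) * pairing k \<tau>) \<longlonglongrightarrow> pairing k \<tau>" by simp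
      qed
      show "AE \<tau> in lborel. norm (complex_of_real (exp (- X i * \<tau>)) * pairing k \<tau>) \<le> cmod (pairing k \<tau>)" for i
      proof (rule AE_I2)
        fix \<tau> :: real
        show "norm (complex_of_real (exp (- X i * \<tau>)) * pairing k \<tau>) \<le> cmod (pairing k \<tau>)"
          using X(1) p0[of \<tau>] by (cases "\<tau> > 0") (auto simp: norm_mult less_imp_le intro!: mult_left_le_one_le)
      qed
    qed (use pi in auto)
  qed
  then have "((\<lambda>y. 1 / (2 * pi) * (LINT \<tau>|lborel. complex_of_real (exp (- y * \<tau>)) * pairing k \<tau>)) \<longlongrightarrow> 1 / (2 * pi) * (LINT \<tau>|lborel. pairing k \<tau>)) (at_right 0)"
    by (rule tendsto_mult_left)
  moreover have "\<forall>\<^sub>F y in at_right 0. 1 / (2 * pi) * (LINT \<tau>|lborel. complex_of_real (exp (- y * \<tau>)) * pairing k \<tau>) = L2_inner (V (decay y)) k"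
    by (rule eventually_mono[OF eventually_at_right_less]) (rule key[symmetric])
  ultimately have "((\<lambda>y. L2_inner (V (decay y)) k) \<longlongrightarrow> 1 / (2 * pi) * (LINT \<tau>|lborel. pairing k \<tau>)) (at_right 0)"
    by (rule Lim_transform_eventually)
  then show "L2_inner g k = 1 / (2 * pi) * (LINT \<tau>|lborel. pairing k \<tau>)"
    by (rule tendsto_unique[OF trivial_limit_at_right_real lim1])
qed

end

section \<open>Regularity of Hardy space functions\<close>

lemma integrable_inverse_quadratic:
  assumes "\<epsilon> > 0"
  shows "integrable lborel (\<lambda>t::real. 1 / (1 + (\<epsilon> * (t + x))\<^sup>2))"
proof -
  have "integrable lborel (\<lambda>t::real. 1 / (1 + t\<^sup>2))"
    using integrable_inverse_1_plus_square by (simp add: set_integrable_def inverse_eq_divide)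
  from lborel_integrable_real_affine[OF this, of \<epsilon> "\<epsilon> * x"] assms show ?thesis
    by (simp add: algebra_simps)
qed

text \<open>For Im \<zeta> \<ge> 0 the squared modulus of the denominator is (1 + \<epsilon> Im
  \<zeta>)^2 + (\<epsilon> Re \<zeta>)^2. Squaring the regulariser is what makes the resulting bound
  integrable along horizontal lines.\<close>

lemma norm_regulariser_le:
  assumes "\<epsilon> > 0" "Im \<zeta> \<ge> 0"
  shows "cmod ((1 / (1 - \<i> * complex_of_real \<epsilon> * \<zeta>))\<^sup>2) \<le> 1 / (1 + (\<epsilon> * Re \<zeta>)\<^sup>2)" "1 - \<i> * complex_of_real \<epsilon> * \<zeta> \<noteq> 0"
proof -
  have "(cmod (1 - \<i> * complex_of_real \<epsilon> * \<zeta>))\<^sup>2 = (1 + \<epsilon> * Im \<zeta>)\<^sup>2 + (\<epsilon> * Re \<zeta>)\<^sup>2"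
    by (simp add: cmod_power2)
  also have "\<dots> \<ge> 1 + (\<epsilon> * Re \<zeta>)\<^sup>2"
    using assms power_mono[of 1 "1 + \<epsilon> * Im \<zeta>" 2] by simp
  finally have *: "1 + (\<epsilon> * Re \<zeta>)\<^sup>2 \<le> (cmod (1 - \<i> * complex_of_real \<epsilon> * \<zeta>))\<^sup>2" .
  moreover have pos: "1 + (\<epsilon> * Re \<zeta>)\<^sup>2 > 0" by (intro add_pos_nonneg) auto
  ultimately show "cmod ((1 / (1 - \<i> * complex_of_real \<epsilon> * \<zeta>))\<^sup>2) \<le> 1 / (1 + (\<epsilon> * Re \<zeta>)\<^sup>2)"
    by (simp add: norm_power norm_divide power_divide frac_le)
  show "1 - \<i> * complex_of_real \<epsilon> * \<zeta> \<noteq> 0"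
  proof
    assume "1 - \<i> * complex_of_real \<epsilon> * \<zeta> = 0"
    with * pos show False by simp
  qed
qed

text \<open>Provides one dominating function for all lines whose base point moves by at most 1; the
  constant comes from (a + b)^2 \<le> 2 a^2 + 2 b^2.\<close>

lemma inverse_quadratic_shift_le:
  fixes \<epsilon> x x0 t :: real
  assumes "\<bar>x - x0\<bar> \<le> 1"
  shows "1 / (1 + (\<epsilon> * (t + x))\<^sup>2) \<le> (2 + 2 * \<epsilon>\<^sup>2) * (1 / (1 + (\<epsilon> * (t + x0))\<^sup>2))"
proof -
  define a b where "a = \<epsilon> * (t + x)" and "b = \<epsilon> * (x0 - x)"
  have b: "b\<^sup>2 \<le> \<epsilon>\<^sup>2"
  proof -
    have "(x0 - x)\<^sup>2 \<le> 1" using assms by (simp add: abs_square_le_1 abs_minus_commute)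
    from mult_left_mono[OF this, of "\<epsilon>\<^sup>2"] show ?thesis by (simp add: b_def power_mult_distrib)
  qed
  have "(a + b)\<^sup>2 \<le> 2 * a\<^sup>2 + 2 * b\<^sup>2" using sum_squares_bound[of a b] by (simp add: power2_sum)
  also have "\<dots> \<le> 2 * a\<^sup>2 + 2 * \<epsilon>\<^sup>2" using b by simp
  finally have "(a + b)\<^sup>2 \<le> 2 * a\<^sup>2 + 2 * \<epsilon>\<^sup>2" .
  moreover have "0 \<le> \<epsilon>\<^sup>2 * a\<^sup>2" by simp
  moreover have "(2 + 2 * \<epsilon>\<^sup>2) * (1 + a\<^sup>2) = 2 + 2 * a\<^sup>2 + 2 * \<epsilon>\<^sup>2 + 2 * (\<epsilon>\<^sup>2 * a\<^sup>2)"
    by (simp add: algebra_simps)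
  ultimately have "1 + (a + b)\<^sup>2 \<le> (2 + 2 * \<epsilon>\<^sup>2) * (1 + a\<^sup>2)"
    by linarith
  moreover have "a + b = \<epsilon> * (t + x0)" by (simp add: a_def b_def algebra_simps)
  moreover have "1 + a\<^sup>2 > 0" "1 + (a + b)\<^sup>2 > 0" by (intro add_pos_nonneg; simp)+
  ultimately show ?thesis by (simp add: a_def[symmetric] divide_simps)
qed

text \<open>The integral along a horizontal line is a holomorphic function of the base point that is
  invariant under real translations, hence it is constant: this replaces a contour shift.\<close>

lemma integral_horizontal_line_shift:
  fixes \<phi> :: "complex \<Rightarrow> complex" and \<epsilon> \<tau> b c c' :: real
  assumes \<epsilon>: "\<epsilon> > 0" and hol: "\<phi> holomorphic_on {\<zeta>. Im \<zeta> > b}"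
    and bd: "\<And>\<delta>. \<delta> > 0 \<Longrightarrow> \<exists>C. \<forall>\<zeta>. Im \<zeta> \<ge> b + \<delta> \<longrightarrow> cmod (\<phi> \<zeta>) \<le> C * (1 / (1 + (\<epsilon> * Re \<zeta>)\<^sup>2))"
    and c: "b < c" "b < c'"
  defines "I \<equiv> \<lambda>c. LINT t|lborel. \<phi> (complex_of_real t + \<i> * complex_of_real c) * exp (- \<i> * complex_of_real \<tau> * (complex_of_real t + \<i> * complex_of_real c))"
  shows "I c = I c'"
proof -
  define S where "S = {\<zeta>. Im \<zeta> > b}"
  have S: "open S" "convex S" unfolding S_def by (simp_all add: open_halfspace_Im_gt convex_halfspace_Im_gt)
  define F where "F \<zeta> t = \<phi> (complex_of_real t + \<zeta>) * exp (- \<i> * complex_of_real \<tau> * (complex_of_real t + \<zeta>))" for \<zeta> t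
  have tS: "complex_of_real t + \<zeta> \<in> S \<longleftrightarrow> \<zeta> \<in> S" for t \<zeta> by (simp add: S_def)
  have F_hol: "(\<lambda>\<zeta>. F \<zeta> t) holomorphic_on S" for t
    unfolding F_def using tS
    by (intro holomorphic_intros holomorphic_on_compose_gen[OF _ hol, unfolded comp_def]) (auto simp: S_def)
  have F_meas: "F \<zeta> \<in> borel_measurable lborel" if "\<zeta> \<in> S" for \<zeta>
  proof -
    have "continuous_on UNIV (\<lambda>t. \<phi> (complex_of_real t + \<zeta>))"
      by (rule continuous_on_compose2[OF holomorphic_on_imp_continuous_on[OF hol]])
         (use tS that in \<open>auto intro!: continuous_intros simp: S_def\<close>)
    then show ?thesis unfolding F_def measurable_lborel2
      by (intro borel_measurable_continuous_onI continuous_intros)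
  qed
  have F_dom: "\<exists>r>0. \<exists>g. integrable lborel g \<and> (\<forall>\<zeta>\<in>ball \<zeta>0 r \<inter> S. \<forall>t\<in>space lborel. cmod (F \<zeta> t) \<le> g t)" if "\<zeta>0 \<in> S" for \<zeta>0
  proof -
    define \<delta> where "\<delta> = (Im \<zeta>0 - b) / 2"
    have \<delta>: "\<delta> > 0" using that by (simp add: \<delta>_def S_def)
    obtain C where C: "\<And>\<zeta>. Im \<zeta> \<ge> b + \<delta> \<Longrightarrow> cmod (\<phi> \<zeta>) \<le> C * (1 / (1 + (\<epsilon> * Re \<zeta>)\<^sup>2))" using bd[OF \<delta>] by blast
    define r where "r = min 1 \<delta>"
    define D where "D = \<bar>C\<bar> * (2 + 2 * \<epsilon>\<^sup>2) * exp (\<bar>\<tau>\<bar> * (\<bar>Im \<zeta>0\<bar> + 1))"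
    have le: "cmod (F \<zeta> t) \<le> D * (1 / (1 + (\<epsilon> * (t + Re \<zeta>0))\<^sup>2))" if \<zeta>: "\<zeta> \<in> ball \<zeta>0 r" for \<zeta> t
    proof -
      have d: "\<bar>Re \<zeta> - Re \<zeta>0\<bar> \<le> 1" "\<bar>Im \<zeta> - Im \<zeta>0\<bar> \<le> 1" "\<bar>Im \<zeta> - Im \<zeta>0\<bar> \<le> \<delta>"
        using \<zeta> abs_Re_le_cmod[of "\<zeta> - \<zeta>0"] abs_Im_le_cmod[of "\<zeta> - \<zeta>0"] by (auto simp: r_def dist_norm norm_minus_commute)
      have "Im \<zeta>0 = b + 2 * \<delta>" by (simp add: \<delta>_def field_simps)
      then have "Im (complex_of_real t + \<zeta>) \<ge> b + \<delta>" using d(3) by (simp add: abs_le_iff)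
      then have "cmod (\<phi> (complex_of_real t + \<zeta>)) \<le> C * (1 / (1 + (\<epsilon> * (t + Re \<zeta>))\<^sup>2))"
        using C[of "complex_of_real t + \<zeta>"] by simp
      also have "\<dots> \<le> \<bar>C\<bar> * (1 / (1 + (\<epsilon> * (t + Re \<zeta>))\<^sup>2))" by (intro mult_right_mono) auto
      also have "\<dots> \<le> \<bar>C\<bar> * ((2 + 2 * \<epsilon>\<^sup>2) * (1 / (1 + (\<epsilon> * (t + Re \<zeta>0))\<^sup>2)))"
        using d(1) by (intro mult_left_mono inverse_quadratic_shift_le) auto
      finally have 1: "cmod (\<phi> (complex_of_real t + \<zeta>)) \<le> \<bar>C\<bar> * ((2 + 2 * \<epsilon>\<^sup>2) * (1 / (1 + (\<epsilon> * (t + Re \<zeta>0))\<^sup>2)))" .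
      have "cmod (exp (- \<i> * complex_of_real \<tau> * (complex_of_real t + \<zeta>))) = exp (\<tau> * Im \<zeta>)" by simp
      also have "\<tau> * Im \<zeta> \<le> \<bar>\<tau>\<bar> * (\<bar>Im \<zeta>0\<bar> + 1)"
      proof -
        have "\<tau> * Im \<zeta> \<le> \<bar>\<tau>\<bar> * \<bar>Im \<zeta>\<bar>" by (metis abs_ge_self abs_mult)
        also have "\<dots> \<le> \<bar>\<tau>\<bar> * (\<bar>Im \<zeta>0\<bar> + 1)" using d(2) by (intro mult_left_mono) auto
        finally show ?thesis .
      qed
      finally have 2: "cmod (exp (- \<i> * complex_of_real \<tau> * (complex_of_real t + \<zeta>))) \<le> exp (\<bar>\<tau>\<bar> * (\<bar>Im \<zeta>0\<bar> + 1))" by simp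
      have "cmod (F \<zeta> t) \<le> (\<bar>C\<bar> * ((2 + 2 * \<epsilon>\<^sup>2) * (1 / (1 + (\<epsilon> * (t + Re \<zeta>0))\<^sup>2)))) * exp (\<bar>\<tau>\<bar> * (\<bar>Im \<zeta>0\<bar> + 1))"
        unfolding F_def norm_mult by (intro mult_mono 1 2) (auto intro!: mult_nonneg_nonneg)
      then show ?thesis by (simp add: D_def mult_ac)
    qed
    show ?thesis
    proof (rule exI[of _ r], intro conjI)
      show "r > 0" using \<delta> by (simp add: r_def)
      show "\<exists>g. integrable lborel g \<and> (\<forall>\<zeta>\<in>ball \<zeta>0 r \<inter> S. \<forall>t\<in>space lborel. cmod (F \<zeta> t) \<le> g t)"
        using le integrable_inverse_quadratic[OF \<epsilon>, of "Re \<zeta>0"]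
        by (intro exI[of _ "\<lambda>t. D * (1 / (1 + (\<epsilon> * (t + Re \<zeta>0))\<^sup>2))"] conjI integrable_mult_right) auto
    qed
  qed
  define \<Phi> where "\<Phi> \<zeta> = (LINT t|lborel. F \<zeta> t)" for \<zeta>
  have hol\<Phi>: "\<Phi> holomorphic_on S" unfolding \<Phi>_def
    by (rule holomorphic_on_integral[OF S(1) F_hol F_meas F_dom])
  have inv: "\<Phi> (\<zeta> + complex_of_real s) = \<Phi> \<zeta>" for \<zeta> s
  proof -
    have "\<Phi> \<zeta> = (LINT t|lborel. F \<zeta> (s + 1 * t))"
      unfolding \<Phi>_def by (subst lborel_integral_real_affine[where t=s and c=1]) auto
    also have "\<dots> = \<Phi> (\<zeta> + complex_of_real s)"
      unfolding \<Phi>_def F_def by (simp add: add_ac)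
    finally show ?thesis ..
  qed
  have "(\<Phi> has_field_derivative 0) (at \<zeta> within S)" if \<zeta>: "\<zeta> \<in> S" for \<zeta>
  proof -
    obtain D where D: "(\<Phi> has_field_derivative D) (at \<zeta>)"
      using holomorphic_derivI[OF hol\<Phi> S(1) \<zeta>] by blast
    \<comment> \<open>The derivative exists, so it can be computed along real increments, where the
      difference quotients are 0.\<close>
    have "((\<lambda>s. (\<Phi> (\<zeta> + s) - \<Phi> \<zeta>) / s) \<longlongrightarrow> D) (at 0)" using D by (simp add: DERIV_def)
    moreover have "filterlim (\<lambda>n. complex_of_real (1 / real (Suc n))) (at 0) sequentially"
    proof -
      have "(\<lambda>n. 1 / real (Suc n)) \<longlonglongrightarrow> 0" using LIMSEQ_inverse_real_of_nat by (simp add: inverse_eq_divide)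
      then have "(\<lambda>n. complex_of_real (1 / real (Suc n))) \<longlonglongrightarrow> complex_of_real 0" by (rule tendsto_of_real)
      moreover have "complex_of_real (1 / real (Suc n)) \<noteq> 0" for n by (simp only: of_real_eq_0_iff) simp
      ultimately show ?thesis by (intro filterlim_atI always_eventually allI) simp_all
    qed
    ultimately have "(\<lambda>n. (\<Phi> (\<zeta> + complex_of_real (1 / real (Suc n))) - \<Phi> \<zeta>) / complex_of_real (1 / real (Suc n))) \<longlonglongrightarrow> D"
      by (rule filterlim_compose)
    then have "D = 0" unfolding inv by (simp add: LIMSEQ_const_iff)
    then show ?thesis using D has_field_derivative_at_within by blast
  qed
  then obtain k where k: "\<And>\<zeta>. \<zeta> \<in> S \<Longrightarrow> \<Phi> \<zeta> = k"
    using has_field_derivative_zero_constant[OF S(2)] by blast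
  have "I x = \<Phi> (\<i> * complex_of_real x)" for x unfolding I_def \<Phi>_def F_def ..
  then show ?thesis using k[of "\<i> * complex_of_real c"] k[of "\<i> * complex_of_real c'"] c by (simp add: S_def)
qed

section \<open>Interior estimates for holomorphic extensions of Hardy functions\<close>

locale hardy_extension = continuous_weight +
  fixes H :: "complex \<times> complex \<Rightarrow> complex" and M :: ennreal
  assumes hol2: "holomorphic2_on H (Omega p)" and M: "M < \<infinity>"
    and le_M: "\<And>y. y > 0 \<Longrightarrow> (\<integral>\<^sup>+q. ennreal ((cmod (H (lift p y q)))\<^sup>2) \<partial>lborel) \<le> M"
begin

lemma open_Omega: "open (Omega p)"
proof -
  have "continuous_on UNIV (\<lambda>q::complex \<times> complex. p (fst q))" by (intro continuous_on_compose2[OF cont_p] continuous_intros) auto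
  then have "open {q::complex \<times> complex. p (fst q) < Im (snd q)}" by (intro open_Collect_less continuous_intros)
  then show ?thesis by (simp add: Omega_def case_prod_beta')
qed

lemma H_derivative:
  assumes "p z < Im \<zeta>"
  obtains a b where "(H has_derivative (\<lambda>(u, v). a * u + b * v)) (at (z, \<zeta>))"
proof -
  have "(z, \<zeta>) \<in> Omega p" using assms by (simp add: Omega_def)
  then show ?thesis using hol2 that open_Omega at_within_open unfolding holomorphic2_on_def by metis
qed

lemma H_continuous: "continuous_on (Omega p) H"
  using hol2 unfolding holomorphic2_on_def continuous_on_eq_continuous_within by (meson has_derivative_continuous)

lemma H_holomorphic_fst: "(\<lambda>z. H (z, \<zeta>)) holomorphic_on {z. p z < Im \<zeta>}"
  unfolding holomorphic_on_def
proof
  fix z assume "z \<in> {z. p z < Im \<zeta>}"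
  then obtain a b where ab: "(H has_derivative (\<lambda>(u, v). a * u + b * v)) (at (z, \<zeta>))" using H_derivative by blast
  have "((\<lambda>z. (z, \<zeta>)) has_derivative (\<lambda>u. (u, 0))) (at z within {z. p z < Im \<zeta>})"
    by (auto intro!: derivative_eq_intros)
  from has_derivative_compose[OF this, of H "\<lambda>(u, v). a * u + b * v", OF ab] show "(\<lambda>z. H (z, \<zeta>)) field_differentiable at z within {z. p z < Im \<zeta>}"
    unfolding field_differentiable_def has_field_derivative_def by (auto intro!: exI[of _ a] simp: mult_commute_abs)
qed

lemma H_holomorphic_snd: "(\<lambda>\<zeta>. H (z, \<zeta>)) holomorphic_on {\<zeta>. p z < Im \<zeta>}"
  unfolding holomorphic_on_def
proof
  fix \<zeta> assume "\<zeta> \<in> {\<zeta>. p z < Im \<zeta>}"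
  then obtain a b where ab: "(H has_derivative (\<lambda>(u, v). a * u + b * v)) (at (z, \<zeta>))" using H_derivative by blast
  have "((\<lambda>\<zeta>. (z, \<zeta>)) has_derivative (\<lambda>v. (0, v))) (at \<zeta> within {\<zeta>. p z < Im \<zeta>})"
    by (auto intro!: derivative_eq_intros)
  from has_derivative_compose[OF this, of H "\<lambda>(u, v). a * u + b * v", OF ab] show "(\<lambda>\<zeta>. H (z, \<zeta>)) field_differentiable at \<zeta> within {\<zeta>. p z < Im \<zeta>}"
    unfolding field_differentiable_def has_field_derivative_def by (auto intro!: exI[of _ b] simp: mult_commute_abs)
qed

text \<open>\<open>H\<close> is arbitrary off the domain; cutting it off there makes it Borel on the
  whole space, as Tonelli requires.\<close>

definition H0 :: "complex \<times> complex \<Rightarrow> complex" where "H0 q = indicator (Omega p) q *\<^sub>R H q"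

lemma H0_eq: "p z < Im \<zeta> \<Longrightarrow> H0 (z, \<zeta>) = H (z, \<zeta>)" by (simp add: H0_def Omega_def)

lemma H0_lift: "y > 0 \<Longrightarrow> H0 (lift p y q) = H (lift p y q)"
  by (cases q) (simp add: lift_def H0_eq)

lemma H0_measurable [measurable]: "H0 \<in> borel_measurable borel"
  unfolding H0_def[abs_def] using open_Omega
  by (intro borel_measurable_continuous_on_indicator H_continuous) auto

lemma lift_measurable [measurable (raw)]:
  assumes [measurable]: "y \<in> borel_measurable N" "q \<in> borel_measurable N"
  shows "(\<lambda>x. lift p (y x) (q x)) \<in> borel_measurable N"
  unfolding lift_def case_prod_beta' by (intro borel_measurable_Pair) measurable

lemma H_lift_measurable: "y > 0 \<Longrightarrow> (\<lambda>q. H (lift p y q)) \<in> borel_measurable borel"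
proof -
  assume y: "y > 0"
  have "(\<lambda>q. H0 (lift p y q)) \<in> borel_measurable borel" by measurable
  then show ?thesis using H0_lift[OF y] by simp
qed

lemma H_lift_L2: "y > 0 \<Longrightarrow> (\<lambda>q. H (lift p y q)) \<in> L2"
  by (rule L2_I[OF H_lift_measurable le_less_trans[OF le_M M]])

text \<open>The mean value estimate in z and then in \<zeta>, over a product of two small squares.
  In coordinates (v, a, y) with Im \<eta> = p(v) + y this product lies in a slab of translates, each
  of squared norm at most M. The bound does not deteriorate as \<zeta> moves sideways or upwards,
  which the later line integrals depend on.\<close>

lemma H_bound:
  assumes K: "compact K" and \<delta>: "\<delta> > 0"
  obtains C where "C \<ge> 0" "\<And>z \<zeta>. z \<in> K \<Longrightarrow> p z + \<delta> \<le> Im \<zeta> \<Longrightarrow> cmod (H (z, \<zeta>)) \<le> C"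
proof -
  obtain r where r: "r > 0" "\<And>z v. z \<in> K \<Longrightarrow> v \<in> square z r \<Longrightarrow> \<bar>p v - p z\<bar> \<le> \<delta> / 4"
    by (rule p_oscillation[OF K, of "\<delta> / 4"]) (use \<delta> in auto)
  \<comment> \<open>Within the squares p and Im \<zeta> vary by at most \<delta>/4 each, so the
    height over the boundary varies by at most \<delta>/2 and stays positive.\<close>
  define s where "s = min r (\<delta> / 4)"
  have s: "s > 0" "s \<le> \<delta> / 4" using r \<delta> by (auto simp: s_def)
  define c where "c = 8 / (pi * s\<^sup>2)"
  define m where "m = enn2real M"
  have mM: "M = ennreal m" "m \<ge> 0" using M by (auto simp: m_def)
  have "cmod (H (z, \<zeta>)) \<le> sqrt (c * c * (\<delta> * m))" if z: "z \<in> K" and \<zeta>: "p z + \<delta> \<le> Im \<zeta>" for z \<zeta>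
  proof -
    define Y where "Y = Im \<zeta> - p z"
    have osc: "\<bar>p v - p z\<bar> \<le> \<delta> / 4" if "v \<in> square z s" for v
    proof -
      have "v \<in> square z r" using that s_def by (auto simp: square_def in_cbox_complex_iff)
      then show ?thesis by (rule r(2)[OF z])
    qed
    have im: "\<bar>Im \<eta> - Im \<zeta>\<bar> \<le> \<delta> / 4" if "\<eta> \<in> square \<zeta> s" for \<eta>
    proof -
      have "\<bar>Im \<eta> - Im \<zeta>\<bar> \<le> s" using that by (auto simp: square_def in_cbox_complex_iff)
      then show ?thesis using s(2) by linarith
    qed
    have pos: "p v < Im \<eta>" if "v \<in> square z s" "\<eta> \<in> square \<zeta> s" for v \<eta>
      using osc[OF that(1)] im[OF that(2)] \<zeta> \<delta> by linarith
    have \<zeta>sq: "\<zeta> \<in> square \<zeta> s" using s by (auto simp: square_def in_cbox_complex_iff)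
    define I where "I y = (indicator {Y - \<delta> / 2..Y + \<delta> / 2} y :: ennreal)" for y
    have [measurable]: "I \<in> borel_measurable borel" unfolding I_def[abs_def] by measurable
    have [measurable]: "square z s \<in> sets borel" for z s by (simp add: square_def)
    have "ennreal ((cmod (H (z, \<zeta>)))\<^sup>2) \<le> ennreal c * (\<integral>\<^sup>+v. ennreal ((cmod (H (v, \<zeta>)))\<^sup>2) * indicator (square z s) v \<partial>lborel)"
      unfolding c_def by (rule norm_le_square_mean[OF s(1) holomorphic_on_subset[OF H_holomorphic_fst]]) (use pos \<zeta>sq in auto)
    also have "\<dots> \<le> ennreal c * (\<integral>\<^sup>+v. ennreal c * (\<integral>\<^sup>+\<eta>. ennreal ((cmod (H0 (v, \<eta>)))\<^sup>2) * (indicator (square \<zeta> s) \<eta> * indicator (square z s) v) \<partial>lborel) \<partial>lborel)"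
    proof (intro mult_left_mono nn_integral_mono)
      fix v
      show "ennreal ((cmod (H (v, \<zeta>)))\<^sup>2) * indicator (square z s) v \<le> ennreal c * (\<integral>\<^sup>+\<eta>. ennreal ((cmod (H0 (v, \<eta>)))\<^sup>2) * (indicator (square \<zeta> s) \<eta> * indicator (square z s) v) \<partial>lborel)"
      proof (cases "v \<in> square z s")
        case True
        have "ennreal ((cmod (H (v, \<zeta>)))\<^sup>2) \<le> ennreal c * (\<integral>\<^sup>+\<eta>. ennreal ((cmod (H (v, \<eta>)))\<^sup>2) * indicator (square \<zeta> s) \<eta> \<partial>lborel)"
          unfolding c_def by (rule norm_le_square_mean[OF s(1) holomorphic_on_subset[OF H_holomorphic_snd]]) (use pos True in auto)
        also have "(\<integral>\<^sup>+\<eta>. ennreal ((cmod (H (v, \<eta>)))\<^sup>2) * indicator (square \<zeta> s) \<eta> \<partial>lborel) = (\<integral>\<^sup>+\<eta>. ennreal ((cmod (H0 (v, \<eta>)))\<^sup>2) * (indicator (square \<zeta> s) \<eta> * indicator (square z s) v) \<partial>lborel)"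
          using True pos H0_eq by (intro nn_integral_cong) (auto split: split_indicator)
        finally show ?thesis using True by simp
      qed simp
    qed simp
    also have "\<dots> = ennreal (c * c) * (\<integral>\<^sup>+v. \<integral>\<^sup>+\<eta>. ennreal ((cmod (H0 (v, \<eta>)))\<^sup>2) * (indicator (square \<zeta> s) \<eta> * indicator (square z s) v) \<partial>lborel \<partial>lborel)"
      by (subst nn_integral_cmult, measurable) (simp add: mult.assoc[symmetric] ennreal_mult[symmetric] c_def)
    also have "\<dots> \<le> ennreal (c * c) * (\<integral>\<^sup>+v. \<integral>\<^sup>+a. \<integral>\<^sup>+y. ennreal ((cmod (H0 (lift p y (v, a))))\<^sup>2) * I y \<partial>lborel \<partial>lborel \<partial>lborel)"
    proof (intro mult_left_mono nn_integral_mono)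
      fix v
      have "(\<integral>\<^sup>+\<eta>. ennreal ((cmod (H0 (v, \<eta>)))\<^sup>2) * (indicator (square \<zeta> s) \<eta> * indicator (square z s) v) \<partial>lborel)
         = (\<integral>\<^sup>+a. \<integral>\<^sup>+b. ennreal ((cmod (H0 (v, Complex a b)))\<^sup>2) * (indicator (square \<zeta> s) (Complex a b) * indicator (square z s) v) \<partial>lborel \<partial>lborel)"
        by (rule nn_integral_complex) measurable
      also have "\<dots> \<le> (\<integral>\<^sup>+a. \<integral>\<^sup>+y. ennreal ((cmod (H0 (lift p y (v, a))))\<^sup>2) * I y \<partial>lborel \<partial>lborel)"
      proof (rule nn_integral_mono)
        fix a
        have m: "(\<lambda>\<eta>. ennreal ((cmod (H0 (v, \<eta>)))\<^sup>2) * (indicator (square \<zeta> s) \<eta> * indicator (square z s) v)) \<in> borel_measurable borel"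
          by measurable
        have Cm: "(\<lambda>b. Complex a b) \<in> borel_measurable borel"
          unfolding Complex_eq by (intro borel_measurable_continuous_onI continuous_intros)
        \<comment> \<open>Substituting b = p(v) + y replaces the imaginary part by the height above
          the boundary.\<close>
        have "(\<integral>\<^sup>+b. ennreal ((cmod (H0 (v, Complex a b)))\<^sup>2) * (indicator (square \<zeta> s) (Complex a b) * indicator (square z s) v) \<partial>lborel)
          = ennreal \<bar>1\<bar> * (\<integral>\<^sup>+y. ennreal ((cmod (H0 (v, Complex a (p v + 1 * y))))\<^sup>2) * (indicator (square \<zeta> s) (Complex a (p v + 1 * y)) * indicator (square z s) v) \<partial>lborel)"
          by (rule nn_integral_real_affine[where f="\<lambda>b. ennreal ((cmod (H0 (v, Complex a b)))\<^sup>2) * (indicator (square \<zeta> s) (Complex a b) * indicator (square z s) v)"])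
             (use measurable_compose[OF Cm m] in simp_all)
        also have "\<dots> \<le> (\<integral>\<^sup>+y. ennreal ((cmod (H0 (lift p y (v, a))))\<^sup>2) * I y \<partial>lborel)"
        proof -
          have lp: "lift p y (v, a) = (v, Complex a (p v + 1 * y))" for y
            by (simp add: lift_def Complex_eq algebra_simps)
          have "indicator (square \<zeta> s) (Complex a (p v + 1 * y)) * indicator (square z s) v \<le> I y" for y
          proof (cases "Complex a (p v + 1 * y) \<in> square \<zeta> s \<and> v \<in> square z s")
            case True
            then have "\<bar>p v + y - Im \<zeta>\<bar> \<le> \<delta> / 4" "\<bar>p v - p z\<bar> \<le> \<delta> / 4" using im[of "Complex a (p v + 1 * y)"] osc by auto
            then have "y \<in> {Y - \<delta> / 2..Y + \<delta> / 2}" unfolding atLeastAtMost_iff Y_def by linarith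
            then show ?thesis using True by (simp add: I_def)
          qed auto
          then show ?thesis unfolding lp by (auto intro!: nn_integral_mono mult_left_mono)
        qed
        finally show "(\<integral>\<^sup>+b. ennreal ((cmod (H0 (v, Complex a b)))\<^sup>2) * (indicator (square \<zeta> s) (Complex a b) * indicator (square z s) v) \<partial>lborel)
           \<le> (\<integral>\<^sup>+y. ennreal ((cmod (H0 (lift p y (v, a))))\<^sup>2) * I y \<partial>lborel)" .
      qed
      finally show "(\<integral>\<^sup>+\<eta>. ennreal ((cmod (H0 (v, \<eta>)))\<^sup>2) * (indicator (square \<zeta> s) \<eta> * indicator (square z s) v) \<partial>lborel)
        \<le> (\<integral>\<^sup>+a. \<integral>\<^sup>+y. ennreal ((cmod (H0 (lift p y (v, a))))\<^sup>2) * I y \<partial>lborel \<partial>lborel)" .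
    qed simp
    also have "(\<integral>\<^sup>+v. \<integral>\<^sup>+a. \<integral>\<^sup>+y. ennreal ((cmod (H0 (lift p y (v, a))))\<^sup>2) * I y \<partial>lborel \<partial>lborel \<partial>lborel)
        = (\<integral>\<^sup>+q. \<integral>\<^sup>+y. ennreal ((cmod (H0 (lift p y q)))\<^sup>2) * I y \<partial>lborel \<partial>lborel)"
      by (rule nn_integral_lborel_pair[symmetric]) measurable
    also have "\<dots> = (\<integral>\<^sup>+y. \<integral>\<^sup>+q. ennreal ((cmod (H0 (lift p y q)))\<^sup>2) * I y \<partial>lborel \<partial>lborel)"
      by (rule lborel_pair.Fubini') measurable
    also have "\<dots> \<le> (\<integral>\<^sup>+y. M * I y \<partial>lborel)"
    proof (rule nn_integral_mono)
      fix y
      show "(\<integral>\<^sup>+q. ennreal ((cmod (H0 (lift p y q)))\<^sup>2) * I y \<partial>lborel) \<le> M * I y"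
      proof (cases "y \<in> {Y - \<delta> / 2..Y + \<delta> / 2}")
        case True
        then have "y > 0" using \<zeta> \<delta> by (auto simp: Y_def)
        then show ?thesis using le_M[of y] True by (simp add: I_def H0_lift)
      qed (simp add: I_def)
    qed
    also have "\<dots> = M * ennreal \<delta>"
      using \<delta> unfolding I_def by (subst nn_integral_cmult_indicator) auto
    finally have "ennreal ((cmod (H (z, \<zeta>)))\<^sup>2) \<le> ennreal (c * c) * (M * ennreal \<delta>)" by (simp add: mult_left_mono)
    also have "\<dots> = ennreal (c * c * (\<delta> * m))"
      unfolding mM(1) using \<delta> mM(2) by (simp add: ennreal_mult[symmetric] mult_ac c_def)
    finally have "(cmod (H (z, \<zeta>)))\<^sup>2 \<le> c * c * (\<delta> * m)"
      using \<delta> mM(2) by (subst (asm) ennreal_le_iff) (auto intro!: mult_nonneg_nonneg)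
    then show ?thesis by (rule real_le_rsqrt)
  qed
  moreover have "0 \<le> sqrt (c * c * (\<delta> * m))" using \<delta> mM(2) by simp
  ultimately show ?thesis using that by blast
qed

end

section \<open>Orthogonality to the Hardy space\<close>

locale regularised = hardy_extension +
  fixes \<epsilon> y :: real
  assumes \<epsilon>: "\<epsilon> > 0" and y: "y > 0"
begin

definition G :: "complex \<times> complex \<Rightarrow> complex" where
  "G q = H q * (1 / (1 - \<i> * complex_of_real \<epsilon> * snd q))\<^sup>2"

text \<open>Regulariser and Hardy function are evaluated at the same lifted point, so this is the
  trace of the single holomorphic function \<open>G\<close>.\<close>

definition k :: "complex \<times> real \<Rightarrow> complex" where "k q = G (lift p y q)"

lemma G_bound:
  assumes "compact K" "\<delta> > 0"
  obtains C where "C \<ge> 0" "\<And>z \<zeta>. z \<in> K \<Longrightarrow> p z + \<delta> \<le> Im \<zeta> \<Longrightarrow> cmod (G (z, \<zeta>)) \<le> C * (1 / (1 + (\<epsilon> * Re \<zeta>)\<^sup>2))"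
proof -
  obtain C where C: "C \<ge> 0" "\<And>z \<zeta>. z \<in> K \<Longrightarrow> p z + \<delta> \<le> Im \<zeta> \<Longrightarrow> cmod (H (z, \<zeta>)) \<le> C"
    by (rule H_bound[OF assms]) blast
  have "cmod (G (z, \<zeta>)) \<le> C * (1 / (1 + (\<epsilon> * Re \<zeta>)\<^sup>2))" if "z \<in> K" "p z + \<delta> \<le> Im \<zeta>" for z \<zeta>
  proof -
    have "Im \<zeta> \<ge> 0" using that(2) assms(2) p_nonneg[of z] by linarith
    then show ?thesis unfolding G_def norm_mult snd_conv
      by (intro mult_mono C that norm_regulariser_le \<epsilon>) (use C in auto)
  qed
  then show ?thesis using that C(1) by blast
qed

lemma G_holomorphic_fst:
  assumes "\<And>z. z \<in> S \<Longrightarrow> p z < Im \<zeta>"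
  shows "(\<lambda>z. G (z, \<zeta>)) holomorphic_on S"
  unfolding G_def snd_conv by (intro holomorphic_intros holomorphic_on_subset[OF H_holomorphic_fst]) (use assms in auto)

lemma G_holomorphic_snd: "(\<lambda>\<zeta>. G (z, \<zeta>)) holomorphic_on {\<zeta>. p z < Im \<zeta>}"
proof -
  have "1 - \<i> * complex_of_real \<epsilon> * \<zeta> \<noteq> 0" if "p z < Im \<zeta>" for \<zeta>
    using p_nonneg[of z] that by (intro norm_regulariser_le[OF \<epsilon>]) simp
  then show ?thesis unfolding G_def snd_conv by (intro holomorphic_intros H_holomorphic_snd) auto
qed

lemma lift_eq: "lift p y (z, t) = (z, complex_of_real t + \<i> * complex_of_real (p z + y))"
  by (simp add: lift_def algebra_simps)

lemma norm_k_le: "cmod (k q) \<le> cmod (H (lift p y q))"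
proof -
  obtain z t where q: "q = (z, t)" by force
  have "Im (snd (lift p y q)) \<ge> 0" using p_nonneg[of z] y by (simp add: q lift_eq)
  then have "cmod ((1 / (1 - \<i> * complex_of_real \<epsilon> * snd (lift p y q)))\<^sup>2) \<le> 1 / (1 + (\<epsilon> * Re (snd (lift p y q)))\<^sup>2)"
    by (rule norm_regulariser_le[OF \<epsilon>])
  also have "\<dots> \<le> 1" by (simp add: divide_le_eq_1 add_pos_nonneg)
  finally show ?thesis unfolding k_def G_def norm_mult by (intro mult_left_le) auto
qed

lemma k_measurable: "k \<in> borel_measurable borel"
proof -
  have "(\<lambda>q. H (lift p y q) * (1 / (1 - \<i> * complex_of_real \<epsilon> * (complex_of_real (snd q) + \<i> * complex_of_real (p (fst q) + y))))\<^sup>2) \<in> borel_measurable borel"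
    by (intro borel_measurable_times H_lift_measurable y) measurable
  also have "(\<lambda>q. H (lift p y q) * (1 / (1 - \<i> * complex_of_real \<epsilon> * (complex_of_real (snd q) + \<i> * complex_of_real (p (fst q) + y))))\<^sup>2) = k"
    by (auto simp: k_def G_def lift_eq fun_eq_iff)
  finally show ?thesis .
qed

lemma k_L2: "k \<in> L2"
proof (rule L2_I[OF k_measurable])
  have "(\<integral>\<^sup>+q. ennreal ((cmod (k q))\<^sup>2) \<partial>lborel) \<le> (\<integral>\<^sup>+q. ennreal ((cmod (H (lift p y q)))\<^sup>2) \<partial>lborel)"
    by (intro nn_integral_mono ennreal_leI power_mono norm_k_le) simp
  then show "(\<integral>\<^sup>+q. ennreal ((cmod (k q))\<^sup>2) \<partial>lborel) < \<infinity>" using L2_finite[OF H_lift_L2[OF y]] by simp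
qed

lemma G_line_continuous:
  assumes "p z < c"
  shows "continuous_on UNIV (\<lambda>t. G (z, complex_of_real t + \<i> * complex_of_real c))"
  by (rule continuous_on_compose2[OF holomorphic_on_imp_continuous_on[OF G_holomorphic_snd]])
     (use assms in \<open>auto intro!: continuous_intros\<close>)

lemma k_slice_continuous: "continuous_on UNIV (\<lambda>t. k (z, t))"
  using G_line_continuous[of z "p z + y"] y by (simp add: k_def lift_eq)

lemma k_slice_bound:
  obtains C where "C \<ge> 0" "\<And>t. cmod (k (z, t)) \<le> C * (1 / (1 + (\<epsilon> * t)\<^sup>2))"
proof -
  obtain C where C: "C \<ge> 0" "\<And>z' \<zeta>. z' \<in> {z} \<Longrightarrow> p z' + y \<le> Im \<zeta> \<Longrightarrow> cmod (G (z', \<zeta>)) \<le> C * (1 / (1 + (\<epsilon> * Re \<zeta>)\<^sup>2))"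
    by (rule G_bound[of "{z}" y]) (use y in auto)
  have "cmod (k (z, t)) \<le> C * (1 / (1 + (\<epsilon> * t)\<^sup>2))" for t
    unfolding k_def lift_eq using C(2)[of z "complex_of_real t + \<i> * complex_of_real (p z + y)"] by simp
  then show ?thesis using that C(1) by blast
qed

lemma k_slice: "integrable lborel (\<lambda>t. k (z, t))"
proof -
  obtain C where C: "C \<ge> 0" "\<And>t. cmod (k (z, t)) \<le> C * (1 / (1 + (\<epsilon> * t)\<^sup>2))" by (rule k_slice_bound) blast
  show ?thesis
  proof (rule Bochner_Integration.integrable_bound)
    show "integrable lborel (\<lambda>t. C * (1 / (1 + (\<epsilon> * t)\<^sup>2)))"
      using integrable_inverse_quadratic[OF \<epsilon>, of 0] by (intro integrable_mult_right) simp
    show "(\<lambda>t. k (z, t)) \<in> borel_measurable lborel"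
      using borel_measurable_continuous_onI[OF k_slice_continuous] by simp
    show "AE t in lborel. norm (k (z, t)) \<le> norm (C * (1 / (1 + (\<epsilon> * t)\<^sup>2)))"
      by (rule AE_I2, rule order_trans[OF C(2)], unfold real_norm_def, rule abs_ge_self)
  qed
qed

text \<open>The kernel exp (- i \<tau> \<zeta>) is holomorphic in \<zeta>, which makes the integral
  independent of the height c; it is exp (\<tau> c) times the ordinary transform along the
  line.\<close>

definition A :: "real \<Rightarrow> complex \<Rightarrow> real \<Rightarrow> complex" where
  "A \<tau> z c = (LINT t|lborel. G (z, complex_of_real t + \<i> * complex_of_real c) * exp (- \<i> * complex_of_real \<tau> * (complex_of_real t + \<i> * complex_of_real c)))"

lemma A_shift:
  assumes "p z < c" "p z < c'"
  shows "A \<tau> z c = A \<tau> z c'"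
  unfolding A_def
proof (rule integral_horizontal_line_shift[OF \<epsilon> G_holomorphic_snd _ assms])
  fix \<delta> :: real assume "\<delta> > 0"
  then show "\<exists>C. \<forall>\<zeta>. Im \<zeta> \<ge> p z + \<delta> \<longrightarrow> cmod (G (z, \<zeta>)) \<le> C * (1 / (1 + (\<epsilon> * Re \<zeta>)\<^sup>2))"
    by (rule G_bound[of "{z}" \<delta>, rotated]) auto
qed

text \<open>The factor exp (\<tau> c) is the only dependence of the bound on the height. Letting c
  grow will settle \<tau> < 0, and lowering c gains decay for \<tau> > 0.\<close>

lemma A_bound:
  assumes "compact K" "\<delta> > 0"
  obtains C where "C \<ge> 0" "\<And>\<tau> z c. z \<in> K \<Longrightarrow> p z + \<delta> \<le> c \<Longrightarrow> cmod (A \<tau> z c) \<le> C * exp (\<tau> * c)"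
proof -
  obtain C where C: "C \<ge> 0" "\<And>z \<zeta>. z \<in> K \<Longrightarrow> p z + \<delta> \<le> Im \<zeta> \<Longrightarrow> cmod (G (z, \<zeta>)) \<le> C * (1 / (1 + (\<epsilon> * Re \<zeta>)\<^sup>2))"
    by (rule G_bound[OF assms]) blast
  define Q where "Q = (LINT t|lborel. 1 / (1 + (\<epsilon> * t)\<^sup>2))"
  have Qint: "integrable lborel (\<lambda>t. 1 / (1 + (\<epsilon> * t)\<^sup>2))" using integrable_inverse_quadratic[OF \<epsilon>, of 0] by simp
  have Q: "Q \<ge> 0" unfolding Q_def by (intro Bochner_Integration.integral_nonneg) simp
  have "cmod (A \<tau> z c) \<le> C * Q * exp (\<tau> * c)" if z: "z \<in> K" "p z + \<delta> \<le> c" for \<tau> z c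
  proof -
    have le: "cmod (G (z, complex_of_real t + \<i> * complex_of_real c) * exp (- \<i> * complex_of_real \<tau> * (complex_of_real t + \<i> * complex_of_real c))) \<le> C * exp (\<tau> * c) * (1 / (1 + (\<epsilon> * t)\<^sup>2))" for t
    proof -
      have "cmod (G (z, complex_of_real t + \<i> * complex_of_real c)) * exp (\<tau> * c) \<le> C * (1 / (1 + (\<epsilon> * t)\<^sup>2)) * exp (\<tau> * c)"
        using C(2)[OF z(1), of "complex_of_real t + \<i> * complex_of_real c"] z(2) by (intro mult_right_mono) auto
      then show ?thesis by (simp add: norm_mult mult_ac)
    qed
    have "cmod (A \<tau> z c) \<le> (LINT t|lborel. C * exp (\<tau> * c) * (1 / (1 + (\<epsilon> * t)\<^sup>2)))"
      unfolding A_def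
    proof (rule Bochner_Integration.integral_norm_bound_integral)
      show "integrable lborel (\<lambda>t. C * exp (\<tau> * c) * (1 / (1 + (\<epsilon> * t)\<^sup>2)))" by (intro integrable_mult_right Qint)
      then show "integrable lborel (\<lambda>t. G (z, complex_of_real t + \<i> * complex_of_real c) * exp (- \<i> * complex_of_real \<tau> * (complex_of_real t + \<i> * complex_of_real c)))"
      proof (rule Bochner_Integration.integrable_bound)
        have "p z < c" using z assms(2) by simp
        then show "(\<lambda>t. G (z, complex_of_real t + \<i> * complex_of_real c) * exp (- \<i> * complex_of_real \<tau> * (complex_of_real t + \<i> * complex_of_real c))) \<in> borel_measurable lborel"
          unfolding measurable_lborel2 by (intro borel_measurable_continuous_onI continuous_intros G_line_continuous)
      qed (rule AE_I2, rule order_trans[OF le], unfold real_norm_def, rule abs_ge_self)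
    qed (rule le)
    also have "\<dots> = C * exp (\<tau> * c) * Q" unfolding Q_def by (rule integral_mult_right_zero)
    finally show ?thesis by (simp add: mult_ac)
  qed
  moreover have "C * Q \<ge> 0" using C Q by simp
  ultimately show ?thesis using that by blast
qed

text \<open>The common value of \<open>A\<close> on all heights above p z. The height may thus be
  chosen afresh for each purpose: far up, close to the boundary, or constant in z.\<close>

definition a :: "real \<Rightarrow> complex \<Rightarrow> complex" where "a \<tau> z = A \<tau> z (p z + y)"

lemma a_eq: "p z < c \<Longrightarrow> a \<tau> z = A \<tau> z c"
  unfolding a_def using y by (intro A_shift) auto

lemma tfourier_k: "tfourier k \<tau> z = a \<tau> z * complex_of_real (exp (- \<tau> * (p z + y)))"
proof -
  have e: "exp (- \<i> * complex_of_real \<tau> * (complex_of_real t + \<i> * complex_of_real (p z + y))) * complex_of_real (exp (- \<tau> * (p z + y))) = cis (- (\<tau> * t))" for t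
  proof -
    have "- \<i> * complex_of_real \<tau> * (complex_of_real t + \<i> * complex_of_real (p z + y)) + complex_of_real (- \<tau> * (p z + y)) = \<i> * complex_of_real (- (\<tau> * t))"
      by (simp add: algebra_simps)
    then show ?thesis unfolding exp_of_real[symmetric] exp_add[symmetric] cis_conv_exp by simp
  qed
  have "a \<tau> z * complex_of_real (exp (- \<tau> * (p z + y))) = (LINT t|lborel. G (z, complex_of_real t + \<i> * complex_of_real (p z + y)) * (exp (- \<i> * complex_of_real \<tau> * (complex_of_real t + \<i> * complex_of_real (p z + y))) * complex_of_real (exp (- \<tau> * (p z + y)))))"
    unfolding a_def A_def integral_mult_left_zero[symmetric] by (simp only: mult.assoc)
  also have "\<dots> = tfourier k \<tau> z"
    unfolding e tfourier_def fourier_def k_def lift_eq ..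
  finally show ?thesis ..
qed

text \<open>The line is pushed up to infinity, where exp (\<tau> c) tends to 0.\<close>

lemma a_negative:
  assumes "\<tau> < 0"
  shows "a \<tau> z = 0"
proof -
  obtain C where C: "C \<ge> 0" "\<And>\<tau> z' c. z' \<in> {z} \<Longrightarrow> p z' + 1 \<le> c \<Longrightarrow> cmod (A \<tau> z' c) \<le> C * exp (\<tau> * c)"
    by (rule A_bound[of "{z}" 1]) auto
  have "((\<lambda>c. C * exp (\<tau> * c)) \<longlongrightarrow> C * 0) at_top"
  proof (rule tendsto_mult_left)
    have "filterlim (\<lambda>c. \<tau> * c) at_bot at_top"
      using filterlim_tendsto_neg_mult_at_bot[OF tendsto_const assms filterlim_ident] .
    then show "((\<lambda>c. exp (\<tau> * c)) \<longlongrightarrow> 0) at_top" by (rule filterlim_compose[OF exp_at_bot])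
  qed
  moreover have "\<forall>\<^sub>F c in at_top. cmod (a \<tau> z) \<le> C * exp (\<tau> * c)"
    using eventually_ge_at_top[of "p z + 1"]
  proof eventually_elim
    case (elim c)
    then show ?case using C(2)[of z c \<tau>] a_eq[of z c \<tau>] by simp
  qed
  ultimately have "cmod (a \<tau> z) \<le> C * 0" by (intro tendsto_lowerbound) auto
  then show ?thesis by simp
qed

text \<open>Computing \<open>a\<close> at height p z + y/2 while the trace sits at height p z + y
  leaves the decay exp (- \<tau> y / 2).\<close>

lemma tfourier_k_bound:
  obtains C where "C \<ge> 0" "\<And>\<tau>. \<tau> > 0 \<Longrightarrow> cmod (tfourier k \<tau> z) \<le> C * exp (- (y / 2) * \<tau>)"
proof -
  obtain C where C: "C \<ge> 0" "\<And>\<tau> z' c. z' \<in> {z} \<Longrightarrow> p z' + y / 2 \<le> c \<Longrightarrow> cmod (A \<tau> z' c) \<le> C * exp (\<tau> * c)"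
    by (rule A_bound[of "{z}" "y / 2"]) (use y in auto)
  have "cmod (tfourier k \<tau> z) \<le> C * exp (- (y / 2) * \<tau>)" for \<tau>
  proof -
    have "cmod (a \<tau> z) \<le> C * exp (\<tau> * (p z + y / 2))"
      using C(2)[of z "p z + y / 2" \<tau>] a_eq[of z "p z + y / 2" \<tau>] y by simp
    then have "cmod (tfourier k \<tau> z) \<le> C * exp (\<tau> * (p z + y / 2)) * exp (- \<tau> * (p z + y))"
      unfolding tfourier_k norm_mult by (intro mult_mono) (use C in auto)
    also have "\<dots> = C * exp (- (y / 2) * \<tau>)"
      unfolding mult.assoc exp_add[symmetric] by (simp add: algebra_simps)
    finally show ?thesis .
  qed
  then show ?thesis using that C(1) by blast
qed

lemma tfourier_k_measurable: "(\<lambda>\<tau>. tfourier k \<tau> z) \<in> borel_measurable borel"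
  using k_measurable by measurable

lemma tfourier_k_integrable: "integrable lborel (\<lambda>\<tau>. tfourier k \<tau> z)"
proof -
  obtain C where C: "C \<ge> 0" "\<And>\<tau>. \<tau> > 0 \<Longrightarrow> cmod (tfourier k \<tau> z) \<le> C * exp (- (y / 2) * \<tau>)"
    by (rule tfourier_k_bound) blast
  show ?thesis
  proof (rule Bochner_Integration.integrable_bound)
    show "integrable lborel (\<lambda>\<tau>. C * (indicator {0<..} \<tau> * exp (- (y / 2) * \<tau>)))"
      using y by (intro integrable_mult_right integrable_exp_decay) simp
    \<comment> \<open>The bound covers \<tau> > 0 and vanishing covers \<tau> < 0; the remaining
      point is a null set.\<close>
    have "AE \<tau> in lborel. \<tau> \<noteq> (0::real)" by (rule AE_lborel_singleton)
    then show "AE \<tau> in lborel. norm (tfourier k \<tau> z) \<le> norm (C * (indicator {0<..} \<tau> * exp (- (y / 2) * \<tau>)))"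
    proof eventually_elim
      case (elim \<tau>)
      then consider "\<tau> > 0" | "\<tau> < 0" by linarith
      then show ?case
      proof cases
        case 1
        then show ?thesis using C(2)[OF 1] C(1) by simp
      next
        case 2
        then show ?thesis by (simp add: tfourier_k a_negative)
      qed
    qed
  qed (use tfourier_k_measurable in simp)
qed

lemma k_inversion: "k (z, t) = 1 / (2 * pi) * (LINT \<tau>|lborel. tfourier k \<tau> z * cis (\<tau> * t))"
proof -
  obtain C where C: "C \<ge> 0" "\<And>t. cmod (k (z, t)) \<le> C * (1 / (1 + (\<epsilon> * t)\<^sup>2))" by (rule k_slice_bound) blast
  have "cmod (k (z, t)) \<le> C" for t
  proof -
    have "1 / (1 + (\<epsilon> * t)\<^sup>2) \<le> 1" by (simp add: divide_le_eq_1 add_pos_nonneg)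
    from mult_left_mono[OF this C(1)] C(2)[of t] show ?thesis by simp
  qed
  from fourier_inversion[OF k_slice_continuous this k_slice, of t] tfourier_k_integrable
  show ?thesis by (simp add: tfourier_def[abs_def])
qed

text \<open>The height p z + y of the trace is not holomorphic in z. Near z0 it is exchanged for the
  constant height p z0 + 2, which exceeds p by at least 1 on a small square, so that z enters only
  through \<open>G\<close>.\<close>

lemma a_holomorphic: "a \<tau> holomorphic_on UNIV"
  unfolding holomorphic_on_def
proof
  fix z0 :: complex
  obtain r where r: "r > 0" "\<And>z v. z \<in> {z0} \<Longrightarrow> v \<in> square z r \<Longrightarrow> \<bar>p v - p z\<bar> \<le> 1"
    by (rule p_oscillation[of "{z0}" 1]) auto
  define c where "c = p z0 + 2"
  have sq: "z \<in> square z0 r" if "z \<in> ball z0 r" for z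
    using that abs_Re_le_cmod[of "z - z0"] abs_Im_le_cmod[of "z - z0"]
    by (auto simp: square_def in_cbox_complex_iff dist_norm norm_minus_commute)
  have pc: "p z + 1 \<le> c" if "z \<in> square z0 r" for z using r(2)[of z0 z] that by (simp add: c_def abs_le_iff)
  obtain C where C: "C \<ge> 0" "\<And>z \<zeta>. z \<in> square z0 r \<Longrightarrow> p z + 1 \<le> Im \<zeta> \<Longrightarrow> cmod (G (z, \<zeta>)) \<le> C * (1 / (1 + (\<epsilon> * Re \<zeta>)\<^sup>2))"
    by (rule G_bound[of "square z0 r" 1]) (auto simp: square_def)
  have "(\<lambda>z. A \<tau> z c) holomorphic_on ball z0 r"
    unfolding A_def
  proof (rule holomorphic_on_integral[OF open_ball])
    fix t :: real
    show "(\<lambda>z. G (z, complex_of_real t + \<i> * complex_of_real c) * exp (- \<i> * complex_of_real \<tau> * (complex_of_real t + \<i> * complex_of_real c))) holomorphic_on ball z0 r"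
    proof (intro holomorphic_intros G_holomorphic_fst)
      fix z assume "z \<in> ball z0 r"
      then have "p z + 1 \<le> c" by (rule pc[OF sq])
      then show "p z < Im (complex_of_real t + \<i> * complex_of_real c)" by simp
    qed
  next
    fix z assume zb: "z \<in> ball z0 r"
    have "p z < c" using pc[OF sq[OF zb]] by simp
    then show "(\<lambda>t. G (z, complex_of_real t + \<i> * complex_of_real c) * exp (- \<i> * complex_of_real \<tau> * (complex_of_real t + \<i> * complex_of_real c))) \<in> borel_measurable lborel"
      unfolding measurable_lborel2 by (intro borel_measurable_continuous_onI continuous_intros G_line_continuous)
  next
    fix z1
    have le: "cmod (G (z, complex_of_real t + \<i> * complex_of_real c) * exp (- \<i> * complex_of_real \<tau> * (complex_of_real t + \<i> * complex_of_real c))) \<le> C * exp (\<tau> * c) * (1 / (1 + (\<epsilon> * t)\<^sup>2))"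
      if "z \<in> ball z0 r" for z t
    proof -
      have "cmod (G (z, complex_of_real t + \<i> * complex_of_real c)) * exp (\<tau> * c) \<le> C * (1 / (1 + (\<epsilon> * t)\<^sup>2)) * exp (\<tau> * c)"
        using C(2)[OF sq[OF that], of "complex_of_real t + \<i> * complex_of_real c"] pc[OF sq[OF that]] by (intro mult_right_mono) auto
      then show ?thesis by (simp add: norm_mult mult_ac)
    qed
    have int: "integrable lborel (\<lambda>t. C * exp (\<tau> * c) * (1 / (1 + (\<epsilon> * t)\<^sup>2)))"
      using integrable_inverse_quadratic[OF \<epsilon>, of 0] by (intro integrable_mult_right) simp
    show "\<exists>r'>0. \<exists>g. integrable lborel g \<and> (\<forall>z\<in>ball z1 r' \<inter> ball z0 r. \<forall>t\<in>space lborel. cmod (G (z, complex_of_real t + \<i> * complex_of_real c) * exp (- \<i> * complex_of_real \<tau> * (complex_of_real t + \<i> * complex_of_real c))) \<le> g t)"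
      by (rule exI[of _ "1::real"], rule conjI, simp, rule exI, rule conjI, rule int) (use le in blast)
  qed
  moreover have "a \<tau> z = A \<tau> z c" if "z \<in> ball z0 r" for z
    using pc[OF sq[OF that]] by (intro a_eq) simp
  ultimately have "a \<tau> holomorphic_on ball z0 r" by (metis holomorphic_transform)
  then show "a \<tau> field_differentiable at z0 within UNIV"
    using r(1) holomorphic_on_imp_differentiable_at[of "a \<tau>" "ball z0 r" z0] by simp
qed

text \<open>The squared weighted norm of \<open>a \<tau>\<close> is exp (2 \<tau> y) times the
  squared norm of the transform of \<open>k\<close>, and the latter has a finite integral over
  \<tau>. Hence membership is obtained for almost every \<tau> only, and the comparison of pairings
  inherits this.\<close>

lemma AE_a_WE: "AE \<tau> in lborel. \<tau> > 0 \<longrightarrow> a \<tau> \<in> WE \<tau>"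
proof -
  note [measurable] = k_measurable
  define N where "N \<tau> = (\<integral>\<^sup>+z. ennreal ((cmod (tfourier k \<tau> z))\<^sup>2) \<partial>lborel)" for \<tau>
  have "(\<integral>\<^sup>+\<tau>. N \<tau> \<partial>lborel) \<le> ennreal (2 * pi) * (\<integral>\<^sup>+q. ennreal ((cmod (k q))\<^sup>2) \<partial>lborel)"
    unfolding N_def by (rule nn_integral_tfourier_le[OF k_measurable k_slice])
  also have "\<dots> < \<infinity>" using L2_finite[OF k_L2] by (simp add: ennreal_mult_less_top)
  finally have "AE \<tau> in lborel. N \<tau> \<noteq> \<infinity>" unfolding N_def by (intro nn_integral_PInf_AE) auto
  then show ?thesis
  proof eventually_elim
    case (elim \<tau>)
    define B where "B = exp (2 * \<tau> * y) * enn2real (N \<tau>)"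
    have "(cmod (a \<tau> z))\<^sup>2 * exp (- 2 * \<tau> * p z) = exp (2 * \<tau> * y) * (cmod (tfourier k \<tau> z))\<^sup>2" for z
    proof -
      have "exp (2 * \<tau> * y) * (exp (- \<tau> * (p z + y)) * exp (- \<tau> * (p z + y))) = exp (- 2 * \<tau> * p z)"
        unfolding exp_add[symmetric] by (simp add: algebra_simps)
      then show ?thesis unfolding tfourier_k norm_mult power_mult_distrib by (simp add: power2_eq_square mult_ac)
    qed
    then have "(\<integral>\<^sup>+z. ennreal ((cmod (a \<tau> z))\<^sup>2 * exp (- 2 * \<tau> * p z)) \<partial>lborel) = ennreal (exp (2 * \<tau> * y)) * N \<tau>"
      unfolding N_def by (subst nn_integral_cmult[symmetric]) (auto simp: ennreal_mult)
    also have "\<dots> = ennreal B" using elim by (simp add: B_def ennreal_mult ennreal_enn2real less_top)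
    finally show ?case using WE_I(1)[OF a_holomorphic, of \<tau> \<tau> B] by (simp add: B_def)
  qed
qed

end

locale orthogonality = szego_data p f + regularised p H M \<epsilon> y
  for p f H M \<epsilon> y
begin

text \<open>For \<tau> > 0 the transform of \<open>k\<close> is an entire function times
  exponentials, so the reproducing property lets the transform of f take the place of its
  projection. For \<tau> < 0 both sides vanish.\<close>

lemma pairing_k: "AE \<tau> in lborel. pairing k \<tau> = (LINT w|lborel. tfourier f \<tau> w * cnj (tfourier k \<tau> w))"
  using AE_a_WE AE_lborel_singleton[of "0::real"]
proof eventually_elim
  case (elim \<tau>)
  then consider "\<tau> > 0" "a \<tau> \<in> WE \<tau>" | "\<tau> < 0" by fastforce
  then show ?case
  proof cases
    case 1
    have e: "exp (- \<tau> * p z) * exp (- \<tau> * (p z + y)) = exp (- \<tau> * y) * exp (- 2 * \<tau> * p z)" for z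
      unfolding exp_add[symmetric] by (simp add: algebra_simps)
    have e': "exp (- \<tau> * (p z + y)) = exp (- \<tau> * y) * exp (- \<tau> * p z)" for z
      unfolding exp_add[symmetric] by (simp add: algebra_simps)
    have "uw \<tau> z * cnj (tfourier k \<tau> z) = complex_of_real (exp (- \<tau> * y)) * (u \<tau> z * cnj (a \<tau> z) * complex_of_real (exp (- 2 * \<tau> * p z)))" for z
    proof -
      have "uw \<tau> z * cnj (tfourier k \<tau> z) = u \<tau> z * cnj (a \<tau> z) * complex_of_real (exp (- \<tau> * p z) * exp (- \<tau> * (p z + y)))"
        unfolding uw_def tfourier_k by simp
      then show ?thesis unfolding e by simp
    qed
    then have "pairing k \<tau> = complex_of_real (exp (- \<tau> * y)) * win \<tau> (u \<tau>) (a \<tau>)"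
      unfolding pairing_def win_def by simp
    also have "win \<tau> (u \<tau>) (a \<tau>) = cnj (LINT w|lborel. a \<tau> w * cnj (tfourier f \<tau> w) * complex_of_real (exp (- \<tau> * p w)))"
      using u_reproducing[OF 1(1) 1(2)] by (simp add: win_commute[of \<tau> "u \<tau>"])
    also have "\<dots> = (LINT w|lborel. cnj (a \<tau> w * cnj (tfourier f \<tau> w) * complex_of_real (exp (- \<tau> * p w))))"
      by (rule Bochner_Integration.integral_cnj[symmetric])
    also have "complex_of_real (exp (- \<tau> * y)) * \<dots> = (LINT w|lborel. tfourier f \<tau> w * cnj (tfourier k \<tau> w))"
      unfolding integral_mult_right_zero[symmetric] tfourier_k e'
      by (intro Bochner_Integration.integral_cong) (simp_all add: mult_ac)
    finally show ?thesis .
  qed (simp add: pairing_def uw_def u_nonpos tfourier_k a_negative)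
qed

text \<open>Parseval's formula for f and \<open>k\<close>: by inversion \<open>k\<close> comes from
  an integrable transform, so its conjugate is itself a transform and the multiplication formula
  applies on each slice.\<close>

lemma L2_inner_f_k: "L2_inner f k = 1 / (2 * pi) * (LINT \<tau>|lborel. LINT w|lborel. tfourier f \<tau> w * cnj (tfourier k \<tau> w))"
proof -
  note [measurable] = k_measurable
  have f_L2: "f \<in> L2" by (rule test_function_L2[OF test])
  have sq: "integrable (lborel \<Otimes>\<^sub>M lborel) (\<lambda>x. (cmod (tfourier h (snd x) (fst x)))\<^sup>2)"
    if h: "h \<in> L2" and slice: "\<And>w. integrable lborel (\<lambda>s. h (w, s))" for h
  proof -
    note hm [measurable] = L2_measurable[OF h]
    show ?thesis
    proof (intro integrableI_bounded)
      have "(\<integral>\<^sup>+x. ennreal (norm ((cmod (tfourier h (snd x) (fst x)))\<^sup>2)) \<partial>(lborel \<Otimes>\<^sub>M lborel)) = (\<integral>\<^sup>+\<tau>. \<integral>\<^sup>+z. ennreal ((cmod (tfourier h \<tau> z))\<^sup>2) \<partial>lborel \<partial>lborel)"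
        by (subst lborel_pair.nn_integral_snd[symmetric]) auto
      also have "\<dots> \<le> ennreal (2 * pi) * (\<integral>\<^sup>+q. ennreal ((cmod (h q))\<^sup>2) \<partial>lborel)"
        by (rule nn_integral_tfourier_le[OF hm slice])
      also have "\<dots> < \<infinity>" using L2_finite[OF h] by (simp add: ennreal_mult_less_top)
      finally show "(\<integral>\<^sup>+x. ennreal (norm ((cmod (tfourier h (snd x) (fst x)))\<^sup>2)) \<partial>(lborel \<Otimes>\<^sub>M lborel)) < \<infinity>" .
    qed measurable
  qed
  have sqk: "integrable (lborel \<Otimes>\<^sub>M lborel) (\<lambda>x. (cmod (cnj (tfourier k (snd x) (fst x))))\<^sup>2)"
    unfolding complex_mod_cnj by (rule sq[OF k_L2 k_slice])
  have slice_eq: "(LINT t|lborel. f (z, t) * cnj (k (z, t))) = 1 / (2 * pi) * (LINT \<tau>|lborel. tfourier f \<tau> z * cnj (tfourier k \<tau> z))" for z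
  proof -
    define \<phi> where "\<phi> \<tau> = cnj (tfourier k \<tau> z)" for \<tau>
    have \<phi>: "integrable lborel \<phi>" unfolding \<phi>_def using tfourier_k_integrable by simp
    have "cnj (k (z, t)) = 1 / (2 * pi) * fourier \<phi> t" for t
    proof -
      have "cnj (LINT \<tau>|lborel. tfourier k \<tau> z * cis (\<tau> * t)) = fourier \<phi> t"
        unfolding fourier_def \<phi>_def by (subst Bochner_Integration.integral_cnj[symmetric]) (simp add: cis_cnj mult.commute)
      then show ?thesis unfolding k_inversion[of z t] by simp
    qed
    then have "(LINT t|lborel. f (z, t) * cnj (k (z, t))) = (LINT t|lborel. 1 / (2 * pi) * (f (z, t) * fourier \<phi> t))"
      by (simp add: mult_ac)
    also have "\<dots> = 1 / (2 * pi) * (LINT t|lborel. f (z, t) * fourier \<phi> t)" by simp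
    also have "(LINT t|lborel. f (z, t) * fourier \<phi> t) = (LINT \<tau>|lborel. \<phi> \<tau> * fourier (\<lambda>t. f (z, t)) \<tau>)"
      by (rule fourier_multiplication[OF \<phi> test_function_slice[OF test]])
    finally show ?thesis by (simp add: \<phi>_def tfourier_def mult.commute)
  qed
  have "L2_inner f k = (LINT z|lborel. LINT t|lborel. f (z, t) * cnj (k (z, t)))"
    unfolding L2_inner_def lborel_prod[symmetric]
    by (rule lborel_pair.integral_fst'[symmetric]) (use L2_inner_integrable(1)[OF f_L2 k_L2] in \<open>simp add: lborel_prod\<close>)
  also have "\<dots> = 1 / (2 * pi) * (LINT z|lborel. LINT \<tau>|lborel. tfourier f \<tau> z * cnj (tfourier k \<tau> z))"
    unfolding slice_eq by simp
  also have "(LINT z|lborel. LINT \<tau>|lborel. tfourier f \<tau> z * cnj (tfourier k \<tau> z)) = (LINT \<tau>|lborel. LINT z|lborel. tfourier f \<tau> z * cnj (tfourier k \<tau> z))"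
  proof (rule lborel_pair.Fubini_integral[symmetric])
    have "integrable (lborel \<Otimes>\<^sub>M lborel) (\<lambda>x. tfourier f (snd x) (fst x) * cnj (tfourier k (snd x) (fst x)))"
      by (rule Cauchy_Schwarz_integral(1)[OF _ sq[OF f_L2 test_function_slice[OF test]] _ sqk]) measurable
    then show "integrable (lborel \<Otimes>\<^sub>M lborel) (\<lambda>(z, \<tau>). tfourier f \<tau> z * cnj (tfourier k \<tau> z))"
      by (simp add: case_prod_beta')
  qed
  finally show ?thesis .
qed

lemma L2_inner_g_k: "L2_inner g k = L2_inner f k"
proof -
  have m: "pairing k \<in> borel_measurable lborel" using pairing_integrable[OF k_L2 k_slice] by simp
  have m': "(\<lambda>\<tau>. LINT w|lborel. tfourier f \<tau> w * cnj (tfourier k \<tau> w)) \<in> borel_measurable lborel"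
  proof -
    note [measurable] = k_measurable
    show ?thesis by measurable
  qed
  show ?thesis
    unfolding L2_inner_g[OF k_L2 k_slice] L2_inner_f_k integral_cong_AE[OF m m' pairing_k] ..
qed

end

context szego_data
begin

text \<open>Two limits in turn: \<epsilon> \<rightarrow> 0 at a fixed height y, dominated because
  the regulariser has modulus at most 1, and then y \<rightarrow> 0 by \<open>L2\<close> convergence
  of the translates to h.\<close>

lemma g_orthogonal:
  assumes h: "h \<in> H2 p"
  shows "L2_inner (\<lambda>q. f q - g q) h = 0"
proof -
  define d where "d q = f q - g q" for q
  have f_L2: "f \<in> L2" by (rule test_function_L2[OF test])
  have d: "d \<in> L2" unfolding d_def by (rule L2_diff[OF f_L2 g_L2])
  obtain H where H: "holomorphic2_on H (Omega p)"
    "(SUP y\<in>{0<..}. \<integral>\<^sup>+ x. ennreal ((cmod (H (lift p y x)))\<^sup>2) \<partial>lborel) < \<infinity>"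
    "((\<lambda>y. \<integral>\<^sup>+ x. ennreal ((cmod (H (lift p y x) - h x))\<^sup>2) \<partial>lborel) \<longlongrightarrow> 0) (at_right 0)"
    and hL2: "h \<in> L2"
    using h unfolding H2_def by blast
  define M where "M = (SUP y\<in>{0<..}. \<integral>\<^sup>+ x. ennreal ((cmod (H (lift p y x)))\<^sup>2) \<partial>lborel)"
  interpret E: hardy_extension p H M
  proof
    show "M < \<infinity>" unfolding M_def by (rule H(2))
    show "(\<integral>\<^sup>+q. ennreal ((cmod (H (lift p y q)))\<^sup>2) \<partial>lborel) \<le> M" if "y > 0" for y
      unfolding M_def by (rule SUP_upper) (use that in simp)
  qed (rule H(1))
  have zero: "L2_inner d (\<lambda>q. H (lift p y q)) = 0" if y: "y > 0" for y
  proof -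
    define e where "e n = 1 / real (Suc n)" for n
    have e: "e n > 0" for n by (simp add: e_def)
    have elim: "e \<longlonglongrightarrow> 0" unfolding e_def using LIMSEQ_inverse_real_of_nat by (simp add: inverse_eq_divide)
    define k where "k n q = H (lift p y q) * (1 / (1 - \<i> * complex_of_real (e n) * snd (lift p y q)))\<^sup>2" for n q
    have k: "k n \<in> L2" "L2_inner d (k n) = 0" "cmod (k n q) \<le> cmod (H (lift p y q))" for n q
    proof -
      interpret O: orthogonality p f H M "e n" y by unfold_locales (use e y in auto)
      have kk: "k n = O.k" by (simp add: k_def O.k_def O.G_def fun_eq_iff)
      show "k n \<in> L2" "cmod (k n q) \<le> cmod (H (lift p y q))" unfolding kk by (rule O.k_L2, rule O.norm_k_le)
      show "L2_inner d (k n) = 0" unfolding kk d_def L2_inner_diff_left[OF f_L2 g_L2 O.k_L2] O.L2_inner_g_k by simp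
    qed
    have "(\<lambda>n. LINT q|lborel. d q * cnj (k n q)) \<longlonglongrightarrow> (LINT q|lborel. d q * cnj (H (lift p y q)))"
    proof (rule integral_dominated_convergence[where w="\<lambda>q. norm (d q * cnj (H (lift p y q)))"])
      show "(\<lambda>q. d q * cnj (H (lift p y q))) \<in> borel_measurable lborel"
        using L2_inner_integrable(1)[OF d E.H_lift_L2[OF y]] by simp
      show "(\<lambda>q. d q * cnj (k n q)) \<in> borel_measurable lborel" for n
        using L2_inner_integrable(1)[OF d k(1)] by simp
      show "integrable lborel (\<lambda>q. norm (d q * cnj (H (lift p y q))))"
        by (intro integrable_norm L2_inner_integrable d E.H_lift_L2 y)
      show "AE q in lborel. norm (d q * cnj (k n q)) \<le> norm (d q * cnj (H (lift p y q)))" for n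
        using k(3)[of n] by (intro AE_I2) (simp add: norm_mult mult_left_mono)
      show "AE q in lborel. (\<lambda>n. d q * cnj (k n q)) \<longlonglongrightarrow> d q * cnj (H (lift p y q))"
      proof (rule AE_I2)
        fix q
        have "(\<lambda>n. d q * cnj (k n q)) \<longlonglongrightarrow> d q * cnj (H (lift p y q) * (1 / (1 - \<i> * complex_of_real 0 * snd (lift p y q)))\<^sup>2)"
          unfolding k_def by (intro tendsto_intros elim) simp
        then show "(\<lambda>n. d q * cnj (k n q)) \<longlonglongrightarrow> d q * cnj (H (lift p y q))" by simp
      qed
    qed
    then have "(\<lambda>n. L2_inner d (k n)) \<longlonglongrightarrow> L2_inner d (\<lambda>q. H (lift p y q))" by (simp add: L2_inner_def)
    then show ?thesis by (simp add: k(2) LIMSEQ_const_iff)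
  qed
  have "((\<lambda>y. L2_inner (\<lambda>q. H (lift p y q)) d) \<longlongrightarrow> L2_inner h d) (at_right 0)"
    by (rule L2_inner_tendsto[OF eventually_mono[OF eventually_at_right_less E.H_lift_L2] hL2 d H(3)])
  moreover have "\<forall>\<^sub>F y in at_right 0. L2_inner (\<lambda>q. H (lift p y q)) d = 0"
    using eventually_at_right_less[of "0::real"]
    by eventually_elim (metis L2_inner_commute complex_cnj_zero zero)
  ultimately have "((\<lambda>y::real. 0) \<longlongrightarrow> L2_inner h d) (at_right 0)" by (rule Lim_transform_eventually)
  then have "L2_inner h d = 0" using tendsto_unique[OF trivial_limit_at_right_real] tendsto_const by blast
  then have "L2_inner d h = 0" using L2_inner_commute[of d h] by simp
  then show ?thesis by (simp add: d_def[abs_def])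
qed

end

section \<open>The integral formula for the kernel\<close>

lemma H2_L2: "h \<in> H2 p \<Longrightarrow> h \<in> L2"
  by (simp add: H2_def)

context continuous_weight
begin

text \<open>Two candidates for the projection are compared by testing their difference against
  itself, which requires the difference to lie in the Hardy space.\<close>

lemma H2_diff:
  assumes "h1 \<in> H2 p" "h2 \<in> H2 p"
  shows "(\<lambda>q. h1 q - h2 q) \<in> H2 p"
proof -
  define N where "N F = (SUP y\<in>{0<..}. \<integral>\<^sup>+ x. ennreal ((cmod (F (lift p y x)))\<^sup>2) \<partial>lborel)" for F
  obtain F1 where F1: "holomorphic2_on F1 (Omega p)" "N F1 < \<infinity>"
    "((\<lambda>y. \<integral>\<^sup>+ x. ennreal ((cmod (F1 (lift p y x) - h1 x))\<^sup>2) \<partial>lborel) \<longlongrightarrow> 0) (at_right 0)"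
    using assms(1) unfolding H2_def N_def by blast
  obtain F2 where F2: "holomorphic2_on F2 (Omega p)" "N F2 < \<infinity>"
    "((\<lambda>y. \<integral>\<^sup>+ x. ennreal ((cmod (F2 (lift p y x) - h2 x))\<^sup>2) \<partial>lborel) \<longlongrightarrow> 0) (at_right 0)"
    using assms(2) unfolding H2_def N_def by blast
  have le_N: "(\<integral>\<^sup>+q. ennreal ((cmod (F (lift p y q)))\<^sup>2) \<partial>lborel) \<le> N F" if "y > 0" for F y
    unfolding N_def by (rule SUP_upper) (use that in simp)
  interpret E1: hardy_extension p F1 "N F1" by unfold_locales (use F1 le_N in auto)
  interpret E2: hardy_extension p F2 "N F2" by unfold_locales (use F2 le_N in auto)
  note h_meas [measurable] = L2_measurable[OF H2_L2[OF assms(1)]] L2_measurable[OF H2_L2[OF assms(2)]]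
  define F where "F q = F1 q - F2 q" for q
  have "holomorphic2_on F (Omega p)"
    unfolding holomorphic2_on_def
  proof
    fix x assume x: "x \<in> Omega p"
    obtain a1 b1 where 1: "(F1 has_derivative (\<lambda>(u, v). a1 * u + b1 * v)) (at x within Omega p)"
      using F1(1) x unfolding holomorphic2_on_def by blast
    obtain a2 b2 where 2: "(F2 has_derivative (\<lambda>(u, v). a2 * u + b2 * v)) (at x within Omega p)"
      using F2(1) x unfolding holomorphic2_on_def by blast
    have "(F has_derivative (\<lambda>(u, v). (a1 - a2) * u + (b1 - b2) * v)) (at x within Omega p)"
      unfolding F_def using has_derivative_diff[OF 1 2] by (simp add: case_prod_beta' algebra_simps)
    then show "\<exists>a b. (F has_derivative (\<lambda>(u, v). a * u + b * v)) (at x within Omega p)" by blast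
  qed
  moreover have "N F < \<infinity>"
  proof -
    have "N F \<le> 2 * N F1 + 2 * N F2"
      unfolding N_def[of F]
    proof (rule SUP_least)
      fix y :: real assume "y \<in> {0<..}"
      then have y: "y > 0" by simp
      have "(\<integral>\<^sup>+ x. ennreal ((cmod (F (lift p y x)))\<^sup>2) \<partial>lborel) \<le> 2 * (\<integral>\<^sup>+ x. ennreal ((cmod (F1 (lift p y x)))\<^sup>2) \<partial>lborel) + 2 * (\<integral>\<^sup>+ x. ennreal ((cmod (- F2 (lift p y x)))\<^sup>2) \<partial>lborel)"
        using nn_integral_cmod_add_squared_le[of "\<lambda>x. F1 (lift p y x)" lborel "\<lambda>x. - F2 (lift p y x)"]
          E1.H_lift_measurable[OF y] E2.H_lift_measurable[OF y] by (simp add: F_def)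
      also have "\<dots> \<le> 2 * N F1 + 2 * N F2"
        unfolding norm_minus_cancel by (intro add_mono mult_left_mono le_N y) auto
      finally show "(\<integral>\<^sup>+ x. ennreal ((cmod (F (lift p y x)))\<^sup>2) \<partial>lborel) \<le> 2 * N F1 + 2 * N F2" .
    qed
    also have "\<dots> < \<infinity>" using F1(2) F2(2) by (simp add: ennreal_mult_less_top)
    finally show ?thesis .
  qed
  moreover have "((\<lambda>y. \<integral>\<^sup>+ x. ennreal ((cmod (F (lift p y x) - (h1 x - h2 x)))\<^sup>2) \<partial>lborel) \<longlongrightarrow> 0) (at_right 0)"
  proof (rule tendsto_sandwich[OF _ _ tendsto_const])
    have "((\<lambda>y. 2 * (\<integral>\<^sup>+ x. ennreal ((cmod (F1 (lift p y x) - h1 x))\<^sup>2) \<partial>lborel) + 2 * (\<integral>\<^sup>+ x. ennreal ((cmod (F2 (lift p y x) - h2 x))\<^sup>2) \<partial>lborel)) \<longlongrightarrow> 2 * 0 + 2 * 0) (at_right 0)"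
      by (intro tendsto_add ennreal_tendsto_cmult F1 F2) auto
    then show "((\<lambda>y. 2 * (\<integral>\<^sup>+ x. ennreal ((cmod (F1 (lift p y x) - h1 x))\<^sup>2) \<partial>lborel) + 2 * (\<integral>\<^sup>+ x. ennreal ((cmod (F2 (lift p y x) - h2 x))\<^sup>2) \<partial>lborel)) \<longlongrightarrow> 0) (at_right 0)"
      by simp
    show "\<forall>\<^sub>F y in at_right 0. (\<integral>\<^sup>+ x. ennreal ((cmod (F (lift p y x) - (h1 x - h2 x)))\<^sup>2) \<partial>lborel) \<le> 2 * (\<integral>\<^sup>+ x. ennreal ((cmod (F1 (lift p y x) - h1 x))\<^sup>2) \<partial>lborel) + 2 * (\<integral>\<^sup>+ x. ennreal ((cmod (F2 (lift p y x) - h2 x))\<^sup>2) \<partial>lborel)"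
      using eventually_at_right_less[of "0::real"]
    proof eventually_elim
      case (elim y)
      have m: "(\<lambda>x. F1 (lift p y x) - h1 x) \<in> borel_measurable lborel" "(\<lambda>x. h2 x - F2 (lift p y x)) \<in> borel_measurable lborel"
        using E1.H_lift_measurable[OF elim] E2.H_lift_measurable[OF elim] h_meas by simp_all
      have eq: "F (lift p y x) - (h1 x - h2 x) = (F1 (lift p y x) - h1 x) + (h2 x - F2 (lift p y x))" for x by (simp add: F_def)
      have eq': "cmod (h2 x - F2 (lift p y x)) = cmod (F2 (lift p y x) - h2 x)" for x by (rule norm_minus_commute)
      show ?case using nn_integral_cmod_add_squared_le[OF m] unfolding eq eq' .
    qed
  qed simp
  moreover have "(\<lambda>q. h1 q - h2 q) \<in> L2" by (rule L2_diff[OF H2_L2[OF assms(1)] H2_L2[OF assms(2)]])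
  ultimately show ?thesis unfolding H2_def N_def by blast
qed

end

context szego_data
begin

text \<open>\<open>szego_projection\<close> is a choice among functions that agree almost
  everywhere, and g shows that one exists. The difference of the chosen one and g is a Hardy
  function orthogonal to itself, so inner products do not see it.\<close>

lemma L2_inner_szego_projection:
  assumes k: "k \<in> L2"
  shows "L2_inner (szego_projection p f) k = L2_inner g k"
proof -
  define P where "P = szego_projection p f"
  have f_L2: "f \<in> L2" by (rule test_function_L2[OF test])
  have "\<exists>g. g \<in> H2 p \<and> (\<forall>h\<in>H2 p. L2_inner (\<lambda>x. f x - g x) h = 0)"
    using g_H2 g_orthogonal by blast
  from someI_ex[OF this] have P: "P \<in> H2 p" "\<And>h. h \<in> H2 p \<Longrightarrow> L2_inner (\<lambda>x. f x - P x) h = 0"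
    unfolding P_def szego_projection_def by auto
  note P_L2 = H2_L2[OF P(1)]
  define d where "d q = P q - g q" for q
  have d: "d \<in> H2 p" unfolding d_def by (rule H2_diff[OF P(1) g_H2])
  note d_L2 = H2_L2[OF d]
  have "L2_inner P d = L2_inner g d"
    using P(2)[OF d] g_orthogonal[OF d] unfolding L2_inner_diff_left[OF f_L2 P_L2 d_L2] L2_inner_diff_left[OF f_L2 g_L2 d_L2] by simp
  then have "L2_inner d d = 0"
    using L2_inner_diff_left[OF P_L2 g_L2 d_L2] by (simp add: d_def[symmetric])
  then have "(LINT q|lborel. (cmod (d q))\<^sup>2) = 0"
    unfolding L2_inner_def complex_norm_square[symmetric] integral_complex_of_real by simp
  then have "L2_inner d k = 0" using L2_inner_integrable(2)[OF d_L2 k] by simp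
  then show ?thesis
    using L2_inner_diff_left[OF P_L2 g_L2 k] by (simp add: d_def[symmetric] P_def[symmetric])
qed

end

section \<open>Pairing kernels with test functions\<close>

lemma integrable_bounded_compact_support:
  fixes h :: "'a::euclidean_space \<Rightarrow> complex"
  assumes "h \<in> borel_measurable borel" "compact K" "\<And>x. x \<notin> K \<Longrightarrow> h x = 0" "\<And>x. x \<in> K \<Longrightarrow> cmod (h x) \<le> B"
  shows "integrable lborel h"
proof (rule Bochner_Integration.integrable_bound)
  show "integrable lborel (\<lambda>x. indicator K x * B)"
    using emeasure_compact_finite[OF assms(2)] borel_compact[OF assms(2)] by (intro integrable_mult_left integrable_real_indicator) auto
  show "AE x in lborel. norm (h x) \<le> norm (indicator K x * B)"
  proof (rule AE_I2)
    fix x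
    show "norm (h x) \<le> norm (indicator K x * B)"
    proof (cases "x \<in> K")
      case True
      then have "cmod (h x) \<le> \<bar>B\<bar>" using assms(4)[OF True] by linarith
      then show ?thesis using True by simp
    qed (simp add: assms(3))
  qed
qed (use assms(1) in simp)

text \<open>Integrating the real variable out leaves the partial transform; local boundedness of
  \<alpha> is enough because f has compact support.\<close>

lemma test_function_integral:
  assumes f: "test_function f" and m [measurable]: "\<alpha> \<in> borel_measurable borel"
    and bd: "\<And>R. \<exists>C. \<forall>w\<in>cball 0 R. cmod (\<alpha> w) \<le> C"
  shows "integrable lborel (\<lambda>q. \<alpha> (fst q) * f q * cis (- (\<tau> * snd q)))"
    and "(LINT q|lborel. \<alpha> (fst q) * f q * cis (- (\<tau> * snd q))) = (LINT w|lborel. \<alpha> w * tfourier f \<tau> w)"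
proof -
  note [measurable] = test_function_measurable[OF f]
  have k: "compact (supp f)" using f by (simp add: test_function_def)
  obtain B R where BR: "B > 0" "R > 0" "\<And>q. cmod (f q) \<le> B" "\<And>w s. f (w, s) \<noteq> 0 \<Longrightarrow> cmod w \<le> R \<and> \<bar>s\<bar> \<le> R"
    by (rule test_function_bounds[OF f]) blast
  obtain C where C: "\<And>w. w \<in> cball 0 R \<Longrightarrow> cmod (\<alpha> w) \<le> C" using bd by blast
  have "cmod (\<alpha> 0) \<le> C" using C[of 0] BR(2) by simp
  then have C0: "C \<ge> 0" using norm_ge_zero[of "\<alpha> 0"] by linarith
  show int: "integrable lborel (\<lambda>q. \<alpha> (fst q) * f q * cis (- (\<tau> * snd q)))"
  proof (rule integrable_bounded_compact_support[OF _ k])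
    show "(\<lambda>q. \<alpha> (fst q) * f q * cis (- (\<tau> * snd q))) \<in> borel_measurable borel" by measurable
    show "\<alpha> (fst q) * f q * cis (- (\<tau> * snd q)) = 0" if "q \<notin> supp f" for q using eq_0_if_notin_supp[OF that] by simp
    show "cmod (\<alpha> (fst q) * f q * cis (- (\<tau> * snd q))) \<le> C * B" for q
    proof (cases "f q = 0")
      case False
      then have "fst q \<in> cball 0 R" using BR(4)[of "fst q" "snd q"] by simp
      then have "cmod (\<alpha> (fst q)) * cmod (f q) \<le> C * B" by (intro mult_mono C BR C0) auto
      then show ?thesis by (simp add: norm_mult)
    qed (use C0 BR in simp)
  qed
  have "(LINT q|lborel. \<alpha> (fst q) * f q * cis (- (\<tau> * snd q))) = (LINT w|lborel. LINT s|lborel. \<alpha> w * f (w, s) * cis (- (\<tau> * s)))"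
    using lborel_pair.integral_fst'[of "\<lambda>q. \<alpha> (fst q) * f q * cis (- (\<tau> * snd q))"] int by (simp add: lborel_prod)
  also have "\<dots> = (LINT w|lborel. \<alpha> w * tfourier f \<tau> w)"
    unfolding tfourier_def fourier_def by (simp add: mult.assoc)
  finally show "(LINT q|lborel. \<alpha> (fst q) * f q * cis (- (\<tau> * snd q))) = (LINT w|lborel. \<alpha> w * tfourier f \<tau> w)" .
qed

lemma test_function_compact: "test_function f \<Longrightarrow> compact (supp f)"
  by (simp add: test_function_def)

lemma test_functions_product:
  assumes "test_function f" "test_function g"
  obtains B where "(\<lambda>q. f (snd q) * cnj (g (fst q))) \<in> borel_measurable borel" "\<And>q. cmod (f (snd q) * cnj (g (fst q))) \<le> B"
    "\<And>q. q \<notin> supp g \<times> supp f \<Longrightarrow> f (snd q) * cnj (g (fst q)) = 0"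
proof -
  note [measurable] = assms[THEN test_function_measurable]
  obtain B where B: "B > 0" "\<And>q. cmod (f q) \<le> B" by (rule test_function_bounds[OF assms(1)]) blast
  obtain B' where B': "B' > 0" "\<And>q. cmod (g q) \<le> B'" by (rule test_function_bounds[OF assms(2)]) blast
  show ?thesis
  proof
    show "(\<lambda>q. f (snd q) * cnj (g (fst q))) \<in> borel_measurable borel" by measurable
    show "cmod (f (snd q) * cnj (g (fst q))) \<le> B * B'" for q
      unfolding norm_mult complex_mod_cnj by (intro mult_mono B B') (use B in auto)
    show "f (snd q) * cnj (g (fst q)) = 0" if "q \<notin> supp g \<times> supp f" for q
      using that eq_0_if_notin_supp[of "fst q" g] eq_0_if_notin_supp[of "snd q" f] by (cases q) auto
  qed
qed

lemma tested_eq: "tested k f g q = k q * (f (snd q) * cnj (g (fst q)))"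
  by (cases q) (simp add: tested_def mult.assoc)

lemma tested_integrable:
  assumes "test_function f" "test_function g" "set_integrable lborel (supp g \<times> supp f) S"
  shows "integrable lborel (tested S f g)"
proof -
  obtain B where B: "(\<lambda>q. f (snd q) * cnj (g (fst q))) \<in> borel_measurable borel" "\<And>q. cmod (f (snd q) * cnj (g (fst q))) \<le> B"
    "\<And>q. q \<notin> supp g \<times> supp f \<Longrightarrow> f (snd q) * cnj (g (fst q)) = 0"
    by (rule test_functions_product[OF assms(1,2)]) blast
  have "integrable lborel (\<lambda>q. (indicator (supp g \<times> supp f) q *\<^sub>R S q) * (f (snd q) * cnj (g (fst q))))"
  proof (rule Bochner_Integration.integrable_bound)
    show "integrable lborel (\<lambda>q. norm (indicator (supp g \<times> supp f) q *\<^sub>R S q) * B)"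
      using assms(3) unfolding set_integrable_def by (intro integrable_mult_left integrable_norm)
    show "(\<lambda>q. (indicator (supp g \<times> supp f) q *\<^sub>R S q) * (f (snd q) * cnj (g (fst q)))) \<in> borel_measurable lborel"
      by (rule borel_measurable_times[OF borel_measurable_integrable[OF assms(3)[unfolded set_integrable_def]]]) (use B(1) in simp)
    show "AE q in lborel. norm ((indicator (supp g \<times> supp f) q *\<^sub>R S q) * (f (snd q) * cnj (g (fst q)))) \<le> norm (norm (indicator (supp g \<times> supp f) q *\<^sub>R S q) * B)"
    proof (rule AE_I2)
      fix q
      have "norm (indicator (supp g \<times> supp f) q *\<^sub>R S q) * cmod (f (snd q) * cnj (g (fst q))) \<le> norm (indicator (supp g \<times> supp f) q *\<^sub>R S q) * B"
        by (intro mult_left_mono B) simp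
      also have "\<dots> \<le> norm (norm (indicator (supp g \<times> supp f) q *\<^sub>R S q) * B)" unfolding real_norm_def by (rule abs_ge_self)
      finally show "norm ((indicator (supp g \<times> supp f) q *\<^sub>R S q) * (f (snd q) * cnj (g (fst q)))) \<le> norm (norm (indicator (supp g \<times> supp f) q *\<^sub>R S q) * B)"
        unfolding norm_mult[of "_ *\<^sub>R _" "_ * _"] .
    qed
  qed
  also have "(\<lambda>q. (indicator (supp g \<times> supp f) q *\<^sub>R S q) * (f (snd q) * cnj (g (fst q)))) = tested S f g"
  proof
    fix q
    show "(indicator (supp g \<times> supp f) q *\<^sub>R S q) * (f (snd q) * cnj (g (fst q))) = tested S f g q"
      using B(3)[of q] unfolding tested_eq by (cases "q \<in> supp g \<times> supp f") simp_all
  qed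
  finally show ?thesis .
qed

context continuous_weight
begin

text \<open>Separates the variables: s goes with f and yields its transform at \<tau>, while t goes
  with the function tested against.\<close>

lemma szego_integrand_eq:
  assumes "\<tau> > 0"
  shows "szego_integrand p \<tau> q = kernel0 \<tau> (fst (snd q)) (fst (fst q)) * complex_of_real (exp (- \<tau> * p (fst (snd q)))) * complex_of_real (exp (- \<tau> * p (fst (fst q))))
    * cis (- (\<tau> * snd (snd q))) * cis (\<tau> * snd (fst q))"
proof -
  obtain z t w s where q: "q = ((z, t), (w, s))" by (metis surj_pair)
  have "exp (- \<i> * complex_of_real (\<tau> * (s - t))) = cis (- (\<tau> * s)) * cis (\<tau> * t)"
  proof -
    have "- \<i> * complex_of_real (\<tau> * (s - t)) = \<i> * complex_of_real (- (\<tau> * s) + \<tau> * t)" by (simp add: algebra_simps)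
    then have "exp (- \<i> * complex_of_real (\<tau> * (s - t))) = cis (- (\<tau> * s) + \<tau> * t)" by (simp only: cis_conv_exp)
    then show ?thesis by (simp only: cis_mult)
  qed
  moreover have "exp (- \<tau> * (p z + p w)) = exp (- \<tau> * p w) * exp (- \<tau> * p z)"
    unfolding exp_add[symmetric] by (simp add: algebra_simps)
  ultimately show ?thesis using assms by (simp add: q szego_integrand_def kernel0_def kernel_def mult.assoc)
qed

lemma szego_integrand_measurable:
  assumes "\<tau> > 0"
  shows "szego_integrand p \<tau> \<in> borel_measurable borel"
proof -
  have "szego_integrand p \<tau> = (\<lambda>q. kernel0 \<tau> (fst (snd q)) (fst (fst q)) * complex_of_real (exp (- \<tau> * p (fst (snd q)))) * complex_of_real (exp (- \<tau> * p (fst (fst q))))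
    * cis (- (\<tau> * snd (snd q))) * cis (\<tau> * snd (fst q)))"
    by (rule ext) (rule szego_integrand_eq[OF assms])
  then show ?thesis by simp
qed

lemma szego_integrand_locally_integrable:
  assumes \<tau>: "\<tau> > 0" and C: "compact C"
  shows "set_integrable lborel C (szego_integrand p \<tau>)"
proof -
  note [measurable] = szego_integrand_measurable[OF \<tau>] borel_compact[OF C]
  \<comment> \<open>The complex coordinates of both points of C are collected in one compact set, as
    \<open>kernel_bound\<close> expects.\<close>
  define K where "K = (fst \<circ> fst) ` C \<union> (fst \<circ> snd) ` C"
  have K: "compact K" unfolding K_def comp_def
    by (intro compact_Un compact_continuous_image C continuous_intros)
  obtain B where B: "B > 0" "\<And>\<tau> z w. \<tau> > 0 \<Longrightarrow> z \<in> K \<Longrightarrow> w \<in> K \<Longrightarrow> cmod (kernel \<tau> w z) \<le> B * exp (\<tau> * (p z + p w + 2 * 1))"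
    by (rule kernel_bound[OF K, of 1]) auto
  show ?thesis unfolding set_integrable_def
  proof (rule integrable_bounded_compact_support[OF _ C])
    show "(\<lambda>q. indicator C q *\<^sub>R szego_integrand p \<tau> q) \<in> borel_measurable borel" by measurable
    fix q assume q: "q \<in> C"
    define z w where "z = fst (fst q)" and "w = fst (snd q)"
    have "z \<in> K" "w \<in> K" using q by (auto simp: K_def z_def w_def)
    then have "cmod (kernel \<tau> w z) * (exp (- \<tau> * p w) * exp (- \<tau> * p z)) \<le> B * exp (\<tau> * (p z + p w + 2 * 1)) * (exp (- \<tau> * p w) * exp (- \<tau> * p z))"
      by (intro mult_right_mono B \<tau>) simp_all
    also have "\<dots> = B * exp (2 * \<tau>)"
      unfolding mult.assoc exp_add[symmetric] by (simp add: algebra_simps)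
    finally show "cmod (indicator C q *\<^sub>R szego_integrand p \<tau> q) \<le> B * exp (2 * \<tau>)"
      using q \<tau> unfolding szego_integrand_eq[OF \<tau>] by (simp add: norm_mult z_def w_def kernel0_def mult.assoc)
  qed simp
qed

end

context szego_data
begin

lemma u_locally_bounded: "\<exists>C. \<forall>z\<in>cball 0 R. cmod (cnj (uw \<tau> z)) \<le> C"
proof -
  have c: "continuous_on UNIV (u \<tau>)"
    using WE_continuous[OF u_WE, of \<tau>] by (cases "\<tau> > 0") (auto simp: u_nonpos)
  have "continuous_on (cball 0 R) (\<lambda>z. cnj (uw \<tau> z))"
    unfolding uw_def by (intro continuous_intros continuous_on_subset[OF c] continuous_on_subset[OF cont_p]) auto
  then have "bounded ((\<lambda>z. cnj (uw \<tau> z)) ` cball 0 R)"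
    by (intro compact_imp_bounded compact_continuous_image) auto
  then show ?thesis unfolding bounded_iff by auto
qed

text \<open>Integrating over the second point produces \<open>u \<tau>\<close> at the first one, so
  the kernel of the theorem meets the quantity in Parseval's formula for g.\<close>

lemma integral_tested_szego_integrand:
  assumes \<tau>: "\<tau> > 0" and \<psi>: "test_function \<psi>"
  shows "integrable lborel (tested (szego_integrand p \<tau>) f \<psi>)"
    and "(LINT q|lborel. tested (szego_integrand p \<tau>) f \<psi> q) = pairing \<psi> \<tau>"
proof -
  note [measurable] = test_function_measurable[OF \<psi>]
  show int: "integrable lborel (tested (szego_integrand p \<tau>) f \<psi>)"
    by (intro tested_integrable test \<psi> szego_integrand_locally_integrable \<tau> compact_Times test_function_compact)
  \<comment> \<open>Put as a conjugate so that \<open>test_function_integral\<close>, whose phase is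
    cis (- \<tau> s), also handles the outer integration against the conjugate of \<psi>.\<close>
  have inner: "(LINT y|lborel. tested (szego_integrand p \<tau>) f \<psi> (x, y)) = cnj (cnj (uw \<tau> (fst x)) * \<psi> x * cis (- (\<tau> * snd x)))" for x
  proof -
    define z where "z = fst x"
    define \<alpha> where "\<alpha> w = kernel0 \<tau> w z * complex_of_real (exp (- \<tau> * p w))" for w
    have [measurable]: "\<alpha> \<in> borel_measurable borel" unfolding \<alpha>_def by measurable
    have bd: "\<exists>C. \<forall>w\<in>cball 0 R. cmod (\<alpha> w) \<le> C" for R
    proof -
      obtain B where B: "B > 0" "\<And>\<tau> z' w. \<tau> > 0 \<Longrightarrow> z' \<in> cball 0 R \<union> {z} \<Longrightarrow> w \<in> cball 0 R \<union> {z} \<Longrightarrow> cmod (kernel \<tau> w z') \<le> B * exp (\<tau> * (p z' + p w + 2 * 1))"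
        by (rule kernel_bound[of "cball 0 R \<union> {z}" 1]) auto
      have "cmod (\<alpha> w) \<le> B * exp (\<tau> * (p z + 2))" if "w \<in> cball 0 R" for w
      proof -
        have "cmod (kernel \<tau> w z) * exp (- \<tau> * p w) \<le> B * exp (\<tau> * (p z + p w + 2 * 1)) * exp (- \<tau> * p w)"
          using that by (intro mult_right_mono B \<tau>) auto
        also have "\<dots> = B * exp (\<tau> * (p z + 2))"
          unfolding mult.assoc exp_add[symmetric] by (simp add: algebra_simps)
        finally show ?thesis using \<tau> by (simp add: \<alpha>_def norm_mult kernel0_def)
      qed
      then show ?thesis by blast
    qed
    have "(LINT y|lborel. tested (szego_integrand p \<tau>) f \<psi> (x, y))
       = (LINT y|lborel. complex_of_real (exp (- \<tau> * p z)) * cis (\<tau> * snd x) * cnj (\<psi> x) * (\<alpha> (fst y) * f y * cis (- (\<tau> * snd y))))"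
      unfolding tested_eq szego_integrand_eq[OF \<tau>] fst_conv snd_conv \<alpha>_def z_def by (simp only: mult_ac)
    also have "\<dots> = complex_of_real (exp (- \<tau> * p z)) * cis (\<tau> * snd x) * cnj (\<psi> x) * (LINT w|lborel. \<alpha> w * tfourier f \<tau> w)"
      by (simp only: integral_mult_right_zero test_function_integral(2)[OF test _ bd] \<open>\<alpha> \<in> borel_measurable borel\<close>)
    also have "(LINT w|lborel. \<alpha> w * tfourier f \<tau> w) = u \<tau> z"
      unfolding u_def \<alpha>_def by (simp only: mult_ac)
    finally show ?thesis by (simp add: uw_def z_def cis_cnj mult_ac)
  qed
  have "(LINT q|lborel. tested (szego_integrand p \<tau>) f \<psi> q) = (LINT x|lborel. LINT y|lborel. tested (szego_integrand p \<tau>) f \<psi> (x, y))"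
    using lborel_pair.integral_fst'[of "tested (szego_integrand p \<tau>) f \<psi>"] int by (simp add: lborel_prod)
  also have "\<dots> = cnj (LINT x|lborel. cnj (uw \<tau> (fst x)) * \<psi> x * cis (- (\<tau> * snd x)))"
    unfolding inner by (rule Bochner_Integration.integral_cnj)
  also have "(LINT x|lborel. cnj (uw \<tau> (fst x)) * \<psi> x * cis (- (\<tau> * snd x))) = (LINT z|lborel. cnj (uw \<tau> z) * tfourier \<psi> \<tau> z)"
    by (rule test_function_integral(2)[OF \<psi> _ u_locally_bounded]) measurable
  also have "cnj \<dots> = pairing \<psi> \<tau>"
    unfolding pairing_def by (subst Bochner_Integration.integral_cnj[symmetric]) simp
  finally show "(LINT q|lborel. tested (szego_integrand p \<tau>) f \<psi> q) = pairing \<psi> \<tau>" .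
qed

end

context continuous_weight
begin

text \<open>Parseval's formula for g with the test function \<psi> in the second place;
  \<open>pairing\<close> vanishes for \<tau> \<le> 0, which restricts the integral to positive
  frequencies.\<close>

lemma szego_kernel_distributional: "integral_kernel_is_integral (szego_projection p) (1 / (2 * complex_of_real pi)) (szego_integrand p)"
  unfolding integral_kernel_is_integral_def
proof (intro allI impI)
  fix f \<psi> :: "complex \<times> real \<Rightarrow> complex" assume "test_function f \<and> test_function \<psi>"
  then have f: "test_function f" and \<psi>: "test_function \<psi>" by auto
  interpret szego_data p f by unfold_locales (rule f)
  have \<psi>2: "\<psi> \<in> L2" by (rule test_function_L2[OF \<psi>])
  have eq: "indicator {0<..} \<tau> *\<^sub>R (LINT q|lborel. tested (szego_integrand p \<tau>) f \<psi> q) = pairing \<psi> \<tau>" for \<tau>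
  proof (cases "\<tau> > 0")
    case True
    then show ?thesis using integral_tested_szego_integrand[OF True \<psi>] by simp
  qed (simp add: pairing_def uw_def u_nonpos)
  have "set_integrable lborel {0<..} (\<lambda>\<tau>. LINT q|lborel. tested (szego_integrand p \<tau>) f \<psi> q)"
    unfolding set_integrable_def eq using pairing_integrable[OF \<psi>2 test_function_slice[OF \<psi>]] .
  moreover have "L2_inner (szego_projection p f) \<psi> = 1 / (2 * complex_of_real pi) * (LBINT \<tau>:{0<..}. LINT q|lborel. tested (szego_integrand p \<tau>) f \<psi> q)"
    unfolding set_lebesgue_integral_def eq L2_inner_szego_projection[OF \<psi>2]
    using L2_inner_g[OF \<psi>2 test_function_slice[OF \<psi>]] by simp
  ultimately show "(\<forall>\<tau>>0. integrable lborel (tested (szego_integrand p \<tau>) f \<psi>)) \<and>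
        set_integrable lborel {0<..} (\<lambda>\<tau>. LINT q|lborel. tested (szego_integrand p \<tau>) f \<psi> q) \<and>
        L2_inner (szego_projection p f) \<psi> = 1 / (2 * complex_of_real pi) * (LBINT \<tau>:{0<..}. LINT q|lborel. tested (szego_integrand p \<tau>) f \<psi> q)"
    using integral_tested_szego_integrand(1)[OF _ \<psi>] by blast
qed

end

text \<open>Absolute integrability over the product of C and the positive axis lets Fubini exchange
  the \<tau>-integral with the test integral, where C is the compact product of the
  supports.\<close>

lemma integral_kernel_is_integral_on:
  assumes T: "integral_kernel_is_integral T c k"
    and int: "\<And>C. compact C \<Longrightarrow> C \<subseteq> U \<Longrightarrow> set_integrable lborel (C \<times> {0<..}) (\<lambda>(q, \<tau>). k \<tau> q)"
  shows "integral_kernel_on U T (\<lambda>q. c * (LBINT \<tau>:{0<..}. k \<tau> q))"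
  unfolding integral_kernel_on_def
proof (intro conjI allI impI)
  fix C assume "compact C \<and> C \<subseteq> U"
  then have "integrable (lborel \<Otimes>\<^sub>M lborel) (\<lambda>x. indicator (C \<times> {0<..}) x *\<^sub>R (case x of (q, \<tau>) \<Rightarrow> k \<tau> q))"
    using int[of C] by (simp add: set_integrable_def lborel_prod)
  from lborel_pair.integrable_fst'[OF this]
  have "integrable lborel (\<lambda>q. LINT \<tau>|lborel. indicator (C \<times> {0<..}) (q, \<tau>) *\<^sub>R k \<tau> q)" by simp
  then have "integrable lborel (\<lambda>q. c * (LINT \<tau>|lborel. indicator (C \<times> {0<..}) (q, \<tau>) *\<^sub>R k \<tau> q))"
    by (rule integrable_mult_right)
  also have "(\<lambda>q. c * (LINT \<tau>|lborel. indicator (C \<times> {0<..}) (q, \<tau>) *\<^sub>R k \<tau> q)) = (\<lambda>q. indicator C q *\<^sub>R (c * (LBINT \<tau>:{0<..}. k \<tau> q)))"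
  proof
    fix q
    show "c * (LINT \<tau>|lborel. indicator (C \<times> {0<..}) (q, \<tau>) *\<^sub>R k \<tau> q) = indicator C q *\<^sub>R (c * (LBINT \<tau>:{0<..}. k \<tau> q))"
      by (cases "q \<in> C") (simp_all add: set_lebesgue_integral_def indicator_times)
  qed
  finally show "set_integrable lborel C (\<lambda>q. c * (LBINT \<tau>:{0<..}. k \<tau> q))" by (simp add: set_integrable_def)
next
  fix f g assume "test_function f \<and> test_function g \<and> supp g \<times> supp f \<subseteq> U"
  then have f: "test_function f" and g: "test_function g" and sub: "supp g \<times> supp f \<subseteq> U" by auto
  define C where "C = supp g \<times> supp f"
  have C: "compact C" "C \<subseteq> U" unfolding C_def using sub f g by (auto intro: compact_Times test_function_compact)
  obtain B where B: "(\<lambda>q. f (snd q) * cnj (g (fst q))) \<in> borel_measurable borel" "\<And>q. cmod (f (snd q) * cnj (g (fst q))) \<le> B"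
    "\<And>q. q \<notin> C \<Longrightarrow> f (snd q) * cnj (g (fst q)) = 0"
    unfolding C_def by (rule test_functions_product[OF f g]) blast
  define b where "b q = f (snd q) * cnj (g (fst q))" for q
  have bm: "(\<lambda>x. b (fst x)) \<in> borel_measurable (lborel \<Otimes>\<^sub>M lborel)"
    using measurable_compose[OF measurable_fst, of b lborel borel lborel] B(1) by (simp add: b_def[abs_def])
  define \<kappa> where "\<kappa> x = indicator (C \<times> {0<..}) x *\<^sub>R (case x of (q, \<tau>) \<Rightarrow> k \<tau> q)" for x
  have \<kappa>: "integrable (lborel \<Otimes>\<^sub>M lborel) \<kappa>"
    using int[OF C] by (simp add: set_integrable_def lborel_prod \<kappa>_def[abs_def])
  have "integrable (lborel \<Otimes>\<^sub>M lborel) (\<lambda>x. \<kappa> x * b (fst x))"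
  proof (rule Bochner_Integration.integrable_bound)
    show "integrable (lborel \<Otimes>\<^sub>M lborel) (\<lambda>x. norm (\<kappa> x) * B)" using \<kappa> by (intro integrable_mult_left integrable_norm)
    show "(\<lambda>x. \<kappa> x * b (fst x)) \<in> borel_measurable (lborel \<Otimes>\<^sub>M lborel)"
      by (intro borel_measurable_times bm borel_measurable_integrable[OF \<kappa>])
    show "AE x in lborel \<Otimes>\<^sub>M lborel. norm (\<kappa> x * b (fst x)) \<le> norm (norm (\<kappa> x) * B)"
    proof (rule AE_I2)
      fix x
      have "norm (\<kappa> x) * norm (b (fst x)) \<le> norm (\<kappa> x) * B" unfolding b_def by (intro mult_left_mono B) simp
      then show "norm (\<kappa> x * b (fst x)) \<le> norm (norm (\<kappa> x) * B)" by (simp add: norm_mult)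
    qed
  qed
  then have swap: "(LINT q|lborel. LINT \<tau>|lborel. \<kappa> (q, \<tau>) * b q) = (LINT \<tau>|lborel. LINT q|lborel. \<kappa> (q, \<tau>) * b q)"
    by (intro lborel_pair.Fubini_integral[symmetric]) (simp add: case_prod_beta')
  \<comment> \<open>Off C the product of the test functions vanishes, so the cut-off to C inside
    \<open>\<kappa>\<close> disappears.\<close>
  have \<kappa>b: "\<kappa> (q, \<tau>) * b q = indicator {0<..} \<tau> *\<^sub>R (k \<tau> q * b q)" for q \<tau>
    using B(3)[of q] by (cases "q \<in> C") (auto simp: \<kappa>_def b_def split: split_indicator)
  have "L2_inner (T f) g = c * (LBINT \<tau>:{0<..}. LINT q|lborel. tested (k \<tau>) f g q)"
    using T f g unfolding integral_kernel_is_integral_def by blast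
  also have "(LBINT \<tau>:{0<..}. LINT q|lborel. tested (k \<tau>) f g q) = (LINT \<tau>|lborel. LINT q|lborel. \<kappa> (q, \<tau>) * b q)"
    unfolding \<kappa>b set_lebesgue_integral_def tested_eq b_def[symmetric] by simp
  also have "\<dots> = (LINT q|lborel. (LBINT \<tau>:{0<..}. k \<tau> q) * b q)"
  proof -
    have E: "(LINT \<tau>|lborel. \<kappa> (q, \<tau>) * b q) = (LBINT \<tau>:{0<..}. k \<tau> q) * b q" for q
      unfolding \<kappa>b mult_scaleR_left[symmetric] set_lebesgue_integral_def by (rule integral_mult_left_zero)
    show ?thesis unfolding swap[symmetric] E ..
  qed
  also have "c * \<dots> = (LINT q|lborel. c * ((LBINT \<tau>:{0<..}. k \<tau> q) * b q))"
    by (rule integral_mult_right_zero[symmetric])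
  also have "\<dots> = (LINT q|lborel. tested (\<lambda>q. c * (LBINT \<tau>:{0<..}. k \<tau> q)) f g q)"
    unfolding tested_eq b_def by (simp only: mult.assoc)
  finally show "L2_inner (T f) g = (LINT q|lborel. tested (\<lambda>q. c * (LBINT \<tau>:{0<..}. k \<tau> q)) f g q)" .
qed

text \<open>Both kernels give the same pairings with tensor products supported in U, so their
  difference vanishes weakly there.\<close>

lemma integral_kernel_on_unique:
  assumes U: "open U" and S: "integral_kernel_on U T S" and S': "integral_kernel_on U T S'"
  shows "AE q in lborel. q \<in> U \<longrightarrow> S q = S' q"
proof -
  have "AE q in lborel. q \<in> U \<longrightarrow> S q - S' q = 0"
  proof (rule AE_zero_if_tensor_integrals_zero[OF U])
    fix C assume "compact C" "C \<subseteq> U"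
    then have "set_integrable lborel C S" "set_integrable lborel C S'" using S S' unfolding integral_kernel_on_def by blast+
    then show "set_integrable lborel C (\<lambda>q. S q - S' q)" by (rule set_integral_diff)
  next
    fix f g :: "complex \<times> real \<Rightarrow> complex"
    assume "continuous_on UNIV f" "compact (supp f)" "continuous_on UNIV g" "compact (supp g)" and sub: "supp g \<times> supp f \<subseteq> U"
    then have f: "test_function f" and g: "test_function g" by (auto simp: test_function_def)
    have C: "compact (supp g \<times> supp f)" using f g by (intro compact_Times test_function_compact)
    have i: "integrable lborel (tested S f g)" "integrable lborel (tested S' f g)"
      using S S' C sub unfolding integral_kernel_on_def by (auto intro!: tested_integrable f g)
    have "(LINT (x, y)|lborel. (S (x, y) - S' (x, y)) * f y * cnj (g x)) = (LINT q|lborel. tested S f g q - tested S' f g q)"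
      by (intro Bochner_Integration.integral_cong) (auto simp: tested_def algebra_simps)
    also have "\<dots> = (LINT q|lborel. tested S f g q) - (LINT q|lborel. tested S' f g q)"
      by (rule Bochner_Integration.integral_diff[OF i])
    also have "\<dots> = L2_inner (T f) g - L2_inner (T f) g"
      using S S' f g sub unfolding integral_kernel_on_def by metis
    finally show "(LINT (x, y)|lborel. (S (x, y) - S' (x, y)) * f y * cnj (g x)) = 0" by simp
  qed
  then show ?thesis by simp
qed

theorem proposition2:
  fixes p :: "complex \<Rightarrow> real"
  assumes nonneg: "\<And>z. 0 \<le> p z"
    and C1: "C1_function p"
  shows "integral_kernel_is_integral (szego_projection p) (1 / (2 * complex_of_real pi)) (szego_integrand p)
    \<and> (\<forall>U. open U \<and>
          (\<forall>C. compact C \<and> C \<subseteq> U \<longrightarrow>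
             set_integrable lborel (C \<times> {0<..}) (\<lambda>(q, \<tau>). szego_integrand p \<tau> q)) \<longrightarrow>
          integral_kernel_on U (szego_projection p)
            (\<lambda>q. 1 / (2 * complex_of_real pi) * (LBINT \<tau>:{0<..}. szego_integrand p \<tau> q)) \<and>
          (\<forall>S. integral_kernel_on U (szego_projection p) S \<longrightarrow>
             (AE q in lborel. q \<in> U \<longrightarrow>
                S q = 1 / (2 * complex_of_real pi) * (LBINT \<tau>:{0<..}. szego_integrand p \<tau> q))))"
proof -
  have "continuous_on UNIV p"
    using C1 has_derivative_continuous unfolding C1_function_def continuous_on_eq_continuous_at[OF open_UNIV] by blast
  with nonneg interpret continuous_weight p by unfold_locales
  note D = szego_kernel_distributional
  show ?thesis
  proof (intro conjI allI impI)
    fix U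
    assume U: "open U \<and> (\<forall>C. compact C \<and> C \<subseteq> U \<longrightarrow> set_integrable lborel (C \<times> {0<..}) (\<lambda>(q, \<tau>). szego_integrand p \<tau> q))"
    show K: "integral_kernel_on U (szego_projection p) (\<lambda>q. 1 / (2 * complex_of_real pi) * (LBINT \<tau>:{0<..}. szego_integrand p \<tau> q))"
      by (rule integral_kernel_is_integral_on[OF D]) (simp add: U)
    fix S assume S: "integral_kernel_on U (szego_projection p) S"
    show "AE q in lborel. q \<in> U \<longrightarrow> S q = 1 / (2 * complex_of_real pi) * (LBINT \<tau>:{0<..}. szego_integrand p \<tau> q)"
      by (rule integral_kernel_on_unique[OF conjunct1[OF U] S K])
  qed (rule D)
qed

end
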